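(* Let $T$ be an $\mathrm{NSOP}_{3}$ theory, and assume that the relation $\downarrow^{K^{*}d}$ is symmetric in $T$. Let $M$ be a model of $T$, and suppose $p$ and $q$ are global $M$-invariant types with $p^{(\omega)}|_{M}=q^{(\omega)}|_{M}$. Let $a,b\supseteq M$ be small supersets of $M$ with $a\downarrow^{K}_{M}b$. Then there is $c\models p(x)|_{a}\cup q(x)|_{b}$ with $c\downarrow^{K^{*}d}_{M}ab$.
   Context: $T$ is a complete first-order theory, $\mathbb{M}$ a sufficiently saturated model of $T$, and $M\prec\mathbb{M}$ is small. For $n\ge 3$, a theory has $\mathrm{SOP}_{n}$ if there is a definable relation $R(x_{1},x_{2})$ (on tuples) with no $n$-cycles, but with tuples $\{a_{i}\}_{i\in\omega}$ such that $\models R(a_{i},a_{j})$ for all $i<j$. Otherwise it is $\mathrm{NSOP}_{n}$. A global type is a complete type over $\mathbb{M}$. A global type $p(x)$ is $M$-invariant if $\varphi(x,b)\in p$ and $b'\equiv_{M}b$ imply $\varphi(x,b')\in p$. For an $M$-invariant type $p$, $p^{(\omega)}$ is the $M$-invariant type such that, for $A\supseteq M$, $\{a_{i}\}_{i\in\omega}\models p^{(\omega)}|_{A}$ iff $a_{i}\models p|_{A\{a_{j}\}_{j<i}}$ for all $i$. An invariant Morley sequence over $M$ is a sequence $\{b_{i}\}_{i\in\omega}$ such that, for some fixed global $M$-invariant type $p$, $b_{i}\models p|_{M\{b_{j}\}_{j<i}}$ for all $i$. A formula $\varphi(x,b)$ Kim-divides over $M$ if there is an invariant Morley sequence $\{b_{i}\}_{i\in\omega}$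 over $M$ with $b_{0}=b$ such that $\{\varphi(x,b_{i})\}_{i\in\omega}$ is inconsistent; it Kim-forks over $M$ if it implies a finite disjunction of formulas Kim-dividing over $M$. $a\downarrow^{K}_{M}b$ means $\mathrm{tp}(a/Mb)$ contains no formula Kim-forking over $M$. A formula $\varphi(x,b)$ Conant-divides over $M$ if for every invariant Morley sequence $\{b_{i}\}_{i\in\omega}$ over $M$ with $b_{0}=b$, $\{\varphi(x,b_{i})\}_{i\in\omega}$ is inconsistent. $a\downarrow^{K^{*}d}_{M}b$ means $\mathrm{tp}(a/Mb)$ contains no formula Conant-dividing over $M$. The relation $\downarrow^{K^{*}d}$ is symmetric if for all $M,a,b$, $a\downarrow^{K^{*}d}_{M}b$ implies $b\downarrow^{K^{*}d}_{M}a$. *)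

theory Defs
  imports Main
begin

section \<open>First-order logic\<close>

text \<open>
  Bound variables are de Bruijn indices \<open>Bnd n\<close>; free variables \<open>Fre v\<close> are drawn from an
  arbitrary type \<open>'v\<close>. Hence \<open>fv\<close> and \<open>map_fm\<close>, which come with the datatype, are the set of free
  variables and the (capture-free) renaming of free variables.
\<close>

datatype (trm_funs: 'f, trm_vars: 'v) trm =
  Bnd nat
| Fre 'v
| Fn 'f "('f, 'v) trm list"

datatype (fm_funs: 'f, fm_rels: 'r, fv: 'v) fm =
  Eq "('f, 'v) trm" "('f, 'v) trm"
| Rel 'r "('f, 'v) trm list"
| Neg "('f, 'r, 'v) fm"
| And "('f, 'r, 'v) fm" "('f, 'r, 'v) fm"
| Ex "('f, 'r, 'v) fm"
for map: map_fm

text \<open>A language is a set of function symbols and a set of relation symbols, tagged with arities.\<close>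

record ('f, 'r) lang =
  funs :: "('f \<times> nat) set"
  rels :: "('r \<times> nat) set"

record ('f, 'r, 'a) struct =
  univ :: "'a set"
  fint :: "'f \<Rightarrow> 'a list \<Rightarrow> 'a"
  rint :: "'r \<Rightarrow> 'a list \<Rightarrow> bool"

text \<open>The number \<open>k\<close> bounds the de Bruijn indices that may occur unbound.\<close>

primrec wf_trm :: "('f, 'r) lang \<Rightarrow> nat \<Rightarrow> ('f, 'v) trm \<Rightarrow> bool" where
  "wf_trm L k (Bnd n) \<longleftrightarrow> n < k"
| "wf_trm L k (Fre v) \<longleftrightarrow> True"
| "wf_trm L k (Fn f ts) \<longleftrightarrow> (f, length ts) \<in> funs L \<and> list_all (wf_trm L k) ts"

primrec wf_fm :: "('f, 'r) lang \<Rightarrow> nat \<Rightarrow> ('f, 'r, 'v) fm \<Rightarrow> bool" where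
  "wf_fm L k (Eq t u) \<longleftrightarrow> wf_trm L k t \<and> wf_trm L k u"
| "wf_fm L k (Rel r ts) \<longleftrightarrow> (r, length ts) \<in> rels L \<and> list_all (wf_trm L k) ts"
| "wf_fm L k (Neg \<phi>) \<longleftrightarrow> wf_fm L k \<phi>"
| "wf_fm L k (And \<phi> \<psi>) \<longleftrightarrow> wf_fm L k \<phi> \<and> wf_fm L k \<psi>"
| "wf_fm L k (Ex \<phi>) \<longleftrightarrow> wf_fm L (Suc k) \<phi>"

definition Fm :: "('f, 'r) lang \<Rightarrow> 'v set \<Rightarrow> ('f, 'r, 'v) fm set" where
  "Fm L V = {\<phi>. wf_fm L 0 \<phi> \<and> fv \<phi> \<subseteq> V}"

primrec eval :: "('f, 'r, 'a) struct \<Rightarrow> 'a list \<Rightarrow> ('v \<Rightarrow> 'a) \<Rightarrow> ('f, 'v) trm \<Rightarrow> 'a" where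
  "eval \<AA> e s (Bnd n) = e ! n"
| "eval \<AA> e s (Fre v) = s v"
| "eval \<AA> e s (Fn f ts) = fint \<AA> f (map (eval \<AA> e s) ts)"

primrec sat :: "('f, 'r, 'a) struct \<Rightarrow> 'a list \<Rightarrow> ('v \<Rightarrow> 'a) \<Rightarrow> ('f, 'r, 'v) fm \<Rightarrow> bool" where
  "sat \<AA> e s (Eq t u) \<longleftrightarrow> eval \<AA> e s t = eval \<AA> e s u"
| "sat \<AA> e s (Rel r ts) \<longleftrightarrow> rint \<AA> r (map (eval \<AA> e s) ts)"
| "sat \<AA> e s (Neg \<phi>) \<longleftrightarrow> \<not> sat \<AA> e s \<phi>"
| "sat \<AA> e s (And \<phi> \<psi>) \<longleftrightarrow> sat \<AA> e s \<phi> \<and> sat \<AA> e s \<psi>"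
| "sat \<AA> e s (Ex \<phi>) \<longleftrightarrow> (\<exists>x\<in>univ \<AA>. sat \<AA> (x # e) s \<phi>)"

definition holds :: "('f, 'r, 'a) struct \<Rightarrow> ('v \<Rightarrow> 'a) \<Rightarrow> ('f, 'r, 'v) fm \<Rightarrow> bool" where
  "holds \<AA> s \<phi> \<longleftrightarrow> sat \<AA> [] s \<phi>"

definition is_struct :: "('f, 'r) lang \<Rightarrow> ('f, 'r, 'a) struct \<Rightarrow> bool" where
  "is_struct L \<AA> \<longleftrightarrow> univ \<AA> \<noteq> {} \<and>
     (\<forall>(f, n)\<in>funs L. \<forall>xs. length xs = n \<and> set xs \<subseteq> univ \<AA> \<longrightarrow> fint \<AA> f xs \<in> univ \<AA>)"

text \<open>Sentences use \<open>nat\<close> as a dummy type of free variables.\<close>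

definition complete_theory :: "('f, 'r) lang \<Rightarrow> ('f, 'r, nat) fm set \<Rightarrow> bool" where
  "complete_theory L T \<longleftrightarrow> T \<subseteq> Fm L {} \<and> (\<forall>\<sigma>\<in>Fm L {}. \<sigma> \<in> T \<or> Neg \<sigma> \<in> T)"

definition is_model :: "('f, 'r) lang \<Rightarrow> ('f, 'r, nat) fm set \<Rightarrow> ('f, 'r, 'a) struct \<Rightarrow> bool" where
  "is_model L T \<AA> \<longleftrightarrow> is_struct L \<AA> \<and> (\<forall>\<sigma>\<in>T. \<forall>s. holds \<AA> s \<sigma>)"

definition elem_sub :: "('f, 'r) lang \<Rightarrow> 'a set \<Rightarrow> ('f, 'r, 'a) struct \<Rightarrow> bool" where
  "elem_sub L M \<AA> \<longleftrightarrow> M \<subseteq> univ \<AA> \<and> is_struct L (\<AA>\<lparr>univ := M\<rparr>) \<and>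
     (\<forall>\<phi>\<in>Fm L (UNIV :: nat set). \<forall>s. range s \<subseteq> M \<longrightarrow>
        (holds (\<AA>\<lparr>univ := M\<rparr>) s \<phi> \<longleftrightarrow> holds \<AA> s \<phi>))"


section \<open>Types\<close>

text \<open>
  A tuple indexed by a set \<open>I\<close> is a function of which only the values on \<open>I\<close> matter; finite
  tuples are indexed by \<open>{..<n}\<close>. A formula \<open>\<phi>(x, b)\<close> with parameters in the structure is a
  formula whose free variables are \<open>Inl i\<close> (the variable \<open>x\<^sub>i\<close>) or \<open>Inr m\<close> (a name for the element
  \<open>m\<close>). A formula \<open>\<phi>(x, y)\<close> with \<open>y\<close> an \<open>n\<close>-tuple has variables \<open>Inl i\<close> and \<open>Inr j\<close>, \<open>j < n\<close>; then
  \<open>inst \<phi> b\<close> is \<open>\<phi>(x, b)\<close>. Variables in \<open>y\<close> need not actually occur in \<open>\<phi>\<close>.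
\<close>

definition inst :: "('f, 'r, 'i + nat) fm \<Rightarrow> (nat \<Rightarrow> 'a) \<Rightarrow> ('f, 'r, 'i + 'a) fm" where
  "inst \<phi> b = map_fm id id (map_sum id b) \<phi>"

lemma eval_map_trm: "eval \<AA> e s (map_trm id g t) = eval \<AA> e (s \<circ> g) t"
  by (induction t) (auto intro!: arg_cong[where f = "fint \<AA> _"])

lemma sat_map_fm: "sat \<AA> e s (map_fm id id g \<phi>) \<longleftrightarrow> sat \<AA> e (s \<circ> g) \<phi>"
  by (induction \<phi> arbitrary: e) (auto simp: eval_map_trm comp_def)

lemma holds_inst: "holds \<AA> (case_sum c id) (inst \<phi> b) \<longleftrightarrow> holds \<AA> (case_sum c b) \<phi>"
proof -
  have "case_sum c id \<circ> map_sum id b = case_sum c b"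
    by (auto split: sum.splits simp: fun_eq_iff)
  then show ?thesis
    by (simp add: inst_def holds_def sat_map_fm)
qed

definition realizes ::
  "('f, 'r, 'a) struct \<Rightarrow> 'i set \<Rightarrow> ('i \<Rightarrow> 'a) \<Rightarrow> ('f, 'r, 'i + 'a) fm set \<Rightarrow> bool" where
  "realizes \<AA> I c \<Phi> \<longleftrightarrow> c ` I \<subseteq> univ \<AA> \<and> (\<forall>\<phi>\<in>\<Phi>. holds \<AA> (case_sum c id) \<phi>)"

definition consistent :: "('f, 'r, 'a) struct \<Rightarrow> 'i set \<Rightarrow> ('f, 'r, 'i + 'a) fm set \<Rightarrow> bool" where
  "consistent \<AA> I \<Phi> \<longleftrightarrow> (\<forall>F. finite F \<and> F \<subseteq> \<Phi> \<longrightarrow> (\<exists>c. realizes \<AA> I c F))"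

definition complete_type ::
  "('f, 'r) lang \<Rightarrow> ('f, 'r, 'a) struct \<Rightarrow> 'i set \<Rightarrow> 'a set \<Rightarrow> ('f, 'r, 'i + 'a) fm set \<Rightarrow> bool" where
  "complete_type L \<AA> I A p \<longleftrightarrow> p \<subseteq> Fm L (Inl ` I \<union> Inr ` A) \<and> consistent \<AA> I p \<and>
     (\<forall>\<phi>\<in>Fm L (Inl ` I \<union> Inr ` A). \<phi> \<in> p \<or> Neg \<phi> \<in> p)"

definition tp ::
  "('f, 'r) lang \<Rightarrow> ('f, 'r, 'a) struct \<Rightarrow> 'i set \<Rightarrow> ('i \<Rightarrow> 'a) \<Rightarrow> 'a set \<Rightarrow> ('f, 'r, 'i + 'a) fm set" where
  "tp L \<AA> I a A = {\<phi> \<in> Fm L (Inl ` I \<union> Inr ` A). holds \<AA> (case_sum a id) \<phi>}"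

definition restr ::
  "('f, 'r, 'i + 'a) fm set \<Rightarrow> 'a set \<Rightarrow> ('f, 'r, 'i + 'a) fm set" (infixl "\<restriction>" 90) where
  "p \<restriction> A = {\<phi> \<in> p. fv \<phi> \<subseteq> range Inl \<union> Inr ` A}"


section \<open>The monster model\<close>

text \<open>
  Small means of cardinality less than the saturation cardinal \<open>\<kappa>\<close>, which is required to exceed
  the cardinality of the language and to be uncountable.
\<close>

definition small :: "'k rel \<Rightarrow> 'b set \<Rightarrow> bool" where
  "small \<kappa> A \<longleftrightarrow> (card_of A, \<kappa>) \<in> ordLess"

definition saturated :: "('f, 'r) lang \<Rightarrow> 'k rel \<Rightarrow> ('f, 'r, 'a) struct \<Rightarrow> bool" where
  "saturated L \<kappa> \<AA> \<longleftrightarrow> (\<forall>A p. A \<subseteq> univ \<AA> \<and> small \<kappa> A \<and> complete_type L \<AA> (UNIV :: unit set) A p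
     \<longrightarrow> (\<exists>c. realizes \<AA> UNIV c p))"

definition monster ::
  "('f, 'r) lang \<Rightarrow> ('f, 'r, nat) fm set \<Rightarrow> 'k rel \<Rightarrow> ('f, 'r, 'a) struct \<Rightarrow> bool" where
  "monster L T \<kappa> \<MM> \<longleftrightarrow> Card_order \<kappa> \<and> small \<kappa> (UNIV :: nat set) \<and> small \<kappa> (funs L) \<and>
     small \<kappa> (rels L) \<and> is_model L T \<MM> \<and> saturated L \<kappa> \<MM>"

definition small_model :: "('f, 'r) lang \<Rightarrow> 'k rel \<Rightarrow> ('f, 'r, 'a) struct \<Rightarrow> 'a set \<Rightarrow> bool" where
  "small_model L \<kappa> \<MM> M \<longleftrightarrow> elem_sub L M \<MM> \<and> small \<kappa> M"

text \<open>
  A complete theory is \<open>SOP n\<close> if its monster model \<open>\<MM>\<close> is. The relation is defined without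
  parameters.
\<close>

definition SOP :: "('f, 'r) lang \<Rightarrow> ('f, 'r, 'a) struct \<Rightarrow> nat \<Rightarrow> bool" where
  "SOP L \<MM> n \<longleftrightarrow> (\<exists>m. \<exists>R\<in>Fm L (Inl ` {..<m} \<union> Inr ` {..<m} :: (nat + nat) set).
     (\<nexists>e. (\<forall>i<n. e i ` {..<m} \<subseteq> univ \<MM>) \<and>
          (\<forall>i<n. holds \<MM> (case_sum (e i) (e (Suc i mod n))) R)) \<and>
     (\<exists>a :: nat \<Rightarrow> nat \<Rightarrow> 'a. (\<forall>i. a i ` {..<m} \<subseteq> univ \<MM>) \<and>
          (\<forall>i j. i < j \<longrightarrow> holds \<MM> (case_sum (a i) (a j)) R)))"


section \<open>Invariant types and Morley sequences\<close>

definition invariant_type ::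
  "('f, 'r) lang \<Rightarrow> ('f, 'r, 'a) struct \<Rightarrow> 'a set \<Rightarrow> 'i set \<Rightarrow> ('f, 'r, 'i + 'a) fm set \<Rightarrow> bool" where
  "invariant_type L \<MM> M I p \<longleftrightarrow> complete_type L \<MM> I (univ \<MM>) p \<and>
     (\<forall>n b b'. \<forall>\<phi>\<in>Fm L (Inl ` I \<union> Inr ` {..<n}).
        b ` {..<n} \<subseteq> univ \<MM> \<and> b' ` {..<n} \<subseteq> univ \<MM> \<and> tp L \<MM> {..<n} b' M = tp L \<MM> {..<n} b M \<and>
        inst \<phi> b \<in> p \<longrightarrow> inst \<phi> b' \<in> p)"

definition morley_seq_of ::
  "('f, 'r, 'a) struct \<Rightarrow> 'i set \<Rightarrow> ('f, 'r, 'i + 'a) fm set \<Rightarrow> 'a set \<Rightarrow> (nat \<Rightarrow> 'i \<Rightarrow> 'a) \<Rightarrow> bool" where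
  "morley_seq_of \<MM> I p A a \<longleftrightarrow> (\<forall>i. realizes \<MM> I (a i) (p \<restriction> (A \<union> (\<Union>j<i. a j ` I))))"

definition invariant_morley_seq ::
  "('f, 'r) lang \<Rightarrow> ('f, 'r, 'a) struct \<Rightarrow> 'a set \<Rightarrow> 'i set \<Rightarrow> (nat \<Rightarrow> 'i \<Rightarrow> 'a) \<Rightarrow> bool" where
  "invariant_morley_seq L \<MM> M I a \<longleftrightarrow>
     (\<exists>p. invariant_type L \<MM> M I p \<and> morley_seq_of \<MM> I p M a)"

text \<open>\<open>r\<close> is the type \<open>p\<^bsup>(\<omega>)\<^esup>\<close>, in the variables \<open>x\<^bsub>(i, k)\<^esub>\<close> with \<open>i \<in> \<omega>\<close> and \<open>k \<in> I\<close>.\<close>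

definition is_omega_power ::
  "('f, 'r) lang \<Rightarrow> 'k rel \<Rightarrow> ('f, 'r, 'a) struct \<Rightarrow> 'a set \<Rightarrow> 'i set \<Rightarrow> ('f, 'r, 'i + 'a) fm set \<Rightarrow>
    ('f, 'r, (nat \<times> 'i) + 'a) fm set \<Rightarrow> bool" where
  "is_omega_power L \<kappa> \<MM> M I p r \<longleftrightarrow> invariant_type L \<MM> M (UNIV \<times> I) r \<and>
     (\<forall>A a. M \<subseteq> A \<and> A \<subseteq> univ \<MM> \<and> small \<kappa> A \<longrightarrow>
        (realizes \<MM> (UNIV \<times> I) (case_prod a) (r \<restriction> A) \<longleftrightarrow> morley_seq_of \<MM> I p A a))"


section \<open>Kim-independence and Conant-independence\<close>

definition kim_divides ::
  "('f, 'r) lang \<Rightarrow> ('f, 'r, 'a) struct \<Rightarrow> 'a set \<Rightarrow> 'i set \<Rightarrow> nat \<Rightarrow>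
    ('f, 'r, 'i + nat) fm \<Rightarrow> (nat \<Rightarrow> 'a) \<Rightarrow> bool" where
  "kim_divides L \<MM> M I n \<phi> b \<longleftrightarrow> (\<exists>bs. invariant_morley_seq L \<MM> M {..<n} bs \<and>
     (\<forall>j<n. bs 0 j = b j) \<and> \<not> consistent \<MM> I (range (\<lambda>i. inst \<phi> (bs i))))"

definition conant_divides ::
  "('f, 'r) lang \<Rightarrow> ('f, 'r, 'a) struct \<Rightarrow> 'a set \<Rightarrow> 'i set \<Rightarrow> nat \<Rightarrow>
    ('f, 'r, 'i + nat) fm \<Rightarrow> (nat \<Rightarrow> 'a) \<Rightarrow> bool" where
  "conant_divides L \<MM> M I n \<phi> b \<longleftrightarrow> (\<forall>bs. invariant_morley_seq L \<MM> M {..<n} bs \<and>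
     (\<forall>j<n. bs 0 j = b j) \<longrightarrow> \<not> consistent \<MM> I (range (\<lambda>i. inst \<phi> (bs i))))"

text \<open>\<open>S\<close> is the finite set of disjuncts \<open>\<psi>(x, d)\<close>, with \<open>d\<close> a \<open>k\<close>-tuple.\<close>

definition kim_forks ::
  "('f, 'r) lang \<Rightarrow> ('f, 'r, 'a) struct \<Rightarrow> 'a set \<Rightarrow> 'i set \<Rightarrow>
    ('f, 'r, 'i + nat) fm \<Rightarrow> (nat \<Rightarrow> 'a) \<Rightarrow> bool" where
  "kim_forks L \<MM> M I \<phi> b \<longleftrightarrow> (\<exists>S. finite S \<and>
     (\<forall>(k, \<psi>, d)\<in>S. \<psi> \<in> Fm L (Inl ` I \<union> Inr ` {..<k}) \<and> d ` {..<k} \<subseteq> univ \<MM> \<and>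
        kim_divides L \<MM> M I k \<psi> d) \<and>
     (\<forall>c. realizes \<MM> I c {inst \<phi> b} \<longrightarrow> (\<exists>(k, \<psi>, d)\<in>S. realizes \<MM> I c {inst \<psi> d})))"

text \<open>
  In the independence relations the left-hand side is a tuple \<open>a\<close> indexed by \<open>I\<close>; a set \<open>A\<close> is
  read as the tuple \<open>id\<close> indexed by \<open>A\<close>. On the right-hand side only the set of entries matters.
\<close>

definition kim_indep ::
  "('f, 'r) lang \<Rightarrow> ('f, 'r, 'a) struct \<Rightarrow> 'a set \<Rightarrow> 'i set \<Rightarrow> ('i \<Rightarrow> 'a) \<Rightarrow> 'a set \<Rightarrow> bool" where
  "kim_indep L \<MM> M I a B \<longleftrightarrow> (\<forall>n d. \<forall>\<phi>\<in>Fm L (Inl ` I \<union> Inr ` {..<n}).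
     d ` {..<n} \<subseteq> M \<union> B \<and> inst \<phi> d \<in> tp L \<MM> I a (M \<union> B) \<longrightarrow> \<not> kim_forks L \<MM> M I \<phi> d)"

definition conant_indep ::
  "('f, 'r) lang \<Rightarrow> ('f, 'r, 'a) struct \<Rightarrow> 'a set \<Rightarrow> 'i set \<Rightarrow> ('i \<Rightarrow> 'a) \<Rightarrow> 'a set \<Rightarrow> bool" where
  "conant_indep L \<MM> M I a B \<longleftrightarrow> (\<forall>n d. \<forall>\<phi>\<in>Fm L (Inl ` I \<union> Inr ` {..<n}).
     d ` {..<n} \<subseteq> M \<union> B \<and> inst \<phi> d \<in> tp L \<MM> I a (M \<union> B) \<longrightarrow> \<not> conant_divides L \<MM> M I n \<phi> d)"

definition conant_indep_symmetric :: "('f, 'r) lang \<Rightarrow> 'k rel \<Rightarrow> ('f, 'r, 'a) struct \<Rightarrow> bool" where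
  "conant_indep_symmetric L \<kappa> \<MM> \<longleftrightarrow> (\<forall>M A B.
     small_model L \<kappa> \<MM> M \<and> A \<subseteq> univ \<MM> \<and> small \<kappa> A \<and> B \<subseteq> univ \<MM> \<and> small \<kappa> B \<and>
     conant_indep L \<MM> M A id B \<longrightarrow> conant_indep L \<MM> M B id A)"

end

theory Submission
  imports Defs "HOL-Library.Infinite_Set"
begin

text \<open>
  Conant-independence is reduced to a consistency question as follows. Let \<open>c\<^sub>0, c\<^sub>1, \<dots>\<close> be a Morley
  sequence of \<open>p\<close> over \<open>M\<close> whose members all have the same type over \<open>ab\<close>. A formula that \<open>ab\<close>
  satisfies together with \<open>c\<^sub>0\<close> then has the solution \<open>ab\<close> along the whole sequence, so it does not
  Conant-divide. Thus \<open>ab\<close> is Conant-independent from \<open>c\<^sub>0\<close> (\<open>conant_indep_morley\<close>), and symmetry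
  gives the independence of \<open>c\<^sub>0\<close> from \<open>ab\<close>. A realization of \<open>p\<^sup>\<omega>|a \<union> q\<^sup>\<omega>|b\<close> is a Morley sequence of
  \<open>p\<close> over \<open>M\<close> with members realizing \<open>p|a \<union> q|b\<close>, and it can be thinned out until the members have
  the same type over \<open>ab\<close> (\<open>morley_thin\<close>). Since \<open>p\<^sup>\<omega>\<close> and \<open>q\<^sup>\<omega>\<close> have the same Morley sequences over
  \<open>M\<close> as well (\<open>omega_power_morley\<close>), what remains is to show that \<open>p|a \<union> q|b\<close> is consistent for
  invariant types \<open>p\<close> and \<open>q\<close> with the same Morley sequences over \<open>M\<close> (\<open>amalgam_consistent\<close>).

  Suppose that \<open>\<phi>(x, a)\<close> in \<open>p\<close> and \<open>\<psi>(x, b)\<close> in \<open>q\<close> are inconsistent with each other. As \<open>a\<close> is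
  Kim-independent from \<open>b\<close>, there are copies \<open>f\<^sub>j\<close> of \<open>a\<close> over \<open>M\<close> and a Morley sequence of copies
  \<open>g\<^sub>i\<close> of \<open>b\<close>, each \<open>g\<^sub>i\<close> realizing an invariant type over everything chosen before, such that
  \<open>\<phi>(x, f\<^sub>j)\<close> and \<open>\<psi>(x, g\<^sub>i)\<close> are inconsistent for \<open>i < j\<close> (\<open>kim_indep_copy\<close>,
  \<open>interleaved_copies\<close>). Elements \<open>c\<^sub>i\<close> that satisfy \<open>\<phi>(x, f\<^sub>l)\<close> for \<open>l \<le> i\<close> and \<open>\<psi>(x, g\<^sub>l)\<close> for
  \<open>l > i\<close> complete these to the third strong order property (\<open>SOP3_criterion\<close>).

  The elements \<open>c\<^sub>i\<close> are found inside sequences that are Morley sequences of \<open>p\<close>, and hence also of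
  \<open>q\<close>, over \<open>M\<close> (\<open>chain_blocks\<close>). The main tool is \<open>morley_absorb\<close>: suppose that finite blocks of a
  Morley sequence of an invariant type over \<open>C\<close> satisfy some conditions over \<open>Y\<close>, and that \<open>b\<close>
  realizes an invariant type over \<open>C \<union> Y\<close>. Then the sequence can be replaced by one that satisfies
  the same conditions and is Morley over \<open>C \<union> b\<close>; a failure of this already yields the third
  strong order property. Read as a sequence of \<open>q\<close>, the sequence absorbs \<open>g\<^sub>l\<close>, after which all its
  members satisfy \<open>\<psi>(x, g\<^sub>l)\<close>. Read as a sequence of \<open>p\<close>, it absorbs new realizations of \<open>p\<close> over
  \<open>f\<^sub>0, \<dots>, f\<^sub>l\<close>, one for each block (\<open>morley_insert\<close>). Alternating the two steps produces the required
  pattern.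
\<close>

section \<open>Renaming and quantifying the variables of formulas\<close>

abbreviation ren :: "('v \<Rightarrow> 'w) \<Rightarrow> ('f, 'r, 'v) fm \<Rightarrow> ('f, 'r, 'w) fm" where
  "ren g \<equiv> map_fm id id g"

lemma holds_ren: "holds \<AA> s (ren g \<phi>) \<longleftrightarrow> holds \<AA> (s \<circ> g) \<phi>"
  by (simp add: holds_def sat_map_fm)

lemma wf_trm_map: "wf_trm L k (map_trm id g t) \<longleftrightarrow> wf_trm L k t"
  by (induction t) (auto simp: list_all_iff)

lemma wf_fm_ren: "wf_fm L k (ren g \<phi>) \<longleftrightarrow> wf_fm L k \<phi>"
  by (induction \<phi> arbitrary: k) (auto simp: list_all_iff wf_trm_map)

lemma ren_in_Fm: "\<phi> \<in> Fm L V \<Longrightarrow> (\<And>v. v \<in> V \<Longrightarrow> g v \<in> W) \<Longrightarrow> ren g \<phi> \<in> Fm L W"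
  by (auto simp: Fm_def wf_fm_ren fm.set_map)

lemma Fm_mono: "V \<subseteq> W \<Longrightarrow> \<phi> \<in> Fm L V \<Longrightarrow> \<phi> \<in> Fm L W"
  by (auto simp: Fm_def)

lemma Fm_fv: "\<phi> \<in> Fm L V \<Longrightarrow> \<phi> \<in> Fm L (fv \<phi>)"
  by (auto simp: Fm_def)

lemma FmD: "\<phi> \<in> Fm L V \<Longrightarrow> fv \<phi> \<subseteq> V"
  by (auto simp: Fm_def)

lemma finite_trm_vars: "finite (trm_vars t)"
  by (induction t) auto

lemma finite_fv: "finite (fv \<phi>)"
  by (induction \<phi>) (auto simp: finite_trm_vars)

lemma eval_cong: "(\<And>v. v \<in> trm_vars t \<Longrightarrow> s v = s' v) \<Longrightarrow> eval \<AA> e s t = eval \<AA> e s' t"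
proof (induction t)
  case (Fn f ts)
  then have "map (eval \<AA> e s) ts = map (eval \<AA> e s') ts" by auto
  then show ?case by (simp only: eval.simps)
qed auto

lemma sat_cong: "(\<And>v. v \<in> fv \<phi> \<Longrightarrow> s v = s' v) \<Longrightarrow> sat \<AA> e s \<phi> = sat \<AA> e s' \<phi>"
proof (induction \<phi> arbitrary: e)
  case (Rel r ts)
  then have "map (eval \<AA> e s) ts = map (eval \<AA> e s') ts"
    by (auto intro!: eval_cong)
  then show ?case by (simp only: sat.simps)
next
  case (Eq t u)
  then have "eval \<AA> e s t = eval \<AA> e s' t" "eval \<AA> e s u = eval \<AA> e s' u"
    by (auto intro!: eval_cong)
  then show ?case by simp
qed auto

lemma holds_cong: "(\<And>v. v \<in> fv \<phi> \<Longrightarrow> s v = s' v) \<Longrightarrow> holds \<AA> s \<phi> = holds \<AA> s' \<phi>"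
  unfolding holds_def by (rule sat_cong)

lemma holds_cong_Fm: "\<phi> \<in> Fm L V \<Longrightarrow> (\<And>v. v \<in> V \<Longrightarrow> s v = s' v) \<Longrightarrow> holds \<AA> s \<phi> = holds \<AA> s' \<phi>"
  by (rule holds_cong) (auto simp: Fm_def)

lemma ren_ren: "ren g (ren h \<phi>) = ren (g \<circ> h) \<phi>"
  by (simp add: fm.map_comp)

lemma ren_cong: "(\<And>v. v \<in> fv \<phi> \<Longrightarrow> g v = h v) \<Longrightarrow> ren g \<phi> = ren h \<phi>"
  by (rule fm.map_cong) auto

lemma ren_cong_Fm: "\<phi> \<in> Fm L V \<Longrightarrow> (\<And>v. v \<in> V \<Longrightarrow> g v = h v) \<Longrightarrow> ren g \<phi> = ren h \<phi>"
  by (rule ren_cong) (auto simp: Fm_def)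

lemma ren_id: "ren id \<phi> = \<phi>" "ren (\<lambda>x. x) \<phi> = \<phi>"
  by (simp_all add: fm.map_id fm.map_id[unfolded id_def] flip: id_def)

lemma ren_preimage:
  assumes "\<psi> \<in> Fm L W" "W \<subseteq> g ` V"
  obtains \<phi> where "\<phi> \<in> Fm L V" "ren g \<phi> = \<psi>"
proof
  show "ren (inv_into V g) \<psi> \<in> Fm L V"
    using assms by (intro ren_in_Fm) (auto intro: inv_into_into)
  have "ren g (ren (inv_into V g) \<psi>) = ren id \<psi>"
    unfolding ren_ren using assms by (intro ren_cong_Fm[OF assms(1)]) (auto simp: f_inv_into_f)
  then show "ren g (ren (inv_into V g) \<psi>) = \<psi>" by (simp add: ren_id)
qed

text \<open>Binding a free variable turns it into the index that refers to a quantifier outside the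
  whole formula, hence the bound \<open>k\<close> grows under \<open>Ex\<close>.\<close>

primrec bind_trm :: "'v \<Rightarrow> nat \<Rightarrow> ('f, 'v) trm \<Rightarrow> ('f, 'v) trm" where
  "bind_trm v k (Bnd n) = Bnd n"
| "bind_trm v k (Fre w) = (if w = v then Bnd k else Fre w)"
| "bind_trm v k (Fn f ts) = Fn f (map (bind_trm v k) ts)"

primrec bind_fm :: "'v \<Rightarrow> nat \<Rightarrow> ('f, 'r, 'v) fm \<Rightarrow> ('f, 'r, 'v) fm" where
  "bind_fm v k (Eq t u) = Eq (bind_trm v k t) (bind_trm v k u)"
| "bind_fm v k (Rel r ts) = Rel r (map (bind_trm v k) ts)"
| "bind_fm v k (Neg \<phi>) = Neg (bind_fm v k \<phi>)"
| "bind_fm v k (And \<phi> \<psi>) = And (bind_fm v k \<phi>) (bind_fm v k \<psi>)"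
| "bind_fm v k (Ex \<phi>) = Ex (bind_fm v (Suc k) \<phi>)"

lemma eval_bind_trm:
  "wf_trm L (length e) t \<Longrightarrow> eval \<AA> (e @ [x]) s (bind_trm v (length e) t) = eval \<AA> e (s(v := x)) t"
  by (induction t) (auto simp: nth_append list_all_iff intro!: arg_cong[where f = "fint \<AA> _"])

lemma sat_bind_fm:
  "wf_fm L (length e) \<phi> \<Longrightarrow> sat \<AA> (e @ [x]) s (bind_fm v (length e) \<phi>) = sat \<AA> e (s(v := x)) \<phi>"
proof (induction \<phi> arbitrary: e)
  case (Rel r ts)
  then have "map (eval \<AA> (e @ [x]) s \<circ> bind_trm v (length e)) ts = map (eval \<AA> e (s(v := x))) ts"
    by (auto simp: list_all_iff intro!: eval_bind_trm)
  then show ?case by (simp only: bind_fm.simps sat.simps map_map)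
next
  case (Ex \<phi>)
  have "sat \<AA> (y # e @ [x]) s (bind_fm v (Suc (length e)) \<phi>) = sat \<AA> (y # e) (s(v := x)) \<phi>" for y
    using Ex.IH[of "y # e"] Ex.prems by (simp del: fun_upd_apply)
  then show ?case by (simp del: fun_upd_apply)
qed (auto simp: eval_bind_trm)

lemma wf_bind_trm: "wf_trm L k t \<Longrightarrow> wf_trm L (Suc k) (bind_trm v k t)"
  by (induction t) (auto simp: list_all_iff)

lemma wf_bind_fm: "wf_fm L k \<phi> \<Longrightarrow> wf_fm L (Suc k) (bind_fm v k \<phi>)"
  by (induction \<phi> arbitrary: k) (auto simp: list_all_iff wf_bind_trm)

lemma vars_bind_trm: "trm_vars (bind_trm v k t) = trm_vars t - {v}"
  by (induction t) auto

lemma fv_bind_fm: "fv (bind_fm v k \<phi>) = fv \<phi> - {v}"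
  by (induction \<phi> arbitrary: k) (auto simp: vars_bind_trm)

definition ex_var :: "'v \<Rightarrow> ('f, 'r, 'v) fm \<Rightarrow> ('f, 'r, 'v) fm" where
  "ex_var v \<phi> = Ex (bind_fm v 0 \<phi>)"

lemma ex_var_Fm: "\<phi> \<in> Fm L V \<Longrightarrow> ex_var v \<phi> \<in> Fm L (V - {v})"
  by (auto simp: Fm_def ex_var_def fv_bind_fm wf_bind_fm)

lemma holds_ex_var:
  "\<phi> \<in> Fm L V \<Longrightarrow> holds \<AA> s (ex_var v \<phi>) \<longleftrightarrow> (\<exists>x\<in>univ \<AA>. holds \<AA> (s(v := x)) \<phi>)"
  using sat_bind_fm[of L "[]" \<phi> \<AA> _ s v] by (simp add: holds_def ex_var_def Fm_def)

lemma ex_vars: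
  assumes "finite X" "\<phi> \<in> Fm L V"
  shows "\<exists>\<phi>'\<in>Fm L (V - X). \<forall>(\<AA> :: ('f, 'r, 'a) struct) s. univ \<AA> \<noteq> {} \<longrightarrow>
    (holds \<AA> s \<phi>' \<longleftrightarrow> (\<exists>w. w ` X \<subseteq> univ \<AA> \<and> holds \<AA> (\<lambda>v. if v \<in> X then w v else s v) \<phi>))"
  using assms(1)
proof induction
  case empty
  show ?case using assms(2) by (intro bexI[of _ \<phi>]) auto
next
  case (insert x X)
  then obtain \<phi>' where \<phi>': "\<phi>' \<in> Fm L (V - X)"
    "\<And>(\<AA> :: ('f, 'r, 'a) struct) s. univ \<AA> \<noteq> {} \<Longrightarrow>
      holds \<AA> s \<phi>' \<longleftrightarrow> (\<exists>w. w ` X \<subseteq> univ \<AA> \<and> holds \<AA> (\<lambda>v. if v \<in> X then w v else s v) \<phi>)"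
    by blast
  have "holds \<AA> s (ex_var x \<phi>') \<longleftrightarrow>
     (\<exists>w. w ` insert x X \<subseteq> univ \<AA> \<and> holds \<AA> (\<lambda>v. if v \<in> insert x X then w v else s v) \<phi>)"
    if "univ \<AA> \<noteq> {}" for \<AA> :: "('f, 'r, 'a) struct" and s
  proof -
    have eq: "(\<lambda>v. if v \<in> X then w v else (s(x := y)) v)
        = (\<lambda>v. if v \<in> insert x X then (w(x := y)) v else s v)" for w y
      using insert.hyps by auto
    show ?thesis (is "_ = ?R")
      unfolding holds_ex_var[OF \<phi>'(1)] \<phi>'(2)[OF that] eq
    proof
      assume "\<exists>y\<in>univ \<AA>. \<exists>w. w ` X \<subseteq> univ \<AA> \<and>
        holds \<AA> (\<lambda>v. if v \<in> insert x X then (w(x := y)) v else s v) \<phi>"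
      then obtain y w where "y \<in> univ \<AA>" "w ` X \<subseteq> univ \<AA>"
        "holds \<AA> (\<lambda>v. if v \<in> insert x X then (w(x := y)) v else s v) \<phi>" by blast
      then show ?R by (intro exI[of _ "w(x := y)"]) (auto simp: image_subset_iff)
    next
      assume ?R
      then obtain w where w: "w ` insert x X \<subseteq> univ \<AA>"
        "holds \<AA> (\<lambda>v. if v \<in> insert x X then w v else s v) \<phi>" by blast
      then show "\<exists>y\<in>univ \<AA>. \<exists>w. w ` X \<subseteq> univ \<AA> \<and>
        holds \<AA> (\<lambda>v. if v \<in> insert x X then (w(x := y)) v else s v) \<phi>"
        by (intro bexI[of _ "w x"] exI[of _ w]) (auto simp only: fun_upd_triv)
    qed
  qed
  moreover have "ex_var x \<phi>' \<in> Fm L (V - insert x X)"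
    using ex_var_Fm[OF \<phi>'(1), of x] by (auto simp: Fm_def)
  ultimately show ?case by blast
qed

text \<open>A single formula serves all structures: for coheirs it is evaluated in \<open>\<MM>\<close> and in \<open>M\<close>.\<close>

lemma ex_formula:
  assumes "\<phi> \<in> Fm L (Inl ` X \<union> Inr ` Y)"
  obtains \<phi>' where "\<phi>' \<in> Fm L Y"
    "\<And>(\<AA> :: ('f, 'r, 'a) struct) s. univ \<AA> \<noteq> {} \<Longrightarrow>
      holds \<AA> s \<phi>' \<longleftrightarrow> (\<exists>w. w ` X \<subseteq> univ \<AA> \<and> holds \<AA> (case_sum w s) \<phi>)"
proof -
  define X0 where "X0 = fv \<phi> \<inter> range Inl"
  have "finite X0" by (simp add: X0_def finite_fv)
  from ex_vars[OF this Fm_fv[OF assms], where 'a = 'a] obtain \<phi>1 where \<phi>1: "\<phi>1 \<in> Fm L (fv \<phi> - X0)"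
    "\<And>(\<AA> :: ('f, 'r, 'a) struct) s. univ \<AA> \<noteq> {} \<Longrightarrow>
      holds \<AA> s \<phi>1 \<longleftrightarrow> (\<exists>w. w ` X0 \<subseteq> univ \<AA> \<and> holds \<AA> (\<lambda>v. if v \<in> X0 then w v else s v) \<phi>)"
    by blast
  have sub: "fv \<phi> \<subseteq> Inl ` X \<union> Inr ` Y" using assms by (rule FmD)
  then have subX: "x \<in> X" if "Inl x \<in> fv \<phi>" for x using that by auto
  show thesis
  proof
    show "ren projr \<phi>1 \<in> Fm L Y"
      using sub by (intro ren_in_Fm[OF \<phi>1(1)]) (auto simp: X0_def)
    fix \<AA> :: "('f, 'r, 'a) struct" and s :: "'c \<Rightarrow> 'a"
    assume ne: "univ \<AA> \<noteq> {}"
    show "holds \<AA> s (ren projr \<phi>1) \<longleftrightarrow> (\<exists>w. w ` X \<subseteq> univ \<AA> \<and> holds \<AA> (case_sum w s) \<phi>)" (is "?l = ?r")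
      unfolding holds_ren \<phi>1(2)[OF ne]
    proof
      assume "\<exists>w. w ` X0 \<subseteq> univ \<AA> \<and> holds \<AA> (\<lambda>v. if v \<in> X0 then w v else (s \<circ> projr) v) \<phi>"
      then obtain w where w: "w ` X0 \<subseteq> univ \<AA>"
        "holds \<AA> (\<lambda>v. if v \<in> X0 then w v else (s \<circ> projr) v) \<phi>" by blast
      from ne obtain z where z: "z \<in> univ \<AA>" by blast
      have "holds \<AA> (\<lambda>v. if v \<in> X0 then w v else (s \<circ> projr) v) \<phi>
          = holds \<AA> (case_sum (\<lambda>x. if Inl x \<in> X0 then w (Inl x) else z) s) \<phi>"
        by (rule holds_cong) (use sub in \<open>auto simp: X0_def split: sum.split\<close>)
      with w(2) have "holds \<AA> (case_sum (\<lambda>x. if Inl x \<in> X0 then w (Inl x) else z) s) \<phi>" by simp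
      then show ?r using w(1) z by (intro exI[of _ "\<lambda>x. if Inl x \<in> X0 then w (Inl x) else z"]) auto
    next
      assume ?r
      then obtain w where w: "w ` X \<subseteq> univ \<AA>" "holds \<AA> (case_sum w s) \<phi>" by blast
      have "holds \<AA> (\<lambda>v. if v \<in> X0 then (w \<circ> projl) v else (s \<circ> projr) v) \<phi>
          = holds \<AA> (case_sum w s) \<phi>"
        by (rule holds_cong) (use sub in \<open>auto simp: X0_def split: sum.split\<close>)
      moreover have "(w \<circ> projl) ` X0 \<subseteq> univ \<AA>" using w(1) subX by (auto simp: X0_def)
      ultimately show "\<exists>w. w ` X0 \<subseteq> univ \<AA> \<and> holds \<AA> (\<lambda>v. if v \<in> X0 then w v else (s \<circ> projr) v) \<phi>"
        using w(2) by blast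
    qed
  qed
qed

lemma conj_formula:
  assumes "finite F" "F \<subseteq> Fm L V"
  obtains \<phi> where "\<phi> \<in> Fm L V"
    "\<And>(\<AA> :: ('f, 'r, 'a) struct) s. univ \<AA> \<noteq> {} \<Longrightarrow> holds \<AA> s \<phi> \<longleftrightarrow> (\<forall>\<chi>\<in>F. holds \<AA> s \<chi>)"
proof -
  have "\<exists>\<phi>\<in>Fm L V. \<forall>(\<AA> :: ('f, 'r, 'a) struct) s. univ \<AA> \<noteq> {} \<longrightarrow>
      (holds \<AA> s \<phi> \<longleftrightarrow> (\<forall>\<chi>\<in>F. holds \<AA> s \<chi>))"
    using assms
  proof induction
    case empty
    show ?case by (intro bexI[of _ "Ex (Eq (Bnd 0) (Bnd 0))"]) (auto simp: holds_def Fm_def)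
  next
    case (insert \<chi> F)
    then obtain \<phi> where "\<phi> \<in> Fm L V" "\<forall>(\<AA> :: ('f, 'r, 'a) struct) s. univ \<AA> \<noteq> {} \<longrightarrow>
      (holds \<AA> s \<phi> \<longleftrightarrow> (\<forall>\<chi>\<in>F. holds \<AA> s \<chi>))" by blast
    then show ?case using insert.prems
      by (intro bexI[of _ "And \<chi> \<phi>"]) (auto simp: holds_def Fm_def)
  qed
  then show thesis using that by blast
qed

lemma Neg_Fm: "Neg \<phi> \<in> Fm L V \<longleftrightarrow> \<phi> \<in> Fm L V" and And_Fm: "And \<phi> \<psi> \<in> Fm L V \<longleftrightarrow> \<phi> \<in> Fm L V \<and> \<psi> \<in> Fm L V"
  by (auto simp: Fm_def)

lemma holds_Neg: "holds \<AA> s (Neg \<phi>) \<longleftrightarrow> \<not> holds \<AA> s \<phi>" and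
  holds_And: "holds \<AA> s (And \<phi> \<psi>) \<longleftrightarrow> holds \<AA> s \<phi> \<and> holds \<AA> s \<psi>"
  by (auto simp: holds_def)

text \<open>The Teichmueller--Tukey lemma. Its instances below are complete types, assignments of values to
  the variables of a type, types that are finitely satisfiable in \<open>M\<close>, and types that are realized
  infinitely often in a sequence.\<close>

lemma tukey:
  assumes mono: "\<forall>F F'. G F' \<and> F \<subseteq> F' \<longrightarrow> G F"
    and S0: "S0 \<subseteq> W" "\<forall>F. finite F \<and> F \<subseteq> S0 \<longrightarrow> G F"
  shows "\<exists>S. S0 \<subseteq> S \<and> S \<subseteq> W \<and> (\<forall>F. finite F \<and> F \<subseteq> S \<longrightarrow> G F) \<and>
    (\<forall>x\<in>W. x \<notin> S \<longrightarrow> (\<exists>F. finite F \<and> F \<subseteq> S \<and> \<not> G (insert x F)))"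
proof -
  define \<A> where "\<A> = {S. S0 \<subseteq> S \<and> S \<subseteq> W \<and> (\<forall>F. finite F \<and> F \<subseteq> S \<longrightarrow> G F)}"
  have "\<exists>S\<in>\<A>. \<forall>X\<in>\<A>. S \<subseteq> X \<longrightarrow> X = S"
  proof (rule subset_Zorn_nonempty)
    show "\<A> \<noteq> {}" using S0 by (auto simp: \<A>_def)
    fix \<C> assume C: "\<C> \<noteq> {}" "subset.chain \<A> \<C>"
    then have sub: "\<C> \<subseteq> \<A>" by (simp add: subset.chain_def)
    have "G F" if F: "finite F" "F \<subseteq> \<Union>\<C>" for F
    proof -
      obtain S where "S \<in> \<C>" "F \<subseteq> S" by (rule finite_subset_Union_chain[OF F C])
      then show ?thesis using sub F(1) by (auto simp: \<A>_def)
    qed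
    moreover have "S0 \<subseteq> \<Union>\<C>" "\<Union>\<C> \<subseteq> W" using C(1) sub by (fastforce simp: \<A>_def)+
    ultimately show "\<Union>\<C> \<in> \<A>" by (auto simp: \<A>_def)
  qed
  then obtain S where S: "S \<in> \<A>" "\<And>X. X \<in> \<A> \<Longrightarrow> S \<subseteq> X \<Longrightarrow> X = S" by blast
  have "\<exists>F. finite F \<and> F \<subseteq> S \<and> \<not> G (insert x F)" if x: "x \<in> W" "x \<notin> S" for x
  proof -
    have "insert x S \<notin> \<A>" using S(2)[of "insert x S"] x by blast
    then obtain F where F: "finite F" "F \<subseteq> insert x S" "\<not> G F"
      using S(1) x by (auto simp: \<A>_def)
    have "\<not> G (insert x (F - {x}))" using F(3) mono by blast
    then show ?thesis using F by (intro exI[of _ "F - {x}"]) auto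
  qed
  then show ?thesis using S(1) by (intro exI[of _ S]) (auto simp: \<A>_def)
qed

section \<open>Saturation for small tuples\<close>

lemma realizes_mono: "realizes \<AA> I c \<Phi> \<Longrightarrow> \<Psi> \<subseteq> \<Phi> \<Longrightarrow> realizes \<AA> I c \<Psi>"
  by (auto simp: realizes_def)

locale saturated_structure =
  fixes L :: "('f, 'r) lang" and \<kappa> :: "'k rel" and \<MM> :: "('f, 'r, 'a) struct"
  assumes card_order: "Card_order \<kappa>"
    and small_nat: "small \<kappa> (UNIV :: nat set)"
    and saturated: "saturated L \<kappa> \<MM>"
    and univ_nonempty: "univ \<MM> \<noteq> {}"
begin

lemma infinite_Field: "\<not> finite (Field \<kappa>)"
proof
  assume "finite (Field \<kappa>)"
  moreover have "(card_of (UNIV :: nat set), card_of (Field \<kappa>)) \<in> ordLeq"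
    using small_nat card_of_Field_ordIso[OF card_order] unfolding small_def
    by (meson ordIso_symmetric ordLess_imp_ordLeq ordLess_ordIso_trans)
  ultimately show False
    using card_of_ordLeq_finite infinite_UNIV_nat by blast
qed

lemma small_Un: "small \<kappa> A \<Longrightarrow> small \<kappa> B \<Longrightarrow> small \<kappa> (A \<union> B)"
  unfolding small_def by (rule card_of_Un_ordLess_infinite_Field[OF infinite_Field card_order])

lemma small_subset: "A \<subseteq> B \<Longrightarrow> small \<kappa> B \<Longrightarrow> small \<kappa> A"
  unfolding small_def by (meson card_of_mono1 ordLeq_ordLess_trans)

lemma small_image: "small \<kappa> A \<Longrightarrow> small \<kappa> (f ` A)"
  unfolding small_def by (meson card_of_image ordLeq_ordLess_trans)

lemma small_finite:
  assumes "finite A"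
  shows "small \<kappa> A"
proof -
  obtain f :: "_ \<Rightarrow> nat" where "inj_on f A" using finite_imp_inj_to_nat_seg[OF assms] by blast
  then have "(card_of A, card_of (UNIV :: nat set)) \<in> ordLeq" using card_of_ordLeq by blast
  then show ?thesis using small_nat unfolding small_def by (rule ordLeq_ordLess_trans)
qed

lemma small_Times_nat: "small \<kappa> A \<Longrightarrow> small \<kappa> ((UNIV :: nat set) \<times> A)"
proof -
  assume A: "small \<kappa> A"
  let ?C = "(UNIV :: nat set) <+> A"
  have C: "small \<kappa> ?C"
    using card_of_Plus_ordLess_infinite_Field[OF infinite_Field card_order] small_nat A
    unfolding small_def by blast
  have "\<not> finite ?C" by (simp add: finite_Plus_iff)
  then have "(card_of (?C \<times> ?C), card_of ?C) \<in> ordIso" by (rule card_of_Times_same_infinite)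
  moreover have "(card_of ((UNIV :: nat set) \<times> A), card_of (?C \<times> ?C)) \<in> ordLeq"
    by (rule ordLeq_transitive[OF card_of_Times_mono1[OF card_of_Plus1] card_of_Times_mono2[OF card_of_Plus2]])
  ultimately have "(card_of ((UNIV :: nat set) \<times> A), card_of ?C) \<in> ordLeq"
    using ordLeq_ordIso_trans by blast
  then show ?thesis using C unfolding small_def by (rule ordLeq_ordLess_trans)
qed

lemma small_UN_finite: "finite N \<Longrightarrow> (\<And>i. i \<in> N \<Longrightarrow> small \<kappa> (A i)) \<Longrightarrow> small \<kappa> (\<Union>i\<in>N. A i)"
  by (induction rule: finite_induct) (auto intro: small_Un small_finite)

lemma ex_fm:
  assumes "\<phi> \<in> Fm L (Inl ` X \<union> Inr ` Y)"
  shows "\<exists>\<phi>'\<in>Fm L Y. \<forall>s. holds \<MM> s \<phi>' \<longleftrightarrow> (\<exists>w. w ` X \<subseteq> univ \<MM> \<and> holds \<MM> (case_sum w s) \<phi>)"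
  using ex_formula[OF assms, where 'a = 'a] univ_nonempty by metis

lemma conj_fm:
  assumes "finite F" "F \<subseteq> Fm L V"
  shows "\<exists>\<phi>\<in>Fm L V. \<forall>s. holds \<MM> s \<phi> \<longleftrightarrow> (\<forall>\<chi>\<in>F. holds \<MM> s \<chi>)"
  using conj_formula[OF assms, where 'a = 'a] univ_nonempty by metis

lemma complete_extension:
  fixes I :: "'i set"
  assumes "\<Phi> \<subseteq> Fm L (Inl ` I \<union> Inr ` A)" "consistent \<MM> I \<Phi>"
  obtains p where "\<Phi> \<subseteq> p" "complete_type L \<MM> I A p"
proof -
  let ?W = "Fm L (Inl ` I \<union> Inr ` A)"
  let ?G = "\<lambda>F. \<exists>c. realizes \<MM> I c F"
  have mono: "\<forall>F F' :: ('f, 'r, 'i + 'a) fm set. ?G F' \<and> F \<subseteq> F' \<longrightarrow> ?G F"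
    using realizes_mono by metis
  have fin: "\<forall>F. finite F \<and> F \<subseteq> \<Phi> \<longrightarrow> ?G F"
    using assms(2) by (simp add: consistent_def)
  obtain p where p: "\<Phi> \<subseteq> p" "p \<subseteq> ?W" "\<forall>F. finite F \<and> F \<subseteq> p \<longrightarrow> ?G F"
    "\<forall>\<phi>\<in>?W. \<phi> \<notin> p \<longrightarrow> (\<exists>F. finite F \<and> F \<subseteq> p \<and> \<not> ?G (insert \<phi> F))"
    using tukey[OF mono assms(1) fin] by (elim exE conjE, intro that)
  have "\<phi> \<in> p \<or> Neg \<phi> \<in> p" if \<phi>: "\<phi> \<in> ?W" for \<phi>
  proof (rule ccontr)
    assume "\<not> ?thesis"
    then have "\<phi> \<notin> p" "Neg \<phi> \<notin> p" by auto
    obtain F where F: "finite F" "F \<subseteq> p" "\<not> ?G (insert \<phi> F)"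
      using p(4) \<phi> \<open>\<phi> \<notin> p\<close> by meson
    obtain F' where F': "finite F'" "F' \<subseteq> p" "\<not> ?G (insert (Neg \<phi>) F')"
      using p(4) \<phi> \<open>Neg \<phi> \<notin> p\<close> unfolding Neg_Fm[symmetric, of \<phi>] by meson
    have "finite (F \<union> F')" "F \<union> F' \<subseteq> p" using F F' by auto
    then obtain c where c: "realizes \<MM> I c (F \<union> F')" using p(3) by meson
    show False
    proof (cases "holds \<MM> (case_sum c id) \<phi>")
      case True
      then have "realizes \<MM> I c (insert \<phi> F)" using c by (simp add: realizes_def)
      then show False using F(3) by blast
    next
      case False
      then have "realizes \<MM> I c (insert (Neg \<phi>) F')" using c by (simp add: realizes_def holds_Neg)
      then show False using F'(3) by blast
    qed
  qed
  then have "complete_type L \<MM> I A p" using p(2,3) by (simp add: complete_type_def consistent_def)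
  then show thesis using p(1) that by blast
qed

text \<open>Saturation speaks of one variable. A maximal set of assignments \<open>x\<^sub>i = m\<close> that is compatible
  with \<open>\<Phi>\<close> is defined on all of \<open>I\<close>: a missing variable is added by realizing its type over the
  parameters and the values already assigned, a small set.\<close>

lemma realize_small:
  fixes I :: "'i set"
  assumes \<Phi>: "\<Phi> \<subseteq> Fm L (Inl ` I \<union> Inr ` A)" "consistent \<MM> I \<Phi>"
    and A: "A \<subseteq> univ \<MM>" "small \<kappa> A" and I: "small \<kappa> I"
  obtains c where "realizes \<MM> I c \<Phi>"
proof -
  define R where "R = (\<lambda>(c :: 'i \<Rightarrow> 'a) F. \<forall>i m. (i, m) \<in> F \<longrightarrow> c i = m)"
  define G where "G = (\<lambda>F. \<forall>\<Psi>. finite \<Psi> \<and> \<Psi> \<subseteq> \<Phi> \<longrightarrow> (\<exists>c. realizes \<MM> I c \<Psi> \<and> R c F))"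
  have GE: "\<exists>c. realizes \<MM> I c \<Psi> \<and> R c F" if "G F" "finite \<Psi>" "\<Psi> \<subseteq> \<Phi>" for F \<Psi>
    using that by (simp add: G_def)
  have mono: "\<forall>F F'. G F' \<and> F \<subseteq> F' \<longrightarrow> G F"
    unfolding G_def R_def by (meson subset_eq)
  have fin: "\<forall>F. finite F \<and> F \<subseteq> {} \<longrightarrow> G F"
    using \<Phi>(2) by (auto simp: consistent_def G_def R_def)
  obtain S where S1: "S \<subseteq> I \<times> univ \<MM>" "\<forall>F. finite F \<and> F \<subseteq> S \<longrightarrow> G F"
    "\<forall>x\<in>I \<times> univ \<MM>. x \<notin> S \<longrightarrow> (\<exists>F. finite F \<and> F \<subseteq> S \<and> \<not> G (insert x F))"
    using tukey[OF mono empty_subsetI[of "I \<times> univ \<MM>"] fin] by (elim exE conjE, intro that)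
  note S = S1(1) S1(2)[rule_format, OF conjI] S1(3)[rule_format]
  have functional: "m = m'" if "(i, m) \<in> S" "(i, m') \<in> S" for i m m'
    using GE[OF S(2)[of "{(i, m), (i, m')}"], of "{}"] that by (auto simp: R_def)
  have "\<exists>m. (i, m) \<in> S" if i: "i \<in> I" for i
  proof (rule ccontr)
    assume no: "\<nexists>m. (i, m) \<in> S"
    define A' where "A' = A \<union> snd ` S"
    have "snd ` S \<subseteq> (\<lambda>i. THE m. (i, m) \<in> S) ` I"
    proof
      fix m assume "m \<in> snd ` S"
      then obtain j where "(j, m) \<in> S" by auto
      moreover from this functional have "(THE m. (j, m) \<in> S) = m" by blast
      ultimately show "m \<in> (\<lambda>i. THE m. (i, m) \<in> S) ` I" using S(1) by force
    qed
    then have "small \<kappa> (snd ` S)" by (rule small_subset) (rule small_image[OF I])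
    then have A': "small \<kappa> A'" "A' \<subseteq> univ \<MM>"
      unfolding A'_def using A S(1) by (auto intro!: small_Un)
    define Q where "Q = (\<lambda>\<theta> \<Psi> F. finite \<Psi> \<and> \<Psi> \<subseteq> \<Phi> \<and> finite F \<and> F \<subseteq> S \<and>
        (\<forall>c. realizes \<MM> I c \<Psi> \<and> R c F \<longrightarrow> holds \<MM> (case_sum (\<lambda>_ :: unit. c i) id) \<theta>))"
    define \<Theta> where "\<Theta> = {\<theta> \<in> Fm L (Inl ` UNIV \<union> Inr ` A'). \<exists>\<Psi> F. Q \<theta> \<Psi> F}"
    have "consistent \<MM> (UNIV :: unit set) \<Theta>"
      unfolding consistent_def
    proof (intro allI impI)
      fix H assume H: "finite H \<and> H \<subseteq> \<Theta>"
      then have "\<exists>\<Psi> F. Q \<theta> \<Psi> F" if "\<theta> \<in> H" for \<theta> using that unfolding \<Theta>_def by blast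
      then obtain \<Psi> F where Q: "\<And>\<theta>. \<theta> \<in> H \<Longrightarrow> Q \<theta> (\<Psi> \<theta>) (F \<theta>)" by metis
      have "G (\<Union>\<theta>\<in>H. F \<theta>)" using H Q by (intro S(2)) (auto simp: Q_def)
      moreover have "finite (\<Union>\<theta>\<in>H. \<Psi> \<theta>)" "(\<Union>\<theta>\<in>H. \<Psi> \<theta>) \<subseteq> \<Phi>" using H Q by (auto simp: Q_def)
      ultimately obtain c where c: "realizes \<MM> I c (\<Union>\<theta>\<in>H. \<Psi> \<theta>)" "R c (\<Union>\<theta>\<in>H. F \<theta>)"
        using GE by metis
      have "holds \<MM> (case_sum (\<lambda>_. c i) id) \<theta>" if "\<theta> \<in> H" for \<theta>
      proof -
        have "realizes \<MM> I c (\<Psi> \<theta>)" "R c (F \<theta>)" using c that by (auto simp: realizes_def R_def)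
        then show ?thesis using Q[OF that] by (auto simp: Q_def)
      qed
      then have "realizes \<MM> UNIV (\<lambda>_. c i) H" using c(1) i by (auto simp: realizes_def)
      then show "\<exists>c. realizes \<MM> (UNIV :: unit set) c H" by blast
    qed
    moreover have "\<Theta> \<subseteq> Fm L (Inl ` UNIV \<union> Inr ` A')" by (auto simp: \<Theta>_def)
    ultimately obtain p where p: "\<Theta> \<subseteq> p" "complete_type L \<MM> UNIV A' p"
      by (metis complete_extension)
    then obtain c0 where c0: "realizes \<MM> (UNIV :: unit set) c0 p"
      using saturated A' unfolding saturated_def by blast
    define m where "m = c0 ()"
    have m: "m \<in> univ \<MM>" using c0 by (auto simp: realizes_def m_def)
    obtain F \<Psi> where F: "finite F" "F \<subseteq> S" "finite \<Psi>" "\<Psi> \<subseteq> \<Phi>"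
      "\<nexists>c. realizes \<MM> I c \<Psi> \<and> R c (insert (i, m) F)"
      using S(3)[of "(i, m)"] i m no unfolding G_def by blast
    have "\<Psi> \<subseteq> Fm L (Inl ` I \<union> Inr ` A)" using F(4) \<Phi>(1) by (rule subset_trans)
    from conj_fm[OF F(3) this] obtain \<psi> where \<psi>: "\<psi> \<in> Fm L (Inl ` I \<union> Inr ` A)"
      "\<forall>s. holds \<MM> s \<psi> \<longleftrightarrow> (\<forall>\<chi>\<in>\<Psi>. holds \<MM> s \<chi>)" by (elim bexE, intro that)
    define v where "v = (\<lambda>j. THE m. (j, m) \<in> S)"
    have v: "v j = m" if "(j, m) \<in> S" for j m unfolding v_def using that functional by blast
    define g :: "'i + 'a \<Rightarrow> 'i + (unit + 'a)" where
      "g = case_sum (\<lambda>j. if j = i then Inr (Inl ()) else if j \<in> fst ` F then Inr (Inr (v j)) else Inl j)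
          (\<lambda>a. Inr (Inr a))"
    have gFm: "ren g \<psi> \<in> Fm L (Inl ` I \<union> Inr ` (Inl ` UNIV \<union> Inr ` A'))"
    proof (rule ren_in_Fm[OF \<psi>(1)])
      fix u assume u: "u \<in> Inl ` I \<union> Inr ` A"
      have vA: "v j \<in> A'" if "j \<in> fst ` F" for j
      proof -
        from that F(2) obtain m where "(j, m) \<in> S" by auto
        then show ?thesis using v[of j m] by (force simp: A'_def)
      qed
      show "g u \<in> Inl ` I \<union> Inr ` (Inl ` UNIV \<union> Inr ` A')"
      proof (cases u)
        case (Inl j)
        then show ?thesis using u vA[of j] by (simp add: g_def image_iff del: image_eqI)
      next
        case (Inr a)
        then show ?thesis using u by (auto simp: g_def A'_def)
      qed
    qed
    from ex_fm[OF gFm] obtain \<theta> where \<theta>: "\<theta> \<in> Fm L (Inl ` (UNIV :: unit set) \<union> Inr ` A')"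
      "\<forall>s. holds \<MM> s \<theta> \<longleftrightarrow> (\<exists>w. w ` I \<subseteq> univ \<MM> \<and> holds \<MM> (case_sum w s) (ren g \<psi>))"
      by (elim bexE, intro that)
    have comp: "case_sum w (case_sum (\<lambda>_ :: unit. x) id) \<circ> g
        = case_sum (\<lambda>j. if j = i then x else if j \<in> fst ` F then v j else w j) id" for w x
      by (auto simp: g_def fun_eq_iff split: sum.split)
    have \<theta>_iff: "holds \<MM> (case_sum (\<lambda>_. x) id) \<theta> \<longleftrightarrow> (\<exists>w. w ` I \<subseteq> univ \<MM> \<and>
        (\<forall>\<chi>\<in>\<Psi>. holds \<MM> (case_sum (\<lambda>j. if j = i then x else if j \<in> fst ` F then v j else w j) id) \<chi>))" for x
      unfolding \<theta>(2)[rule_format] holds_ren comp \<psi>(2)[rule_format] ..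
    have Fv: "j \<in> fst ` F \<Longrightarrow> (j, v j) \<in> F" for j using F(2) v by force
    have "Q \<theta> \<Psi> F"
      unfolding Q_def
    proof (intro conjI allI impI F)
      fix c assume c: "realizes \<MM> I c \<Psi> \<and> R c F"
      have "v j = c j" if "j \<in> fst ` F" for j using c Fv[OF that] by (simp add: R_def)
      then have "(\<lambda>j. if j = i then c i else if j \<in> fst ` F then v j else c j) = c"
        by (simp add: fun_eq_iff del: image_iff)
      then show "holds \<MM> (case_sum (\<lambda>_. c i) id) \<theta>"
        unfolding \<theta>_iff using c by (intro exI[of _ c]) (auto simp: realizes_def)
    qed
    then have "\<theta> \<in> p" using p(1) \<theta>(1) by (auto simp: \<Theta>_def)
    then have "holds \<MM> (case_sum c0 id) \<theta>" using c0 by (auto simp: realizes_def)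
    moreover have "c0 = (\<lambda>_. m)" by (auto simp: m_def)
    ultimately obtain w where w: "w ` I \<subseteq> univ \<MM>"
      "\<forall>\<chi>\<in>\<Psi>. holds \<MM> (case_sum (\<lambda>j. if j = i then m else if j \<in> fst ` F then v j else w j) id) \<chi>"
      using \<theta>_iff[of m] by metis
    let ?c = "\<lambda>j. if j = i then m else if j \<in> fst ` F then v j else w j"
    have "v j \<in> univ \<MM>" if "j \<in> fst ` F" for j using Fv[OF that] F(2) S(1) by blast
    then have "?c ` I \<subseteq> univ \<MM>" using w(1) m by (simp add: image_subset_iff)
    then have "realizes \<MM> I ?c \<Psi>" using w(2) by (simp add: realizes_def)
    moreover have "R ?c (insert (i, m) F)"
    proof -
      have "j \<noteq> i \<and> j \<in> fst ` F \<and> v j = m'" if "(j, m') \<in> F" for j m'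
      proof -
        have "(j, m') \<in> S" using that F(2) by blast
        moreover from this have "j \<noteq> i" using no by blast
        moreover have "j \<in> fst ` F" using that by (rule image_eqI[rotated]) simp
        ultimately show ?thesis using v by blast
      qed
      then show ?thesis by (simp add: R_def)
    qed
    ultimately show False using F(5) by blast
  qed
  then obtain c where c: "\<And>i. i \<in> I \<Longrightarrow> (i, c i) \<in> S" by metis
  have "holds \<MM> (case_sum c id) \<phi>" if \<phi>: "\<phi> \<in> \<Phi>" for \<phi>
  proof -
    let ?F = "(\<lambda>i. (i, c i)) ` {i. Inl i \<in> fv \<phi>}"
    have sub: "fv \<phi> \<subseteq> Inl ` I \<union> Inr ` A" using \<Phi>(1) \<phi> FmD by blast
    have "finite (Inl -` fv \<phi>)" by (intro finite_vimageI finite_fv) auto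
    then have "finite ?F" by (simp add: vimage_def)
    moreover have "?F \<subseteq> S" using sub c by auto
    ultimately obtain c' where c': "realizes \<MM> I c' {\<phi>}" "R c' ?F"
      using GE[OF S(2)[of ?F], of "{\<phi>}"] \<phi> by auto
    have "holds \<MM> (case_sum c' id) \<phi> = holds \<MM> (case_sum c id) \<phi>"
      using c'(2) by (intro holds_cong) (auto simp: R_def split: sum.split)
    then show ?thesis using c'(1) by (auto simp: realizes_def)
  qed
  then show thesis using c S(1) by (intro that[of c]) (auto simp: realizes_def)
qed

lemma saturation:
  assumes \<Phi>: "\<Phi> \<subseteq> Fm L (Inl ` W \<union> Inr ` V)"
    and fin: "\<And>F. finite F \<Longrightarrow> F \<subseteq> \<Phi> \<Longrightarrow> \<exists>w. w ` W \<subseteq> univ \<MM> \<and> (\<forall>\<phi>\<in>F. holds \<MM> (case_sum w s) \<phi>)"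
    and W: "small \<kappa> W" and s: "s ` V \<subseteq> univ \<MM>" "small \<kappa> (s ` V)"
  obtains w where "w ` W \<subseteq> univ \<MM>" "\<And>\<phi>. \<phi> \<in> \<Phi> \<Longrightarrow> holds \<MM> (case_sum w s) \<phi>"
proof -
  have eq: "holds \<MM> (case_sum w id) (ren (map_sum id s) \<phi>) \<longleftrightarrow> holds \<MM> (case_sum w s) \<phi>" for w \<phi>
  proof -
    have "case_sum w id \<circ> map_sum id s = case_sum w s" by (auto simp: fun_eq_iff split: sum.split)
    then show ?thesis by (simp add: holds_ren)
  qed
  have "consistent \<MM> W (ren (map_sum id s) ` \<Phi>)"
    unfolding consistent_def
  proof (intro allI impI)
    fix F assume "finite F \<and> F \<subseteq> ren (map_sum id s) ` \<Phi>"
    then obtain F' where F': "F' \<subseteq> \<Phi>" "finite F'" "F = ren (map_sum id s) ` F'"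
      by (meson finite_subset_image)
    then show "\<exists>c. realizes \<MM> W c F" using fin[of F'] by (auto simp: realizes_def eq)
  qed
  moreover have "ren (map_sum id s) ` \<Phi> \<subseteq> Fm L (Inl ` W \<union> Inr ` s ` V)"
    using \<Phi> by (auto intro!: ren_in_Fm)
  ultimately obtain w where "realizes \<MM> W w (ren (map_sum id s) ` \<Phi>)"
    using realize_small[of _ W "s ` V"] s W by blast
  then show thesis by (intro that[of w]) (auto simp: realizes_def eq)
qed

text \<open>The tuples compared are indexed by names, and parameters are not treated separately: a type over a
  set of parameters is one where each parameter has a name at which both tuples take it as value.\<close>

definition eqv :: "'v set \<Rightarrow> ('v \<Rightarrow> 'a) \<Rightarrow> ('v \<Rightarrow> 'a) \<Rightarrow> bool" where
  "eqv V s t \<longleftrightarrow> (\<forall>\<phi>\<in>Fm L V. holds \<MM> s \<phi> \<longleftrightarrow> holds \<MM> t \<phi>)"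

lemma eqvD: "eqv V s t \<Longrightarrow> \<phi> \<in> Fm L V \<Longrightarrow> holds \<MM> s \<phi> \<longleftrightarrow> holds \<MM> t \<phi>"
  by (simp add: eqv_def)

lemma eqv_refl: "eqv V s s" by (simp add: eqv_def)

lemma eqv_sym: "eqv V s t \<Longrightarrow> eqv V t s" by (simp add: eqv_def)

lemma eqv_trans: "eqv V s t \<Longrightarrow> eqv V t u \<Longrightarrow> eqv V s u" by (simp add: eqv_def)

lemma eqv_ren:
  assumes "eqv V' s' t'" "\<And>v. v \<in> V \<Longrightarrow> g v \<in> V'"
    "\<And>v. v \<in> V \<Longrightarrow> s v = s' (g v)" "\<And>v. v \<in> V \<Longrightarrow> t v = t' (g v)"
  shows "eqv V s t"
  unfolding eqv_def
proof
  fix \<phi> :: "('f, 'r, 'c) fm" assume \<phi>: "\<phi> \<in> Fm L V"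
  have "holds \<MM> s \<phi> = holds \<MM> s' (ren g \<phi>)" "holds \<MM> t \<phi> = holds \<MM> t' (ren g \<phi>)"
    unfolding holds_ren using assms(3,4) by (auto intro!: holds_cong_Fm[OF \<phi>])
  moreover have "ren g \<phi> \<in> Fm L V'" using \<phi> assms(2) by (rule ren_in_Fm)
  ultimately show "holds \<MM> s \<phi> = holds \<MM> t \<phi>" using eqvD[OF assms(1)] by blast
qed

lemma eqv_solvable:
  assumes "eqv V s t" "\<phi> \<in> Fm L (Inl ` W \<union> Inr ` V)"
    "w ` W \<subseteq> univ \<MM>" "holds \<MM> (case_sum w s) \<phi>"
  obtains w' where "w' ` W \<subseteq> univ \<MM>" "holds \<MM> (case_sum w' t) \<phi>"
proof -
  obtain \<phi>' where "\<phi>' \<in> Fm L V"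
      "\<And>s. holds \<MM> s \<phi>' \<longleftrightarrow> (\<exists>w. w ` W \<subseteq> univ \<MM> \<and> holds \<MM> (case_sum w s) \<phi>)"
    using ex_fm[OF assms(2)] by metis
  then show thesis using assms that eqvD[OF assms(1)] by blast
qed

text \<open>Homogeneity. The type to be realized is finitely satisfiable because \<open>s\<close> and \<open>t\<close> satisfy the same
  existential formulas.\<close>

lemma eqv_extend:
  assumes st: "eqv V s t" and w: "w ` W \<subseteq> univ \<MM>" and W: "small \<kappa> W"
    and t: "t ` V \<subseteq> univ \<MM>" "small \<kappa> (t ` V)"
  obtains w' where "w' ` W \<subseteq> univ \<MM>" "eqv (Inl ` W \<union> Inr ` V) (case_sum w s) (case_sum w' t)"
proof -
  let ?V = "Inl ` W \<union> Inr ` V"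
  let ?\<Phi> = "{\<phi> \<in> Fm L ?V. holds \<MM> (case_sum w s) \<phi>}"
  obtain w' where w': "w' ` W \<subseteq> univ \<MM>" "\<And>\<phi>. \<phi> \<in> ?\<Phi> \<Longrightarrow> holds \<MM> (case_sum w' t) \<phi>"
  proof (rule saturation[of ?\<Phi> W V t, OF _ _ W t])
    fix F assume F: "finite F" "F \<subseteq> ?\<Phi>"
    then obtain \<phi> where \<phi>: "\<phi> \<in> Fm L ?V"
      "\<And>s. holds \<MM> s \<phi> \<longleftrightarrow> (\<forall>\<chi>\<in>F. holds \<MM> s \<chi>)"
      using conj_fm[of F ?V] by blast
    then have "holds \<MM> (case_sum w s) \<phi>" using F by auto
    then show "\<exists>w. w ` W \<subseteq> univ \<MM> \<and> (\<forall>\<phi>\<in>F. holds \<MM> (case_sum w t) \<phi>)"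
      using eqv_solvable[OF st \<phi>(1) w] \<phi>(2) by metis
  qed auto
  have "holds \<MM> (case_sum w s) \<phi> = holds \<MM> (case_sum w' t) \<phi>" if "\<phi> \<in> Fm L ?V" for \<phi>
    using w'(2)[of \<phi>] w'(2)[of "Neg \<phi>"] that by (auto simp: Neg_Fm holds_Neg)
  then show thesis using that w'(1) by (auto simp: eqv_def)
qed

end

section \<open>Invariant types and Morley sequences\<close>

lemma positions_bounded:
  assumes "finite X"
  shows "\<exists>n :: nat. \<forall>k i. Inl (k, i) \<in> X \<longrightarrow> k < n"
proof -
  have "finite ((fst \<circ> projl) ` X)" using assms by blast
  then obtain n where n: "\<forall>k\<in>(fst \<circ> projl) ` X. k < n" using finite_nat_set_iff_bounded by blast
  have "k < n" if "Inl (k, i) \<in> X" for k i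
    using bspec[OF n imageI[OF that]] by simp
  then show ?thesis by blast
qed

locale saturated_over_model = saturated_structure L \<kappa> \<MM>
  for L :: "('f, 'r) lang" and \<kappa> :: "'k rel" and \<MM> :: "('f, 'r, 'a) struct" +
  fixes M :: "'a set"
  assumes small_model: "small_model L \<kappa> \<MM> M"
begin

lemma M_small: "small \<kappa> M" and M_univ: "M \<subseteq> univ \<MM>"
  using small_model by (auto simp: small_model_def elem_sub_def)

abbreviation invariant :: "'i set \<Rightarrow> ('f, 'r, 'i + 'a) fm set \<Rightarrow> bool" where
  "invariant I p \<equiv> invariant_type L \<MM> M I p"

abbreviation morley :: "'i set \<Rightarrow> ('f, 'r, 'i + 'a) fm set \<Rightarrow> 'a set \<Rightarrow> (nat \<Rightarrow> 'i \<Rightarrow> 'a) \<Rightarrow> bool" where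
  "morley I p A c \<equiv> morley_seq_of \<MM> I p A c"

text \<open>If both tuples name the elements of \<open>M\<close> in the same way, then \<open>eqv V s t\<close> is equality of types
  over \<open>M\<close>. Any index may serve as a name, so that tuples can be extended without new names for \<open>M\<close>.\<close>

definition names_M :: "'v set \<Rightarrow> ('v \<Rightarrow> 'a) \<Rightarrow> ('v \<Rightarrow> 'a) \<Rightarrow> bool" where
  "names_M V s t \<longleftrightarrow> (\<forall>m\<in>M. \<exists>v\<in>V. s v = m \<and> t v = m)"

lemma names_M_id: "M \<subseteq> A \<Longrightarrow> names_M A id id"
  by (auto simp: names_M_def)

lemma names_M_Inr: "names_M V s t \<Longrightarrow> names_M (W \<union> Inr ` V) (case_sum u s) (case_sum u' t)"
  by (force simp: names_M_def)

lemma invariant_Fm: "invariant I p \<Longrightarrow> p \<subseteq> Fm L (Inl ` I \<union> Inr ` univ \<MM>)"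
  by (simp add: invariant_type_def complete_type_def)

lemma invariant_Neg:
  "invariant I p \<Longrightarrow> \<phi> \<in> Fm L (Inl ` I \<union> Inr ` univ \<MM>) \<Longrightarrow> \<phi> \<notin> p \<Longrightarrow> Neg \<phi> \<in> p"
  by (auto simp: invariant_type_def complete_type_def)

lemma restr_Fm:
  assumes "invariant I p"
  shows "p \<restriction> A \<subseteq> Fm L (Inl ` I \<union> Inr ` A)"
proof
  fix \<phi> assume "\<phi> \<in> p \<restriction> A"
  then have \<phi>: "\<phi> \<in> p" "fv \<phi> \<subseteq> range Inl \<union> Inr ` A" by (simp_all add: restr_def)
  then have "\<phi> \<in> Fm L (Inl ` I \<union> Inr ` univ \<MM>)" using invariant_Fm[OF assms] by blast
  moreover from this have "fv \<phi> \<subseteq> Inl ` I \<union> Inr ` univ \<MM>" by (rule FmD)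
  then have "fv \<phi> \<subseteq> Inl ` I \<union> Inr ` A" using \<phi>(2) by fast
  ultimately show "\<phi> \<in> Fm L (Inl ` I \<union> Inr ` A)" by (simp add: Fm_def)
qed

lemma in_restr: "\<phi> \<in> p \<Longrightarrow> \<phi> \<in> Fm L (Inl ` I \<union> Inr ` A) \<Longrightarrow> \<phi> \<in> p \<restriction> A"
  unfolding restr_def Fm_def by blast

lemma restr_mono: "A \<subseteq> B \<Longrightarrow> p \<restriction> A \<subseteq> p \<restriction> B"
  unfolding restr_def by blast

lemma realizes_restr_mono: "realizes \<MM> I c (p \<restriction> B) \<Longrightarrow> A \<subseteq> B \<Longrightarrow> realizes \<MM> I c (p \<restriction> A)"
  using realizes_mono restr_mono by metis

lemma realizes_iff:
  assumes "invariant I p" "realizes \<MM> I c (p \<restriction> A)" "A \<subseteq> univ \<MM>" "\<phi> \<in> Fm L (Inl ` I \<union> Inr ` A)"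
  shows "holds \<MM> (case_sum c id) \<phi> \<longleftrightarrow> \<phi> \<in> p"
proof
  assume "\<phi> \<in> p"
  then show "holds \<MM> (case_sum c id) \<phi>"
    using assms(2) in_restr[OF _ assms(4)] by (auto simp: realizes_def)
next
  assume h: "holds \<MM> (case_sum c id) \<phi>"
  show "\<phi> \<in> p"
  proof (rule ccontr)
    assume "\<phi> \<notin> p"
    moreover have "\<phi> \<in> Fm L (Inl ` I \<union> Inr ` univ \<MM>)"
      using assms(3) by (intro Fm_mono[OF _ assms(4)]) auto
    ultimately have "Neg \<phi> \<in> p" using invariant_Neg[OF assms(1)] by blast
    then have "Neg \<phi> \<in> p \<restriction> A" using assms(4) by (intro in_restr) (simp_all add: Neg_Fm)
    then show False using assms(2) h by (auto simp: realizes_def holds_Neg)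
  qed
qed

text \<open>Invariance is defined through finite tuples; they are the names that occur in \<open>\<phi>\<close>.\<close>

lemma invariant_eqv_M:
  fixes s t :: "'v \<Rightarrow> 'a"
  assumes p: "invariant I p" and \<phi>: "\<phi> \<in> Fm L (Inl ` I \<union> Inr ` V)"
    and st: "s ` V \<subseteq> univ \<MM>" "t ` V \<subseteq> univ \<MM>"
    and eq: "eqv (Inl ` V \<union> Inr ` M) (case_sum s id) (case_sum t id)"
    and in_p: "ren (map_sum id s) \<phi> \<in> p"
  shows "ren (map_sum id t) \<phi> \<in> p"
proof -
  define V0 where "V0 = {v. Inr v \<in> fv \<phi>}"
  have "finite (Inr -` fv \<phi>)" by (intro finite_vimageI finite_fv) auto
  then have "finite V0" by (simp add: vimage_def V0_def)
  then obtain h n where h: "bij_betw h {..<n :: nat} V0"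
    using ex_bij_betw_nat_finite[of V0] by (auto simp: atLeast0LessThan)
  have V0: "V0 \<subseteq> V" using FmD[OF \<phi>] by (auto simp: V0_def)
  have hV: "h k \<in> V" if "k < n" for k using h V0 that by (auto simp: bij_betw_def)
  define k where "k = the_inv_into {..<n} h"
  have k: "k v < n" "h (k v) = v" if "v \<in> V0" for v
    using that bij_betw_the_inv_into[OF h] f_the_inv_into_f_bij_betw[OF h] unfolding k_def
    by (auto simp: bij_betw_def)
  define \<phi>' where "\<phi>' = ren (map_sum id k) \<phi>"
  have \<phi>': "\<phi>' \<in> Fm L (Inl ` I \<union> Inr ` {..<n})"
    unfolding \<phi>'_def using FmD[OF \<phi>] k(1) by (intro ren_in_Fm[OF Fm_fv[OF \<phi>]]) (auto simp: V0_def)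
  have inst: "inst \<phi>' (u \<circ> h) = ren (map_sum id u) \<phi>" for u
    unfolding inst_def \<phi>'_def ren_ren using k(2)
    by (intro ren_cong) (auto simp: V0_def map_sum_def split: sum.split)
  have "tp L \<MM> {..<n} (t \<circ> h) M = tp L \<MM> {..<n} (s \<circ> h) M"
  proof -
    have "eqv (Inl ` {..<n} \<union> Inr ` M) (case_sum (s \<circ> h) id) (case_sum (t \<circ> h) id)"
      by (rule eqv_ren[OF eq, where g = "map_sum h id"]) (use hV in auto)
    then show ?thesis by (auto simp: tp_def eqv_def)
  qed
  moreover have "(s \<circ> h) ` {..<n} \<subseteq> univ \<MM>" "(t \<circ> h) ` {..<n} \<subseteq> univ \<MM>" using st hV by auto
  moreover have "inst \<phi>' (s \<circ> h) \<in> p" using in_p by (simp add: inst)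
  ultimately have "inst \<phi>' (t \<circ> h) \<in> p" using p \<phi>' unfolding invariant_type_def by blast
  then show ?thesis by (simp add: inst)
qed

lemma invariant_eqv:
  assumes p: "invariant I p" and eq: "eqv V s t" and M: "names_M V s t"
    and st: "s ` V \<subseteq> univ \<MM>" "t ` V \<subseteq> univ \<MM>" and \<phi>: "\<phi> \<in> Fm L (Inl ` I \<union> Inr ` V)"
  shows "ren (map_sum id s) \<phi> \<in> p \<longleftrightarrow> ren (map_sum id t) \<phi> \<in> p"
proof -
  from M obtain f where f: "\<And>m. m \<in> M \<Longrightarrow> f m \<in> V \<and> s (f m) = m \<and> t (f m) = m"
    unfolding names_M_def by metis
  have e: "eqv (Inl ` V \<union> Inr ` M) (case_sum s id) (case_sum t id)"
    by (rule eqv_ren[OF eq, where g = "case_sum id f"]) (use f in auto)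
  show ?thesis
    using invariant_eqv_M[OF p \<phi> st e] invariant_eqv_M[OF p \<phi> st(2,1) eqv_sym[OF e]] by blast
qed

lemma holds_map_sum: "holds \<MM> (case_sum c id) (ren (map_sum id s) \<phi>) \<longleftrightarrow> holds \<MM> (case_sum c s) \<phi>"
proof -
  have "case_sum c id \<circ> map_sum id s = case_sum c s" by (auto simp: fun_eq_iff split: sum.split)
  then show ?thesis by (simp add: holds_ren)
qed

lemma ren_map_sum_Fm:
  "\<phi> \<in> Fm L (Inl ` I \<union> Inr ` V) \<Longrightarrow> ren (map_sum id s) \<phi> \<in> Fm L (Inl ` I \<union> Inr ` s ` V)"
  by (rule ren_in_Fm) auto

text \<open>Whether \<open>\<phi>(x, a)\<close> belongs to an invariant type depends on the type of \<open>a\<close> over \<open>M\<close> alone. Hence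
  realizations over corresponding sets have corresponding types, and conversely.\<close>

lemma eqv_realizes:
  fixes I :: "'i set" and V :: "'v set"
  assumes p: "invariant I p" and eq: "eqv V s t" "names_M V s t"
    and st: "s ` V \<subseteq> univ \<MM>" "t ` V \<subseteq> univ \<MM>"
    and c: "realizes \<MM> I c (p \<restriction> (s ` V))" "realizes \<MM> I c' (p \<restriction> (t ` V))"
  shows "eqv (Inl ` I \<union> Inr ` V) (case_sum c s) (case_sum c' t)"
  unfolding eqv_def
proof
  fix \<phi> :: "('f, 'r, 'i + 'v) fm" assume \<phi>: "\<phi> \<in> Fm L (Inl ` I \<union> Inr ` V)"
  have "holds \<MM> (case_sum c s) \<phi> \<longleftrightarrow> ren (map_sum id s) \<phi> \<in> p"
    using realizes_iff[OF p c(1) st(1) ren_map_sum_Fm[OF \<phi>]] by (simp add: holds_map_sum)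
  also have "\<dots> \<longleftrightarrow> ren (map_sum id t) \<phi> \<in> p" by (rule invariant_eqv[OF p eq st \<phi>])
  also have "\<dots> \<longleftrightarrow> holds \<MM> (case_sum c' t) \<phi>"
    using realizes_iff[OF p c(2) st(2) ren_map_sum_Fm[OF \<phi>]] by (simp add: holds_map_sum)
  finally show "holds \<MM> (case_sum c s) \<phi> = holds \<MM> (case_sum c' t) \<phi>" .
qed

lemma realizes_eqv:
  assumes p: "invariant I p" and eq: "eqv (Inl ` I \<union> Inr ` V) (case_sum c s) (case_sum c' t)"
    and M: "names_M V s t" and st: "s ` V \<subseteq> univ \<MM>" "t ` V \<subseteq> univ \<MM>"
    and c: "realizes \<MM> I c (p \<restriction> (s ` V))" "c' ` I \<subseteq> univ \<MM>"
  shows "realizes \<MM> I c' (p \<restriction> (t ` V))"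
  unfolding realizes_def
proof (intro conjI c(2) ballI)
  fix \<psi> assume \<psi>: "\<psi> \<in> p \<restriction> (t ` V)"
  then have "\<psi> \<in> Fm L (Inl ` I \<union> Inr ` t ` V)" using restr_Fm[OF p] by blast
  moreover have "Inl ` I \<union> Inr ` t ` V \<subseteq> map_sum id t ` (Inl ` I \<union> Inr ` V)"
    by (simp add: image_Un image_image)
  ultimately obtain \<phi> where \<phi>: "\<phi> \<in> Fm L (Inl ` I \<union> Inr ` V)" "ren (map_sum id t) \<phi> = \<psi>"
    by (rule ren_preimage)
  have "eqv V s t" by (rule eqv_ren[OF eq, where g = Inr]) auto
  then have "ren (map_sum id s) \<phi> \<in> p"
    using invariant_eqv[OF p _ M st \<phi>(1)] \<phi>(2) \<psi> by (auto simp: restr_def)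
  then have "holds \<MM> (case_sum c s) \<phi>"
    using realizes_iff[OF p c(1) st(1) ren_map_sum_Fm[OF \<phi>(1)]] by (simp add: holds_map_sum)
  then have "holds \<MM> (case_sum c' t) \<phi>" using eqvD[OF eq \<phi>(1)] by blast
  then show "holds \<MM> (case_sum c' id) \<psi>" using \<phi>(2) by (simp add: holds_map_sum flip: \<phi>(2))
qed

lemma realizes_exists:
  assumes "invariant I p" "small \<kappa> I" "A \<subseteq> univ \<MM>" "small \<kappa> A"
  shows "\<exists>c. realizes \<MM> I c (p \<restriction> A)"
proof -
  have "consistent \<MM> I p" using assms(1) by (simp add: invariant_type_def complete_type_def)
  moreover have "p \<restriction> A \<subseteq> p" unfolding restr_def by blast
  ultimately have "consistent \<MM> I (p \<restriction> A)" unfolding consistent_def by (meson subset_trans)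
  then show ?thesis using realize_small[OF restr_Fm[OF assms(1)]] assms by metis
qed

lemma morley_univ: "morley I p A c \<Longrightarrow> c i ` I \<subseteq> univ \<MM>"
  by (simp add: morley_seq_of_def realizes_def)

lemma morleyD: "morley I p A c \<Longrightarrow> realizes \<MM> I (c i) (p \<restriction> (A \<union> (\<Union>j<i. c j ` I)))"
  by (simp add: morley_seq_of_def)

lemma morleyI: "(\<And>i. realizes \<MM> I (c i) (p \<restriction> (A \<union> (\<Union>j<i. c j ` I)))) \<Longrightarrow> morley I p A c"
  by (simp add: morley_seq_of_def)

lemma morley_mono: "morley I p B c \<Longrightarrow> A \<subseteq> B \<Longrightarrow> morley I p A c"
  by (rule morleyI) (erule realizes_restr_mono[OF morleyD], auto)

lemma morley_realizes: "morley I p A c \<Longrightarrow> realizes \<MM> I (c i) (p \<restriction> A)"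
  by (erule realizes_restr_mono[OF morleyD]) auto

lemma prefix_univ: "X \<subseteq> univ \<MM> \<Longrightarrow> (\<And>i. c i ` I \<subseteq> univ \<MM>) \<Longrightarrow> X \<union> (\<Union>j<(i :: nat). c j ` I) \<subseteq> univ \<MM>"
  by (intro Un_least UN_least)

lemma small_prefix: "small \<kappa> I \<Longrightarrow> small \<kappa> (\<Union>j<(i :: nat). c j ` I)"
  by (intro small_UN_finite small_image) auto

lemma morley_exists:
  fixes I :: "'i set"
  assumes "invariant I p" "small \<kappa> I" "A \<subseteq> univ \<MM>" "small \<kappa> A"
  shows "\<exists>c. morley I p A c"
proof -
  define P where "P c n x \<longleftrightarrow> realizes \<MM> I x (p \<restriction> (A \<union> (\<Union>j<n. c j ` I)))"
    for c :: "nat \<Rightarrow> 'i \<Rightarrow> 'a" and n :: nat and x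
  have "\<exists>c. \<forall>n. P c n (c n)"
  proof (rule dependent_wellorder_choice)
    fix x :: "'i \<Rightarrow> 'a" and f g :: "nat \<Rightarrow> 'i \<Rightarrow> 'a" and n :: nat
    assume "\<And>k. k < n \<Longrightarrow> f k = g k"
    then have "(\<Union>j<n. f j ` I) = (\<Union>j<n. g j ` I)" by simp
    then show "P f n x = P g n x" by (simp only: P_def)
  next
    fix n and f :: "nat \<Rightarrow> 'i \<Rightarrow> 'a"
    assume f: "\<And>k. k < n \<Longrightarrow> P f k (f k)"
    have "f k ` I \<subseteq> univ \<MM>" if "k < n" for k using f[OF that] by (simp add: P_def realizes_def)
    then have "A \<union> (\<Union>j<n. f j ` I) \<subseteq> univ \<MM>" using assms(3) by blast
    moreover have "small \<kappa> (A \<union> (\<Union>j<n. f j ` I))" using assms by (intro small_Un small_prefix)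
    ultimately show "\<exists>x. P f n x"
      unfolding P_def by (rule realizes_exists[OF assms(1,2)])
  qed
  then show ?thesis unfolding morley_seq_of_def P_def .
qed

lemma morley_append:
  assumes "\<And>i. i < N \<Longrightarrow> realizes \<MM> I (c i) (p \<restriction> (A \<union> (\<Union>j<i. c j ` I)))"
    and "morley I p (A \<union> (\<Union>j<N. c j ` I)) e"
  shows "morley I p A (\<lambda>i. if i < N then c i else e (i - N))"
proof (rule morleyI)
  fix i
  let ?c = "\<lambda>i. if i < N then c i else e (i - N)"
  show "realizes \<MM> I (?c i) (p \<restriction> (A \<union> (\<Union>j<i. ?c j ` I)))"
  proof (cases "i < N")
    case True
    then show ?thesis using assms(1)[OF True] by simp
  next
    case False
    have "(\<Union>j<i. ?c j ` I) \<subseteq> (\<Union>j<N. c j ` I) \<union> (\<Union>j<i - N. e j ` I)"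
    proof (rule UN_least)
      fix j assume "j \<in> {..<i}"
      then show "?c j ` I \<subseteq> (\<Union>j<N. c j ` I) \<union> (\<Union>j<i - N. e j ` I)"
      proof (cases "j < N")
        case True
        then show ?thesis by auto
      next
        case jN: False
        have "j - N \<in> {..<i - N}" using jN \<open>j \<in> {..<i}\<close> by auto
        then have "e (j - N) ` I \<subseteq> (\<Union>j<i - N. e j ` I)" by (rule UN_upper)
        then show ?thesis using jN by auto
      qed
    qed
    then have "A \<union> (\<Union>j<i. ?c j ` I) \<subseteq> A \<union> (\<Union>j<N. c j ` I) \<union> (\<Union>j<i - N. e j ` I)"
      unfolding Un_assoc by (rule Un_mono[OF subset_refl])
    from realizes_restr_mono[OF morleyD[OF assms(2)] this]
    have "realizes \<MM> I (e (i - N)) (p \<restriction> (A \<union> (\<Union>j<i. ?c j ` I)))" .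
    moreover have "?c i = e (i - N)" using False by simp
    ultimately show ?thesis by (simp only:)
  qed
qed

lemma morley_shift:
  assumes "morley I p A c"
  shows "morley I p (A \<union> (\<Union>j<N. c j ` I)) (\<lambda>i. c (N + i))"
proof (rule morleyI)
  fix i
  have "c (N + j) ` I \<subseteq> (\<Union>j<N + i. c j ` I)" if "j < i" for j
    using that by (intro UN_upper) simp
  moreover have "c j ` I \<subseteq> (\<Union>j<N + i. c j ` I)" if "j < N" for j
    using that by (intro UN_upper) simp
  ultimately have "A \<union> (\<Union>j<N. c j ` I) \<union> (\<Union>j<i. c (N + j) ` I) \<subseteq> A \<union> (\<Union>j<N + i. c j ` I)"
    by blast
  then show "realizes \<MM> I (c (N + i)) (p \<restriction> (A \<union> (\<Union>j<N. c j ` I) \<union> (\<Union>j<i. c (N + j) ` I)))"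
    by (rule realizes_restr_mono[OF morleyD[OF assms]])
qed

lemma morley_subseq:
  assumes "morley I p A c" "strict_mono f"
  shows "morley I p A (c \<circ> f)"
proof (rule morleyI)
  fix i
  have "(c \<circ> f) j ` I \<subseteq> (\<Union>j<f i. c j ` I)" if "j < i" for j
    unfolding comp_def using strict_monoD[OF assms(2) that] by (intro UN_upper) simp
  then have "A \<union> (\<Union>j<i. (c \<circ> f) j ` I) \<subseteq> A \<union> (\<Union>j<f i. c j ` I)" by blast
  from realizes_restr_mono[OF morleyD[OF assms(1)] this]
  show "realizes \<MM> I ((c \<circ> f) i) (p \<restriction> (A \<union> (\<Union>j<i. (c \<circ> f) j ` I)))" by simp
qed

abbreviation seq_names :: "'i set \<Rightarrow> (nat \<times> 'i) set" where
  "seq_names I \<equiv> UNIV \<times> I"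

lemma prefix_names_image:
  "case_sum (case_prod c) s ` (Inl ` ({..<n} \<times> I) \<union> Inr ` V) = s ` V \<union> (\<Union>j<n. c j ` I)"
  by (auto simp: image_Un image_image)

lemma prefix_names_Suc:
  assumes "eqv (Inl ` I \<union> Inr ` (Inl ` ({..<n} \<times> I) \<union> Inr ` V))
      (case_sum (c n) (case_sum (case_prod c) s)) (case_sum (c' n) (case_sum (case_prod c') t))"
  shows "eqv (Inl ` ({..<Suc n} \<times> I) \<union> Inr ` V) (case_sum (case_prod c) s) (case_sum (case_prod c') t)"
  by (rule eqv_ren[OF assms, where g =
        "case_sum (\<lambda>(k, i). if k = n then Inl i else Inr (Inl (k, i))) (\<lambda>v. Inr (Inr v))"])
     (auto split: if_splits)

lemma Suc_names_prefix:
  assumes "eqv (Inl ` seq_names I \<union> Inr ` V) (case_sum (case_prod c) s) (case_sum (case_prod c') t)"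
  shows "eqv (Inl ` I \<union> Inr ` (Inl ` ({..<n} \<times> I) \<union> Inr ` V))
      (case_sum (c n) (case_sum (case_prod c) s)) (case_sum (c' n) (case_sum (case_prod c') t))"
  by (rule eqv_ren[OF assms, where g = "case_sum (\<lambda>i. Inl (n, i)) id"]) auto

text \<open>The case of realizations, applied along the sequence; a formula mentions finitely many
  members.\<close>

lemma eqv_morley:
  fixes I :: "'i set" and V :: "'v set"
  assumes p: "invariant I p" and eq: "eqv V s t" "names_M V s t"
    and st: "s ` V \<subseteq> univ \<MM>" "t ` V \<subseteq> univ \<MM>"
    and c: "morley I p (s ` V) c" "morley I p (t ` V) c'"
  shows "eqv (Inl ` seq_names I \<union> Inr ` V) (case_sum (case_prod c) s) (case_sum (case_prod c') t)"
proof -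
  have n: "eqv (Inl ` ({..<n} \<times> I) \<union> Inr ` V) (case_sum (case_prod c) s) (case_sum (case_prod c') t)" for n
  proof (induction n)
    case 0
    show ?case by (rule eqv_ren[OF eq(1), where g = projr]) auto
  next
    case (Suc n)
    show ?case
    proof (rule prefix_names_Suc, rule eqv_realizes[OF p Suc names_M_Inr[OF eq(2)]])
      show "case_sum (case_prod c) s ` (Inl ` ({..<n} \<times> I) \<union> Inr ` V) \<subseteq> univ \<MM>"
        unfolding prefix_names_image by (rule prefix_univ[OF st(1) morley_univ[OF c(1)]])
      show "case_sum (case_prod c') t ` (Inl ` ({..<n} \<times> I) \<union> Inr ` V) \<subseteq> univ \<MM>"
        unfolding prefix_names_image by (rule prefix_univ[OF st(2) morley_univ[OF c(2)]])
    qed (unfold prefix_names_image, (rule morleyD[OF c(1)] morleyD[OF c(2)])+)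
  qed
  show ?thesis
    unfolding eqv_def
  proof
    fix \<phi> :: "('f, 'r, nat \<times> 'i + 'v) fm" assume \<phi>: "\<phi> \<in> Fm L (Inl ` seq_names I \<union> Inr ` V)"
    obtain n where n': "\<And>k i. Inl (k, i) \<in> fv \<phi> \<Longrightarrow> k < n"
      using positions_bounded[OF finite_fv] by blast
    have "u \<in> Inl ` ({..<n} \<times> I) \<union> Inr ` V" if "u \<in> fv \<phi>" for u
    proof (cases u)
      case (Inl a)
      then have "a \<in> seq_names I" using FmD[OF \<phi>] that by auto
      then show ?thesis using Inl n'[of "fst a" "snd a"] that by (cases a) simp
    next
      case (Inr v)
      then show ?thesis using FmD[OF \<phi>] that by auto
    qed
    then have "\<phi> \<in> Fm L (Inl ` ({..<n} \<times> I) \<union> Inr ` V)"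
      by (intro Fm_mono[OF _ Fm_fv[OF \<phi>]] subsetI)
    then show "holds \<MM> (case_sum (case_prod c) s) \<phi> = holds \<MM> (case_sum (case_prod c') t) \<phi>"
      by (rule eqvD[OF n])
  qed
qed

lemma morley_eqv:
  assumes p: "invariant I p" and M: "names_M V s t"
    and eq: "eqv (Inl ` seq_names I \<union> Inr ` V) (case_sum (case_prod c) s) (case_sum (case_prod c') t)"
    and st: "s ` V \<subseteq> univ \<MM>" "t ` V \<subseteq> univ \<MM>"
    and c: "morley I p (s ` V) c" "\<And>i. c' i ` I \<subseteq> univ \<MM>"
  shows "morley I p (t ` V) c'"
proof (rule morleyI)
  fix i
  have "realizes \<MM> I (c' i) (p \<restriction> (case_sum (case_prod c') t ` (Inl ` ({..<i} \<times> I) \<union> Inr ` V)))"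
  proof (rule realizes_eqv[OF p Suc_names_prefix[OF eq] names_M_Inr[OF M] _ _ _ c(2)])
    show "case_sum (case_prod c) s ` (Inl ` ({..<i} \<times> I) \<union> Inr ` V) \<subseteq> univ \<MM>"
      unfolding prefix_names_image by (rule prefix_univ[OF st(1) morley_univ[OF c(1)]])
    show "case_sum (case_prod c') t ` (Inl ` ({..<i} \<times> I) \<union> Inr ` V) \<subseteq> univ \<MM>"
      unfolding prefix_names_image by (rule prefix_univ[OF st(2) c(2)])
    show "realizes \<MM> I (c i) (p \<restriction> (case_sum (case_prod c) s ` (Inl ` ({..<i} \<times> I) \<union> Inr ` V)))"
      unfolding prefix_names_image by (rule morleyD[OF c(1)])
  qed
  then show "realizes \<MM> I (c' i) (p \<restriction> (t ` V \<union> (\<Union>j<i. c' j ` I)))"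
    unfolding prefix_names_image .
qed

end

section \<open>A criterion for the third strong order property\<close>

context saturated_structure
begin

text \<open>The three relations for \<open>i < j\<close> are chosen so that a 3-cycle \<open>0, 1, 2\<close> of the conjunction
  is impossible: the tuple \<open>u\<^sub>0\<close> satisfies \<open>\<phi>(x, v\<^sub>1)\<close> by the edge from 0 to 1 and \<open>\<psi>(x, w\<^sub>2)\<close> by
  the edge from 2 to 0, while the edge from 1 to 2 forbids a common solution.\<close>

lemma SOP3_criterion:
  fixes \<phi> :: "('f, 'r, 'x + 'y) fm" and \<psi> :: "('f, 'r, 'x + 'z) fm"
  assumes \<phi>: "\<phi> \<in> Fm L (Inl ` X \<union> Inr ` Y)" and \<psi>: "\<psi> \<in> Fm L (Inl ` X \<union> Inr ` Z)"
    and u: "\<And>i :: nat. u i ` X \<subseteq> univ \<MM>" and v: "\<And>i. v i ` Y \<subseteq> univ \<MM>" and w: "\<And>i. w i ` Z \<subseteq> univ \<MM>"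
    and uv: "\<And>i j. i < j \<Longrightarrow> holds \<MM> (case_sum (u i) (v j)) \<phi>"
    and uw: "\<And>i j. i < j \<Longrightarrow> holds \<MM> (case_sum (u j) (w i)) \<psi>"
    and vw: "\<And>i j x. i < j \<Longrightarrow> x ` X \<subseteq> univ \<MM> \<Longrightarrow> holds \<MM> (case_sum x (v i)) \<phi> \<Longrightarrow>
      \<not> holds \<MM> (case_sum x (w j)) \<psi>"
  shows "SOP L \<MM> 3"
proof -
  let ?V = "Inl ` X \<union> Inr ` (Inl ` Y \<union> Inr ` Z) :: ('x + 'y + 'z) set"
  let ?\<phi> = "ren (map_sum id Inl) \<phi> :: ('f, 'r, 'x + 'y + 'z) fm"
  let ?\<psi> = "ren (map_sum id Inr) \<psi> :: ('f, 'r, 'x + 'y + 'z) fm"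
  have \<phi>V: "?\<phi> \<in> Fm L ?V" using \<phi> by (rule ren_in_Fm) auto
  have \<psi>V: "?\<psi> \<in> Fm L ?V" using \<psi> by (rule ren_in_Fm) auto
  have \<phi>_iff: "holds \<MM> (case_sum x (case_sum y z)) ?\<phi> \<longleftrightarrow> holds \<MM> (case_sum x y) \<phi>" for x y z
  proof -
    have "case_sum x (case_sum y z) \<circ> map_sum id Inl = case_sum x y"
      by (auto simp: fun_eq_iff split: sum.split)
    then show ?thesis by (simp add: holds_ren)
  qed
  have \<psi>_iff: "holds \<MM> (case_sum x (case_sum y z)) ?\<psi> \<longleftrightarrow> holds \<MM> (case_sum x z) \<psi>" for x y z
  proof -
    have "case_sum x (case_sum y z) \<circ> map_sum id Inr = case_sum x z"
      by (auto simp: fun_eq_iff split: sum.split)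
    then show ?thesis by (simp add: holds_ren)
  qed
  have "And ?\<phi> ?\<psi> \<in> Fm L ?V" using \<phi>V \<psi>V by (simp add: And_Fm)
  from ex_fm[OF this] obtain \<chi> where \<chi>: "\<chi> \<in> Fm L (Inl ` Y \<union> Inr ` Z)"
    "\<forall>s. holds \<MM> s \<chi> \<longleftrightarrow> (\<exists>x. x ` X \<subseteq> univ \<MM> \<and> holds \<MM> (case_sum x s) (And ?\<phi> ?\<psi>))"
    by (elim bexE, intro that)
  have \<chi>_iff: "holds \<MM> (case_sum y z) \<chi> \<longleftrightarrow>
      (\<exists>x. x ` X \<subseteq> univ \<MM> \<and> holds \<MM> (case_sum x y) \<phi> \<and> holds \<MM> (case_sum x z) \<psi>)" for y z
    by (simp add: \<chi>(2) holds_And \<phi>_iff \<psi>_iff)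
  \<comment> \<open>The variables that occur are enumerated as one \<open>m\<close>-tuple, as the order property asks for.\<close>
  define V0 where "V0 = fv ?\<phi> \<union> fv ?\<psi> \<union> Inr ` fv \<chi>"
  have "finite V0" unfolding V0_def by (intro finite_UnI finite_imageI finite_fv)
  then obtain h m where h: "bij_betw h {..<m :: nat} V0"
    using ex_bij_betw_nat_finite[of V0] by (auto simp: atLeast0LessThan)
  define k where "k = the_inv_into {..<m} h"
  have k: "k v < m" "h (k v) = v" if "v \<in> V0" for v
    using that bij_betw_the_inv_into[OF h] f_the_inv_into_f_bij_betw[OF h] unfolding k_def
    by (auto simp: bij_betw_def)
  have hV: "h l \<in> V0" if "l < m" for l using h that by (auto simp: bij_betw_def)
  have V0: "V0 \<subseteq> ?V"
    unfolding V0_def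
    by (intro Un_least FmD[OF \<phi>V] FmD[OF \<psi>V] subset_trans[OF image_mono[OF FmD[OF \<chi>(1)]] Un_upper2])
  have fv\<phi>: "map_sum id Inl a \<in> V0" if "a \<in> fv \<phi>" for a using that by (simp add: V0_def fm.set_map)
  have fv\<psi>: "map_sum id Inr a \<in> V0" if "a \<in> fv \<psi>" for a using that by (simp add: V0_def fm.set_map)
  have fv\<chi>: "Inr a \<in> V0" if "a \<in> fv \<chi>" for a using that by (simp add: V0_def)
  define R1 where "R1 = ren (case_sum (\<lambda>x. Inl (k (Inl x))) (\<lambda>y. Inr (k (Inr (Inl y))))) \<phi>"
  define R2 where "R2 = ren (case_sum (\<lambda>x. Inr (k (Inl x))) (\<lambda>z. Inl (k (Inr (Inr z))))) \<psi>"
  define R3 where "R3 = ren (case_sum (\<lambda>y. Inl (k (Inr (Inl y)))) (\<lambda>z. Inr (k (Inr (Inr z))))) \<chi>"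
  define R :: "('f, 'r, nat + nat) fm" where "R = And (And R1 R2) (Neg R3)"
  have R1_iff: "holds \<MM> (case_sum e e') R1 \<longleftrightarrow>
      holds \<MM> (case_sum (\<lambda>x. e (k (Inl x))) (\<lambda>y. e' (k (Inr (Inl y))))) \<phi>" for e e'
    unfolding R1_def holds_ren by (rule holds_cong) (simp split: sum.split)
  have R2_iff: "holds \<MM> (case_sum e e') R2 \<longleftrightarrow>
      holds \<MM> (case_sum (\<lambda>x. e' (k (Inl x))) (\<lambda>z. e (k (Inr (Inr z))))) \<psi>" for e e'
    unfolding R2_def holds_ren by (rule holds_cong) (simp split: sum.split)
  have R3_iff: "holds \<MM> (case_sum e e') R3 \<longleftrightarrow>
      holds \<MM> (case_sum (\<lambda>y. e (k (Inr (Inl y)))) (\<lambda>z. e' (k (Inr (Inr z))))) \<chi>" for e e'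
    unfolding R3_def holds_ren by (rule holds_cong) (simp split: sum.split)
  let ?W = "Inl ` {..<m} \<union> Inr ` {..<m} :: (nat + nat) set"
  have "R1 \<in> Fm L ?W" unfolding R1_def
  proof (rule ren_in_Fm[OF Fm_fv[OF \<phi>]])
    fix a assume "a \<in> fv \<phi>"
    from k(1)[OF fv\<phi>[OF this]]
    show "case_sum (\<lambda>x. Inl (k (Inl x))) (\<lambda>y. Inr (k (Inr (Inl y)))) a \<in> ?W" by - (cases a, auto)
  qed
  moreover have "R2 \<in> Fm L ?W" unfolding R2_def
  proof (rule ren_in_Fm[OF Fm_fv[OF \<psi>]])
    fix a assume "a \<in> fv \<psi>"
    from k(1)[OF fv\<psi>[OF this]]
    show "case_sum (\<lambda>x. Inr (k (Inl x))) (\<lambda>z. Inl (k (Inr (Inr z)))) a \<in> ?W" by - (cases a, auto)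
  qed
  moreover have "R3 \<in> Fm L ?W" unfolding R3_def
  proof (rule ren_in_Fm[OF Fm_fv[OF \<chi>(1)]])
    fix a assume "a \<in> fv \<chi>"
    from k(1)[OF fv\<chi>[OF this]]
    show "case_sum (\<lambda>y. Inl (k (Inr (Inl y)))) (\<lambda>z. Inr (k (Inr (Inr z)))) a \<in> ?W" by - (cases a, auto)
  qed
  ultimately have R_Fm: "R \<in> Fm L ?W" by (simp add: R_def And_Fm Neg_Fm)
  have no_cycle: False
    if e: "\<And>i. i < 3 \<Longrightarrow> e i ` {..<m} \<subseteq> univ \<MM>"
      "\<And>i. i < 3 \<Longrightarrow> holds \<MM> (case_sum (e i) (e (Suc i mod 3))) R" for e :: "nat \<Rightarrow> nat \<Rightarrow> 'a"
  proof -
    obtain z where z: "z \<in> univ \<MM>" using univ_nonempty by blast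
    have e01: "holds \<MM> (case_sum (e 0) (e 1)) R" using e(2)[of 0] by simp
    have e12: "holds \<MM> (case_sum (e 1) (e 2)) R" using e(2)[of 1] by (simp add: numeral_2_eq_2)
    have e20: "holds \<MM> (case_sum (e 2) (e 0)) R" using e(2)[of 2] by simp
    let ?y = "\<lambda>y. e 1 (k (Inr (Inl y)))" and ?z = "\<lambda>z. e 2 (k (Inr (Inr z)))"
    define x where "x = (\<lambda>a. if Inl a \<in> V0 then e 0 (k (Inl a)) else z)"
    have "x a \<in> univ \<MM>" for a
    proof (cases "Inl a \<in> V0")
      case True
      have "e 0 ` {..<m} \<subseteq> univ \<MM>" using e(1)[of 0] by simp
      then show ?thesis using k(1)[OF True] True by (auto simp: x_def)
    qed (simp add: x_def z)
    then have xX: "x ` X \<subseteq> univ \<MM>" by blast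
    have x: "x a = e 0 (k (Inl a))" if "Inl a \<in> V0" for a using that by (simp add: x_def)
    have "holds \<MM> (case_sum (\<lambda>x. e 0 (k (Inl x))) ?y) \<phi>" using e01 by (simp add: R_def holds_And R1_iff)
    moreover have "holds \<MM> (case_sum x ?y) \<phi> = holds \<MM> (case_sum (\<lambda>x. e 0 (k (Inl x))) ?y) \<phi>"
    proof (rule holds_cong)
      fix a assume "a \<in> fv \<phi>"
      then show "case_sum x ?y a = case_sum (\<lambda>x. e 0 (k (Inl x))) ?y a"
        using x fv\<phi>[of a] by - (cases a, simp_all)
    qed
    ultimately have x\<phi>: "holds \<MM> (case_sum x ?y) \<phi>" by simp
    have "holds \<MM> (case_sum (\<lambda>x. e 0 (k (Inl x))) ?z) \<psi>" using e20 by (simp add: R_def holds_And R2_iff)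
    moreover have "holds \<MM> (case_sum x ?z) \<psi> = holds \<MM> (case_sum (\<lambda>x. e 0 (k (Inl x))) ?z) \<psi>"
    proof (rule holds_cong)
      fix a assume "a \<in> fv \<psi>"
      then show "case_sum x ?z a = case_sum (\<lambda>x. e 0 (k (Inl x))) ?z a"
        using x fv\<psi>[of a] by - (cases a, simp_all)
    qed
    ultimately have "holds \<MM> (case_sum x ?z) \<psi>" by simp
    then have "holds \<MM> (case_sum ?y ?z) \<chi>" using x\<phi> xX \<chi>_iff by blast
    then show False using e12 by (simp add: R_def holds_And holds_Neg R3_iff)
  qed
  define \<sigma> where "\<sigma> i = case_sum (u i) (case_sum (v i) (w i))" for i
  define a where "a i l = \<sigma> i (h l)" for i l
  have \<sigma>V: "\<sigma> i x \<in> univ \<MM>" if "x \<in> ?V" for i x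
    using that u[of i] v[of i] w[of i] by (auto simp: \<sigma>_def)
  have a_univ: "a i ` {..<m} \<subseteq> univ \<MM>" for i
  proof
    fix y assume "y \<in> a i ` {..<m}"
    then obtain l where "l < m" "y = \<sigma> i (h l)" by (auto simp: a_def)
    then show "y \<in> univ \<MM>" using hV[of l] V0 \<sigma>V by blast
  qed
  have ak: "a i (k x) = \<sigma> i x" if "x \<in> V0" for i x using k(2)[OF that] by (simp add: a_def)
  have a_R: "holds \<MM> (case_sum (a i) (a j)) R" if ij: "i < j" for i j
  proof -
    have "holds \<MM> (case_sum (\<lambda>x. a i (k (Inl x))) (\<lambda>y. a j (k (Inr (Inl y))))) \<phi>
        = holds \<MM> (case_sum (u i) (v j)) \<phi>"
    proof (rule holds_cong)
      fix b assume "b \<in> fv \<phi>"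
      then show "case_sum (\<lambda>x. a i (k (Inl x))) (\<lambda>y. a j (k (Inr (Inl y)))) b = case_sum (u i) (v j) b"
        using ak fv\<phi>[of b] by - (cases b, simp_all add: \<sigma>_def)
    qed
    then have "holds \<MM> (case_sum (a i) (a j)) R1" using uv[OF ij] by (simp add: R1_iff)
    moreover have "holds \<MM> (case_sum (\<lambda>x. a j (k (Inl x))) (\<lambda>z. a i (k (Inr (Inr z))))) \<psi>
        = holds \<MM> (case_sum (u j) (w i)) \<psi>"
    proof (rule holds_cong)
      fix b assume "b \<in> fv \<psi>"
      then show "case_sum (\<lambda>x. a j (k (Inl x))) (\<lambda>z. a i (k (Inr (Inr z)))) b = case_sum (u j) (w i) b"
        using ak fv\<psi>[of b] by - (cases b, simp_all add: \<sigma>_def)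
    qed
    then have "holds \<MM> (case_sum (a i) (a j)) R2" using uw[OF ij] by (simp add: R2_iff)
    moreover have "holds \<MM> (case_sum (\<lambda>y. a i (k (Inr (Inl y)))) (\<lambda>z. a j (k (Inr (Inr z))))) \<chi>
        = holds \<MM> (case_sum (v i) (w j)) \<chi>"
    proof (rule holds_cong)
      fix b assume "b \<in> fv \<chi>"
      then show "case_sum (\<lambda>y. a i (k (Inr (Inl y)))) (\<lambda>z. a j (k (Inr (Inr z)))) b = case_sum (v i) (w j) b"
        using ak fv\<chi>[of b] by - (cases b, simp_all add: \<sigma>_def)
    qed
    moreover have "\<not> holds \<MM> (case_sum (v i) (w j)) \<chi>" using vw[OF ij] \<chi>_iff by blast
    ultimately show ?thesis by (simp add: R_def holds_And holds_Neg R3_iff)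
  qed
  show ?thesis
    unfolding SOP_def
  proof (intro exI[of _ m] bexI[of _ R] conjI)
    show "\<nexists>e. (\<forall>i<3. e i ` {..<m} \<subseteq> univ \<MM>) \<and> (\<forall>i<3. holds \<MM> (case_sum (e i) (e (Suc i mod 3))) R)"
      using no_cycle by blast
    show "\<exists>a :: nat \<Rightarrow> nat \<Rightarrow> 'a. (\<forall>i. a i ` {..<m} \<subseteq> univ \<MM>) \<and>
        (\<forall>i j. i < j \<longrightarrow> holds \<MM> (case_sum (a i) (a j)) R)"
      using a_univ a_R by blast
  qed (rule R_Fm)
qed

end

section \<open>Making a Morley sequence Morley over a new realization\<close>

context saturated_over_model
begin

text \<open>Otherwise, by compactness, there are a formula \<open>\<phi>(x, Y)\<close>, a consequence of the conditions \<open>\<Sigma>\<close> on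
  finitely many blocks, and a formula \<open>\<theta>(x, b)\<close> over \<open>C\<close>, true of the Morley sequences of \<open>p\<close> over
  \<open>C \<union> b\<close>, without a common solution. Choose in turn a copy \<open>f\<^sub>i\<close> of \<open>Y\<close> over \<open>C\<close>, a realization \<open>g\<^sub>i\<close>
  of \<open>s\<close> and a Morley sequence \<open>e\<^sub>i\<close> of \<open>p\<close>, the last two over everything chosen before.

  The beginnings of the earlier \<open>e\<^sub>k\<close> together have the type over \<open>C\<close> of a beginning of \<open>c\<close>, so \<open>f\<^sub>i\<close>
  can be taken with \<open>\<phi>(e\<^sub>k, f\<^sub>i)\<close> for all \<open>k < i\<close>. Moreover \<open>\<theta>(e\<^sub>i, g\<^sub>k)\<close> holds for \<open>k < i\<close>, since \<open>e\<^sub>i\<close>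
  is Morley over \<open>C \<union> g\<^sub>k\<close>. And \<open>\<phi>(x, f\<^sub>k)\<close> and \<open>\<theta>(x, g\<^sub>i)\<close> have no common solution for \<open>k < i\<close>, since
  \<open>g\<^sub>i\<close> realizes \<open>s\<close> over \<open>f\<^sub>k\<close> as \<open>b\<close> does over \<open>Y\<close>. This is the third strong order property.\<close>

lemma morley_absorb:
  fixes I :: "'i set" and J :: "'j set"
  assumes nsop: "\<not> SOP L \<MM> 3"
    and p: "invariant I p" and I: "small \<kappa> I" and s: "invariant J s" and J: "small \<kappa> J"
    and C: "M \<subseteq> C" "C \<subseteq> univ \<MM>" "small \<kappa> C" and Y: "Y \<subseteq> univ \<MM>" "small \<kappa> Y"
    and \<Sigma>: "\<Sigma> \<subseteq> Fm L (Inl ` ({..<n} \<times> I) \<union> Inr ` Y)"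
    and c: "morley I p C c"
    and blocks: "\<And>k \<phi>. \<phi> \<in> \<Sigma> \<Longrightarrow> holds \<MM> (case_sum (\<lambda>(i, x). c (k * n + i) x) id) \<phi>"
    and b: "realizes \<MM> J b (s \<restriction> (C \<union> Y))"
  shows "\<exists>c'. morley I p (C \<union> b ` J) c' \<and>
    (\<forall>k. \<forall>\<phi>\<in>\<Sigma>. holds \<MM> (case_sum (\<lambda>(i, x). c' (k * n + i) x) id) \<phi>)"
proof -
  have bJ: "b ` J \<subseteq> univ \<MM>" "small \<kappa> (b ` J)" using b small_image[OF J] by (auto simp: realizes_def)
  have CbJ: "C \<union> b ` J \<subseteq> univ \<MM>" "small \<kappa> (C \<union> b ` J)" using C bJ by (auto intro: small_Un)
  obtain cs where cs: "morley I p (C \<union> b ` J) cs" using morley_exists[OF p I CbJ] by blast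
  let ?Z = "Inl ` J \<union> Inr ` C :: ('j + 'a) set"
  let ?zb = "case_sum b id"
  have zb_image: "?zb ` ?Z = C \<union> b ` J" by (auto simp: image_Un image_image)
  have names_Z: "names_M ?Z (case_sum g id) (case_sum g' id)" for g g' :: "'j \<Rightarrow> 'a"
    using names_M_Inr[OF names_M_id[OF C(1)]] .
  show ?thesis
  proof (cases "n = 0")
    case True
    \<comment> \<open>Empty blocks carry no condition on the sequence.\<close>
    have "holds \<MM> (case_sum (\<lambda>(i, x). cs (k * n + i) x) id) \<phi>" if "\<phi> \<in> \<Sigma>" for k \<phi>
    proof -
      have "\<phi> \<in> Fm L (Inl ` ({..<n} \<times> I) \<union> Inr ` Y)" using that \<Sigma> by blast
      then have "holds \<MM> (case_sum (\<lambda>(i, x). cs (k * n + i) x) id) \<phi>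
          = holds \<MM> (case_sum (\<lambda>(i, x). c (k * n + i) x) id) \<phi>"
        by (rule holds_cong_Fm) (use True in auto)
      then show ?thesis using blocks[OF that] by simp
    qed
    then show ?thesis using cs by blast
  next
    case False
    define shift :: "nat \<Rightarrow> (nat \<times> 'i) + 'a \<Rightarrow> (nat \<times> 'i) + 'a" where
      "shift k = map_sum (\<lambda>(i, x). (k * n + i, x)) id" for k
    have shift_iff: "holds \<MM> (case_sum w y) (ren (shift k) \<phi>)
        \<longleftrightarrow> holds \<MM> (case_sum (\<lambda>(i, x). w (k * n + i, x)) y) \<phi>" for w y k \<phi>
      unfolding holds_ren by (rule holds_cong) (simp add: shift_def map_sum_def split: sum.split prod.split)
    define \<Gamma>1 where "\<Gamma>1 = (\<Union>k. ren (shift k) ` \<Sigma>)"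
    define \<Gamma>2 where "\<Gamma>2 = {\<theta> \<in> Fm L (Inl ` seq_names I \<union> Inr ` ?Z). holds \<MM> (case_sum (case_prod cs) ?zb) \<theta>}"
    have \<Gamma>1: "\<Gamma>1 \<subseteq> Fm L (Inl ` seq_names I \<union> Inr ` Y)"
    proof
      fix \<psi> assume "\<psi> \<in> \<Gamma>1"
      then obtain k \<phi> where k: "\<phi> \<in> \<Sigma>" "\<psi> = ren (shift k) \<phi>" unfolding \<Gamma>1_def by blast
      then have "\<phi> \<in> Fm L (Inl ` ({..<n} \<times> I) \<union> Inr ` Y)" using \<Sigma> by blast
      then show "\<psi> \<in> Fm L (Inl ` seq_names I \<union> Inr ` Y)"
        unfolding k(2) by (rule ren_in_Fm) (auto simp: shift_def)
    qed
    have \<Gamma>2: "\<Gamma>2 \<subseteq> Fm L (Inl ` seq_names I \<union> Inr ` ?Z)" unfolding \<Gamma>2_def by blast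
    define V :: "('a + 'j + 'a) set" where "V = Inl ` Y \<union> Inr ` ?Z"
    define t :: "'a + 'j + 'a \<Rightarrow> 'a" where "t = case_sum id ?zb"
    have l_iff: "holds \<MM> (case_sum w (case_sum y z)) (ren (map_sum id Inl) \<phi>) \<longleftrightarrow> holds \<MM> (case_sum w y) \<phi>"
      for w y \<phi> and z :: "'j + 'a \<Rightarrow> 'a"
      unfolding holds_ren by (rule holds_cong) (simp add: map_sum_def split: sum.split)
    have r_iff: "holds \<MM> (case_sum w (case_sum y z)) (ren (map_sum id Inr) \<phi>) \<longleftrightarrow> holds \<MM> (case_sum w z) \<phi>"
      for w z \<phi> and y :: "'a \<Rightarrow> 'a"
      unfolding holds_ren by (rule holds_cong) (simp add: map_sum_def split: sum.split)
    define \<Gamma> where "\<Gamma> = ren (map_sum id Inl) ` \<Gamma>1 \<union> ren (map_sum id Inr) ` \<Gamma>2"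
    have \<Gamma>: "\<Gamma> \<subseteq> Fm L (Inl ` seq_names I \<union> Inr ` V)"
    proof -
      have "ren (map_sum id Inl) \<phi> \<in> Fm L (Inl ` seq_names I \<union> Inr ` V)" if "\<phi> \<in> \<Gamma>1" for \<phi>
        using subsetD[OF \<Gamma>1 that] by (rule ren_in_Fm) (auto simp: V_def)
      moreover have "ren (map_sum id Inr) \<phi> \<in> Fm L (Inl ` seq_names I \<union> Inr ` V)" if "\<phi> \<in> \<Gamma>2" for \<phi>
        using subsetD[OF \<Gamma>2 that] by (rule ren_in_Fm) (auto simp: V_def)
      ultimately show ?thesis unfolding \<Gamma>_def by blast
    qed
    have tV: "t ` V = Y \<union> (C \<union> b ` J)" unfolding t_def V_def image_Un image_image by auto
    have tV': "t ` V \<subseteq> univ \<MM>" "small \<kappa> (t ` V)"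
      unfolding tV using Y CbJ by (auto intro: small_Un)
    have fin: "\<exists>w. w ` seq_names I \<subseteq> univ \<MM> \<and> (\<forall>\<phi>\<in>F. holds \<MM> (case_sum w t) \<phi>)"
      if F: "finite F" "F \<subseteq> \<Gamma>" for F
    proof (rule ccontr)
      assume unsat: "\<not> ?thesis"
      have "finite (F \<inter> ren (map_sum id Inl) ` \<Gamma>1)" "F \<inter> ren (map_sum id Inl) ` \<Gamma>1 \<subseteq> ren (map_sum id Inl) ` \<Gamma>1"
        using F(1) by auto
      then obtain F1 where F1: "F1 \<subseteq> \<Gamma>1" "finite F1"
        "F \<inter> ren (map_sum id Inl) ` \<Gamma>1 = ren (map_sum id Inl) ` F1" by (meson finite_subset_image)
      have "finite (F \<inter> ren (map_sum id Inr) ` \<Gamma>2)" "F \<inter> ren (map_sum id Inr) ` \<Gamma>2 \<subseteq> ren (map_sum id Inr) ` \<Gamma>2"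
        using F(1) by auto
      then obtain F2 where F2: "F2 \<subseteq> \<Gamma>2" "finite F2"
        "F \<inter> ren (map_sum id Inr) ` \<Gamma>2 = ren (map_sum id Inr) ` F2" by (meson finite_subset_image)
      have F12: "F = ren (map_sum id Inl) ` F1 \<union> ren (map_sum id Inr) ` F2"
        using F(2) unfolding F1(3)[symmetric] F2(3)[symmetric] \<Gamma>_def by blast
      from conj_fm[OF F1(2) subset_trans[OF F1(1) \<Gamma>1]] obtain \<phi> where
        \<phi>: "\<phi> \<in> Fm L (Inl ` seq_names I \<union> Inr ` Y)" "\<forall>s. holds \<MM> s \<phi> \<longleftrightarrow> (\<forall>\<chi>\<in>F1. holds \<MM> s \<chi>)"
        by (elim bexE, intro that)
      from conj_fm[OF F2(2) subset_trans[OF F2(1) \<Gamma>2]] obtain \<theta> where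
        \<theta>: "\<theta> \<in> Fm L (Inl ` seq_names I \<union> Inr ` ?Z)" "\<forall>s. holds \<MM> s \<theta> \<longleftrightarrow> (\<forall>\<chi>\<in>F2. holds \<MM> s \<chi>)"
        by (elim bexE, intro that)
      have unsat': "\<not> (holds \<MM> (case_sum w id) \<phi> \<and> holds \<MM> (case_sum w ?zb) \<theta>)"
        if w: "w ` seq_names I \<subseteq> univ \<MM>" for w
      proof
        assume "holds \<MM> (case_sum w id) \<phi> \<and> holds \<MM> (case_sum w ?zb) \<theta>"
        then have "\<forall>\<chi>\<in>F1. holds \<MM> (case_sum w id) \<chi>" "\<forall>\<chi>\<in>F2. holds \<MM> (case_sum w ?zb) \<chi>"
          using \<phi>(2) \<theta>(2) by blast+
        then have "\<forall>\<phi>\<in>F. holds \<MM> (case_sum w t) \<phi>"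
          unfolding F12 t_def ball_Un by (simp add: l_iff r_iff)
        then show False using unsat w by blast
      qed
      have \<phi>_c: "holds \<MM> (case_sum (\<lambda>(i, x). c (K * n + i) x) id) \<phi>" for K
        unfolding \<phi>(2)[rule_format]
      proof
        fix \<chi> assume "\<chi> \<in> F1"
        then obtain k \<phi>0 where k: "\<phi>0 \<in> \<Sigma>" "\<chi> = ren (shift k) \<phi>0" using F1(1) unfolding \<Gamma>1_def by blast
        have "(\<lambda>(i, x). c ((K + k) * n + i) x) = (\<lambda>(i, x). (\<lambda>(i, x). c (K * n + i) x) (k * n + i, x))"
          by (simp add: algebra_simps)
        then show "holds \<MM> (case_sum (\<lambda>(i, x). c (K * n + i) x) id) \<chi>"
          using blocks[OF k(1), of "K + k"] unfolding k(2) shift_iff by simp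
      qed
      have \<theta>_cs: "holds \<MM> (case_sum (case_prod cs) ?zb) \<theta>"
        unfolding \<theta>(2)[rule_format] using F2(1) unfolding \<Gamma>2_def by blast
      obtain N1 where N1: "\<forall>k i. Inl (k, i) \<in> fv \<phi> \<longrightarrow> k < N1" using positions_bounded[OF finite_fv] by blast
      obtain N2 where N2: "\<forall>k i. Inl (k, i) \<in> fv \<theta> \<longrightarrow> k < N2" using positions_bounded[OF finite_fv] by blast
      \<comment> \<open>Segments of length \<open>N\<close> consist of whole blocks and contain all positions in \<open>\<phi>\<close> and \<open>\<theta>\<close>.\<close>
      define N where "N = Suc (N1 + N2) * n"
      have N: "0 < N" "N1 \<le> N" "N2 \<le> N"
      proof -
        have "Suc (N1 + N2) * 1 \<le> N" unfolding N_def using False by (intro mult_le_mono2) simp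
        then show "0 < N" "N1 \<le> N" "N2 \<le> N" by auto
      qed
      let ?X = "{..<N} \<times> I"
      have \<phi>X: "\<phi> \<in> Fm L (Inl ` ?X \<union> Inr ` Y)"
      proof (rule Fm_mono[OF _ Fm_fv[OF \<phi>(1)]], rule subsetI)
        fix u assume u: "u \<in> fv \<phi>"
        then have "u \<in> Inl ` seq_names I \<union> Inr ` Y" using FmD[OF \<phi>(1)] by blast
        then show "u \<in> Inl ` ?X \<union> Inr ` Y" using u N1 N(2) by fastforce
      qed
      have \<theta>X: "\<theta> \<in> Fm L (Inl ` ?X \<union> Inr ` ?Z)"
      proof (rule Fm_mono[OF _ Fm_fv[OF \<theta>(1)]], rule subsetI)
        fix u assume u: "u \<in> fv \<theta>"
        then have "u \<in> Inl ` seq_names I \<union> Inr ` ?Z" using FmD[OF \<theta>(1)] by blast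
        then show "u \<in> Inl ` ?X \<union> Inr ` ?Z" using u N2 N(3) by fastforce
      qed
      have unsatX: "\<not> (holds \<MM> (case_sum w id) \<phi> \<and> holds \<MM> (case_sum w ?zb) \<theta>)"
        if w: "w ` ?X \<subseteq> univ \<MM>" for w
      proof -
        obtain z where z: "z \<in> univ \<MM>" using univ_nonempty by blast
        define w' where "w' a = (if a \<in> ?X then w a else z)" for a
        have "w' a \<in> univ \<MM>" for a using w z unfolding w'_def by auto
        then have "w' ` seq_names I \<subseteq> univ \<MM>" by blast
        moreover have "holds \<MM> (case_sum w id) \<phi> = holds \<MM> (case_sum w' id) \<phi>"
          by (rule holds_cong_Fm[OF \<phi>X]) (auto simp: w'_def)
        moreover have "holds \<MM> (case_sum w ?zb) \<theta> = holds \<MM> (case_sum w' ?zb) \<theta>"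
          by (rule holds_cong_Fm[OF \<theta>X]) (auto simp: w'_def)
        ultimately show ?thesis using unsat'[of w'] by blast
      qed

      \<comment> \<open>Stage \<open>j\<close> is the triple \<open>h j = (f\<^sub>j, g\<^sub>j, e\<^sub>j)\<close>, and \<open>B h i\<close> is what exists before stage \<open>i\<close>.\<close>
      define B where "B h i = C \<union> (\<Union>j<i. fst (h j) ` Y \<union> fst (snd (h j)) ` J \<union> (\<Union>k. snd (snd (h j)) k ` I))"
        for h :: "nat \<Rightarrow> ('a \<Rightarrow> 'a) \<times> ('j \<Rightarrow> 'a) \<times> (nat \<Rightarrow> 'i \<Rightarrow> 'a)" and i :: nat
      \<comment> \<open>The concatenated segments of the stages before \<open>i\<close>. The default value keeps \<open>P h i\<close> below
        independent of the later stages.\<close>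
      define glue where "glue h i k = (if k < N * i then snd (snd (h (k div N))) (k mod N) else undefined)"
        for h :: "nat \<Rightarrow> ('a \<Rightarrow> 'a) \<times> ('j \<Rightarrow> 'a) \<times> (nat \<Rightarrow> 'i \<Rightarrow> 'a)" and i k :: nat
      define P where "P h i y \<longleftrightarrow> fst y ` Y \<subseteq> univ \<MM> \<and>
          eqv (Inl ` Y \<union> Inr ` (Inl ` ({..<N * i} \<times> I) \<union> Inr ` C))
            (case_sum id (case_sum (case_prod c) id)) (case_sum (fst y) (case_sum (case_prod (glue h i)) id)) \<and>
          realizes \<MM> J (fst (snd y)) (s \<restriction> (B h i \<union> fst y ` Y)) \<and>
          morley I p (B h i \<union> fst y ` Y \<union> fst (snd y) ` J) (snd (snd y))"
        for h :: "nat \<Rightarrow> ('a \<Rightarrow> 'a) \<times> ('j \<Rightarrow> 'a) \<times> (nat \<Rightarrow> 'i \<Rightarrow> 'a)" and i y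
      have div_less: "k div N < i" if "k < N * i" for k i
        using that by (simp add: less_mult_imp_div_less mult.commute)
      have "\<exists>h. \<forall>i. P h i (h i)"
      proof (rule dependent_wellorder_choice)
        fix y :: "('a \<Rightarrow> 'a) \<times> ('j \<Rightarrow> 'a) \<times> (nat \<Rightarrow> 'i \<Rightarrow> 'a)" and h h' :: "nat \<Rightarrow> ('a \<Rightarrow> 'a) \<times> ('j \<Rightarrow> 'a) \<times> (nat \<Rightarrow> 'i \<Rightarrow> 'a)" and i :: nat
        assume hh': "\<And>j. j < i \<Longrightarrow> h j = h' j"
        have "B h i = B h' i" unfolding B_def using hh' by simp
        moreover have "glue h i = glue h' i"
          unfolding glue_def using hh'[OF div_less] by (intro ext) simp
        ultimately show "P h i y = P h' i y" by (simp only: P_def)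
      next
        fix i :: nat and h :: "nat \<Rightarrow> ('a \<Rightarrow> 'a) \<times> ('j \<Rightarrow> 'a) \<times> (nat \<Rightarrow> 'i \<Rightarrow> 'a)"
        assume h: "\<And>j. j < i \<Longrightarrow> P h j (h j)"
        define e where "e j = snd (snd (h j))" for j
        have hj: "fst (h j) ` Y \<subseteq> univ \<MM>" "fst (snd (h j)) ` J \<subseteq> univ \<MM>"
          "morley I p (B h j \<union> fst (h j) ` Y \<union> fst (snd (h j)) ` J) (e j)" if "j < i" for j
          using h[OF that] by (simp_all add: P_def realizes_def e_def)
        have e_univ: "(\<Union>k. e j k ` I) \<subseteq> univ \<MM>" if "j < i" for j
          using morley_univ[OF hj(3)[OF that]] by (intro UN_least)
        have B_univ: "B h i \<subseteq> univ \<MM>"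
        proof -
          have "fst (h j) ` Y \<union> fst (snd (h j)) ` J \<union> (\<Union>k. snd (snd (h j)) k ` I) \<subseteq> univ \<MM>"
            if "j \<in> {..<i}" for j
          proof -
            have "j < i" using that by simp
            from hj(1,2)[OF this] e_univ[OF this] show ?thesis unfolding e_def by (intro Un_least)
          qed
          then show ?thesis unfolding B_def by (rule Un_least[OF C(2) UN_least])
        qed
        have B_small: "small \<kappa> (B h i)"
        proof -
          have "(\<Union>k. e j k ` I) = case_prod (e j) ` (UNIV \<times> I)" for j by (auto simp: image_iff)
          then have "small \<kappa> (\<Union>k. e j k ` I)" for j using small_image[OF small_Times_nat[OF I]] by simp
          then have "small \<kappa> (fst (h j) ` Y \<union> fst (snd (h j)) ` J \<union> (\<Union>k. snd (snd (h j)) k ` I))" for j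
            unfolding e_def by (rule small_Un[OF small_Un[OF small_image[OF Y(2)] small_image[OF J]]])
          then show ?thesis
            unfolding B_def by (rule small_Un[OF C(3) small_UN_finite[OF finite_lessThan]])
        qed
        have BC': "C \<subseteq> B h i'" for i' unfolding B_def by (rule Un_upper1)
        note BC = BC'[of i]
        have e_B: "e j k ` I \<subseteq> B h i'" if "j < i'" for i' j k
          using that unfolding B_def e_def by blast
        have glue_e: "glue h i k = e (k div N) (k mod N)" if "k < N * i" for k
          using that by (simp add: glue_def e_def)
        obtain e0 where e0: "morley I p (B h i) e0" using morley_exists[OF p I B_univ B_small] by blast
        define ee where "ee k = (if k < N * i then glue h i k else e0 (k - N * i))" for k
        have glue_prefix: "(\<Union>j<k. glue h i j ` I) \<subseteq> B h (k div N) \<union> (\<Union>r<k mod N. e (k div N) r ` I)"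
          if "k < N * i" for k
        proof (rule UN_least)
          fix j assume "j \<in> {..<k}"
          then have j: "j < k" "j < N * i" using that by auto
          have "j div N \<le> k div N" using j(1) by (simp add: div_le_mono)
          then consider "j div N < k div N" | "j div N = k div N" by linarith
          then show "glue h i j ` I \<subseteq> B h (k div N) \<union> (\<Union>r<k mod N. e (k div N) r ` I)"
          proof cases
            case 1
            then show ?thesis unfolding glue_e[OF j(2)] by (intro le_supI1 e_B)
          next
            case 2
            have "N * (j div N) + j mod N = j" "N * (k div N) + k mod N = k" by simp_all
            then have "j mod N < k mod N" using 2 j(1) by (metis add_less_cancel_left)
            then show ?thesis unfolding glue_e[OF j(2)] 2 by (intro le_supI2 UN_upper) simp
          qed
        qed
        have "morley I p C ee"
          unfolding ee_def
        proof (rule morley_append)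
          fix k assume k: "k < N * i"
          have "realizes \<MM> I (e (k div N) (k mod N)) (p \<restriction> (B h (k div N) \<union> (\<Union>r<k mod N. e (k div N) r ` I)))"
            by (rule realizes_restr_mono[OF morleyD[OF hj(3)[OF div_less[OF k]]]]) blast
          moreover have "C \<union> (\<Union>j<k. glue h i j ` I) \<subseteq> B h (k div N) \<union> (\<Union>r<k mod N. e (k div N) r ` I)"
            by (intro Un_least le_supI1[OF BC'] glue_prefix[OF k])
          ultimately show "realizes \<MM> I (glue h i k) (p \<restriction> (C \<union> (\<Union>j<k. glue h i j ` I)))"
            unfolding glue_e[OF k] by (rule realizes_restr_mono)
        next
          have "glue h i j ` I \<subseteq> B h i" if "j < N * i" for j
            unfolding glue_e[OF that] by (rule e_B[OF div_less[OF that]])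
          then have "C \<union> (\<Union>j<N * i. glue h i j ` I) \<subseteq> B h i" using BC by (intro Un_least UN_least) auto
          then show "morley I p (C \<union> (\<Union>j<N * i. glue h i j ` I)) e0" by (rule morley_mono[OF e0])
        qed
        then have ee: "eqv (Inl ` seq_names I \<union> Inr ` C) (case_sum (case_prod c) id) (case_sum (case_prod ee) id)"
          using eqv_morley[OF p eqv_refl names_M_id[OF C(1)], of c ee] C(2) c by simp
        let ?V1 = "Inl ` ({..<N * i} \<times> I) \<union> Inr ` C :: ((nat \<times> 'i) + 'a) set"
        let ?gl = "case_sum (case_prod (glue h i)) id"
        have eqg: "eqv ?V1 (case_sum (case_prod c) id) ?gl"
          by (rule eqv_ren[OF ee, where g = id]) (auto simp: ee_def)
        have "?gl ` ?V1 \<subseteq> B h i"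
        proof
          fix y assume "y \<in> ?gl ` ?V1"
          then consider k x where "k < N * i" "x \<in> I" "y = glue h i k x" | "y \<in> C" by auto
          then show "y \<in> B h i"
          proof cases
            case 1
            then show ?thesis using e_B[OF div_less[OF 1(1)]] glue_e[OF 1(1)] by (metis image_subset_iff)
          next
            case 2
            then show ?thesis using BC by blast
          qed
        qed
        then have gl: "?gl ` ?V1 \<subseteq> univ \<MM>" "small \<kappa> (?gl ` ?V1)"
          using B_univ small_subset[OF _ B_small] by blast+
        have "id ` Y \<subseteq> univ \<MM>" using Y(1) by simp
        from eqv_extend[OF eqg this Y(2) gl] obtain f where f: "f ` Y \<subseteq> univ \<MM>"
          "eqv (Inl ` Y \<union> Inr ` ?V1) (case_sum id (case_sum (case_prod c) id)) (case_sum f ?gl)" .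
        have Bf: "B h i \<union> f ` Y \<subseteq> univ \<MM>" "small \<kappa> (B h i \<union> f ` Y)"
          by (rule Un_least[OF B_univ f(1)], rule small_Un[OF B_small small_image[OF Y(2)]])
        obtain g where g: "realizes \<MM> J g (s \<restriction> (B h i \<union> f ` Y))" using realizes_exists[OF s J Bf] by blast
        have gJ: "g ` J \<subseteq> univ \<MM>" using g by (simp add: realizes_def)
        have Bg: "B h i \<union> f ` Y \<union> g ` J \<subseteq> univ \<MM>" "small \<kappa> (B h i \<union> f ` Y \<union> g ` J)"
          by (rule Un_least[OF Bf(1) gJ], rule small_Un[OF Bf(2) small_image[OF J]])
        obtain e1 where e1: "morley I p (B h i \<union> f ` Y \<union> g ` J) e1" using morley_exists[OF p I Bg] by blast
        have "P h i (f, g, e1)" unfolding P_def fst_conv snd_conv using f g e1 by blast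
        then show "\<exists>y. P h i y" by blast
      qed
      then obtain h where h: "\<And>i. P h i (h i)" by blast
      define f where "f i = fst (h i)" for i
      define g where "g i = fst (snd (h i))" for i
      define e where "e i = snd (snd (h i))" for i
      have fY: "f i ` Y \<subseteq> univ \<MM>" and
        f_eqv: "eqv (Inl ` Y \<union> Inr ` (Inl ` ({..<N * i} \<times> I) \<union> Inr ` C))
            (case_sum id (case_sum (case_prod c) id)) (case_sum (f i) (case_sum (case_prod (glue h i)) id))" and
        g_real: "realizes \<MM> J (g i) (s \<restriction> (B h i \<union> f i ` Y))" and
        e_mor: "morley I p (B h i \<union> f i ` Y \<union> g i ` J) (e i)" for i
        using h[of i] by (simp_all add: P_def f_def g_def e_def)
      have gJ: "g i ` J \<subseteq> univ \<MM>" for i using g_real[of i] by (simp add: realizes_def)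
      have BC: "C \<subseteq> B h i" for i unfolding B_def by (rule Un_upper1)
      have Bg: "g j ` J \<subseteq> B h i" and Bf: "f j ` Y \<subseteq> B h i" if "j < i" for i j
        using that unfolding B_def g_def f_def by blast+
      have "SOP L \<MM> 3"
      proof (rule SOP3_criterion[OF \<phi>X \<theta>X, where u = "\<lambda>i. case_prod (e i)" and v = f and
            w = "\<lambda>i. case_sum (g i) id"])
        show "case_prod (e i) ` ?X \<subseteq> univ \<MM>" for i using morley_univ[OF e_mor] by auto
        show "case_sum (g i) id ` ?Z \<subseteq> univ \<MM>" for i using gJ[of i] C(2) by (auto simp: image_Un image_image)
        fix k i :: nat assume ki: "k < i"
        have "eqv (Inl ` ?X \<union> Inr ` Y) (case_sum (\<lambda>(t, x). c (N * k + t) x) id) (case_sum (case_prod (e k)) (f i))"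
        proof (rule eqv_ren[OF f_eqv[of i], where g = "case_sum (\<lambda>(t, x). Inr (Inl (N * k + t, x))) Inl"])
          have lt: "N * k + t < N * i" if "t < N" for t
          proof -
            have "N * k + t < N * Suc k" using that by simp
            also have "\<dots> \<le> N * i" using ki by (intro mult_le_mono2) simp
            finally show ?thesis .
          qed
          have gl: "glue h i (N * k + t) = e k t" if "t < N" for t
            using lt[OF that] that by (simp add: glue_def e_def)
          fix v :: "(nat \<times> 'i) + 'a" assume v: "v \<in> Inl ` ?X \<union> Inr ` Y"
          show "case_sum (\<lambda>(t, x). Inr (Inl (N * k + t, x))) Inl v
              \<in> Inl ` Y \<union> Inr ` (Inl ` ({..<N * i} \<times> I) \<union> Inr ` C)"
            using v lt by auto
          show "case_sum (\<lambda>(t, x). c (N * k + t) x) id v = case_sum id (case_sum (case_prod c) id)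
              (case_sum (\<lambda>(t, x). Inr (Inl (N * k + t, x))) Inl v)"
            by (simp split: sum.split prod.split)
          show "case_sum (case_prod (e k)) (f i) v = case_sum (f i) (case_sum (case_prod (glue h i)) id)
              (case_sum (\<lambda>(t, x). Inr (Inl (N * k + t, x))) Inl v)"
            using v gl by auto
        qed
        moreover have "holds \<MM> (case_sum (\<lambda>(t, x). c (N * k + t) x) id) \<phi>"
          using \<phi>_c[of "Suc (N1 + N2) * k"] unfolding N_def by (simp only: mult.assoc mult.commute mult.left_commute)
        ultimately show "holds \<MM> (case_sum (case_prod (e k)) (f i)) \<phi>" using eqvD[OF _ \<phi>X] by blast
        have CY: "C \<subseteq> univ \<MM>" "id ` C \<subseteq> univ \<MM>" "C \<union> Y \<subseteq> univ \<MM>" using C Y by auto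
        have gC: "realizes \<MM> J (g k) (s \<restriction> (id ` C))"
          using realizes_restr_mono[OF g_real[of k]] BC by (metis image_id id_apply le_supI1)
        have bC: "realizes \<MM> J b (s \<restriction> (id ` C))" using realizes_restr_mono[OF b] by simp
        have eqbg: "eqv ?Z (case_sum b id) (case_sum (g k) id)"
          by (rule eqv_realizes[OF s eqv_refl names_M_id[OF C(1)] CY(2,2) bC gC])
        have gk_image: "case_sum (g k) id ` ?Z = C \<union> g k ` J" by (auto simp: image_Un image_image)
        have e_i: "morley I p (case_sum (g k) id ` ?Z) (e i)"
          unfolding gk_image using BC Bg[OF ki] by (intro morley_mono[OF e_mor]) blast
        have "eqv (Inl ` seq_names I \<union> Inr ` ?Z) (case_sum (case_prod cs) ?zb)
            (case_sum (case_prod (e i)) (case_sum (g k) id))"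
        proof (rule eqv_morley[OF p eqbg names_Z _ _ _ e_i])
          show "?zb ` ?Z \<subseteq> univ \<MM>" unfolding zb_image by (rule CbJ)
          show "case_sum (g k) id ` ?Z \<subseteq> univ \<MM>" unfolding gk_image using gJ C(2) by auto
          show "morley I p (?zb ` ?Z) cs" unfolding zb_image by (rule cs)
        qed
        then show "holds \<MM> (case_sum (case_prod (e i)) (case_sum (g k) id)) \<theta>"
          using eqvD[OF _ \<theta>(1)] \<theta>_cs by blast
        fix x :: "nat \<times> 'i \<Rightarrow> 'a"
        assume x: "x ` ?X \<subseteq> univ \<MM>" and x\<phi>: "holds \<MM> (case_sum x (f k)) \<phi>"
        show "\<not> holds \<MM> (case_sum x (case_sum (g i) id)) \<theta>"
        proof
          assume x\<theta>: "holds \<MM> (case_sum x (case_sum (g i) id)) \<theta>"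
          let ?YC = "Inl ` Y \<union> Inr ` C :: ('a + 'a) set"
          have "eqv ?YC (case_sum id id) (case_sum (f k) id)"
            by (rule eqv_ren[OF f_eqv[of k], where g = "case_sum Inl (\<lambda>m. Inr (Inr m))"]) auto
          moreover have "names_M ?YC (case_sum id id) (case_sum (f k) id)"
            by (rule names_M_Inr[OF names_M_id[OF C(1)]])
          moreover have im: "case_sum id id ` ?YC = C \<union> Y" "case_sum (f k) id ` ?YC = C \<union> f k ` Y"
            by (auto simp: image_Un image_image)
          moreover have "C \<union> f k ` Y \<subseteq> univ \<MM>" using C(2) fY by auto
          moreover have "realizes \<MM> J (g i) (s \<restriction> (C \<union> f k ` Y))"
            using BC Bf[OF ki] by (intro realizes_restr_mono[OF g_real]) blast
          ultimately have "eqv (Inl ` J \<union> Inr ` ?YC) (case_sum b (case_sum id id)) (case_sum (g i) (case_sum (f k) id))"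
            using CY(3) b by (intro eqv_realizes[OF s]) simp_all
          then have "eqv V (case_sum id ?zb) (case_sum (f k) (case_sum (g i) id))"
            unfolding V_def
            by (rule eqv_ren[where g = "case_sum (\<lambda>y. Inr (Inl y)) (case_sum Inl (\<lambda>m. Inr (Inr m)))"]) auto
          then have eqV: "eqv V (case_sum (f k) (case_sum (g i) id)) (case_sum id ?zb)" by (rule eqv_sym)
          have l: "ren (map_sum id Inl) \<phi> \<in> Fm L (Inl ` ?X \<union> Inr ` V)"
            using \<phi>X by (rule ren_in_Fm) (auto simp: V_def)
          have r: "ren (map_sum id Inr) \<theta> \<in> Fm L (Inl ` ?X \<union> Inr ` V)"
            using \<theta>X by (rule ren_in_Fm) (auto simp: V_def)
          have lr: "And (ren (map_sum id Inl) \<phi>) (ren (map_sum id Inr) \<theta>) \<in> Fm L (Inl ` ?X \<union> Inr ` V)"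
            using l r by (simp add: And_Fm)
          have "holds \<MM> (case_sum x (case_sum (f k) (case_sum (g i) id)))
              (And (ren (map_sum id Inl) \<phi>) (ren (map_sum id Inr) \<theta>))"
            unfolding holds_And l_iff r_iff using x\<phi> x\<theta> by blast
          from eqv_solvable[OF eqV lr x this] obtain w where w: "w ` ?X \<subseteq> univ \<MM>"
            "holds \<MM> (case_sum w (case_sum id ?zb)) (And (ren (map_sum id Inl) \<phi>) (ren (map_sum id Inr) \<theta>))" .
          then show False using unsatX[OF w(1)] unfolding holds_And l_iff r_iff by blast
        qed
      qed (rule fY)
      then show False using nsop by blast
    qed
    obtain w where w: "w ` seq_names I \<subseteq> univ \<MM>" "\<And>\<phi>. \<phi> \<in> \<Gamma> \<Longrightarrow> holds \<MM> (case_sum w t) \<phi>"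
      using saturation[OF \<Gamma> fin small_Times_nat[OF I] tV'] by blast
    define c' where "c' k i = w (k, i)" for k i
    have w_c': "w = case_prod c'" by (auto simp: c'_def)
    have c'_univ: "c' k ` I \<subseteq> univ \<MM>" for k using w(1) by (auto simp: c'_def)
    have blocks': "holds \<MM> (case_sum (\<lambda>(i, x). c' (k * n + i) x) id) \<phi>" if "\<phi> \<in> \<Sigma>" for k \<phi>
    proof -
      have "ren (map_sum id Inl) (ren (shift k) \<phi>) \<in> \<Gamma>" using that unfolding \<Gamma>_def \<Gamma>1_def by blast
      from w(2)[OF this] have "holds \<MM> (case_sum (\<lambda>(i, x). w (k * n + i, x)) id) \<phi>"
        unfolding t_def l_iff shift_iff .
      then show ?thesis by (simp add: w_c')
    qed
    have \<Gamma>2_w: "holds \<MM> (case_sum w ?zb) \<theta>" if "\<theta> \<in> \<Gamma>2" for \<theta>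
    proof -
      have "ren (map_sum id Inr) \<theta> \<in> \<Gamma>" using that unfolding \<Gamma>_def by blast
      from w(2)[OF this] show ?thesis unfolding t_def r_iff .
    qed
    have "eqv (Inl ` seq_names I \<union> Inr ` ?Z) (case_sum (case_prod cs) ?zb) (case_sum w ?zb)"
      unfolding eqv_def
    proof
      fix \<theta> assume \<theta>: "\<theta> \<in> Fm L (Inl ` seq_names I \<union> Inr ` ?Z)"
      show "holds \<MM> (case_sum (case_prod cs) ?zb) \<theta> = holds \<MM> (case_sum w ?zb) \<theta>"
        using \<Gamma>2_w[of \<theta>] \<Gamma>2_w[of "Neg \<theta>"] \<theta> by (auto simp: \<Gamma>2_def Neg_Fm holds_Neg)
    qed
    then have "morley I p (?zb ` ?Z) c'"
      unfolding w_c'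
      using morley_eqv[OF p names_Z[of b b], of cs c'] CbJ(1) cs c'_univ unfolding zb_image by blast
    then show ?thesis using blocks' unfolding zb_image by blast
  qed
qed

end

section \<open>Constructing invariant types\<close>

context saturated_over_model
begin

text \<open>The type of a tuple whose entries are coordinates of a realization of \<open>s\<close> or elements of \<open>M\<close>. It
  turns Morley sequences of \<open>s\<close> into Morley sequences of tuples that may contain constants from \<open>M\<close>.\<close>

definition pushforward :: "'l set \<Rightarrow> ('l \<Rightarrow> 'j + 'a) \<Rightarrow> ('f, 'r, 'j + 'a) fm set \<Rightarrow> ('f, 'r, 'l + 'a) fm set" where
  "pushforward K h s = {\<chi> \<in> Fm L (Inl ` K \<union> Inr ` univ \<MM>). ren (case_sum h Inr) \<chi> \<in> s}"

lemma tp_eqv: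
  assumes "tp L \<MM> V b' M = tp L \<MM> V b M"
  shows "eqv (Inl ` V \<union> Inr ` M) (case_sum b id) (case_sum b' id)"
  using assms unfolding tp_def eqv_def by blast

context
  fixes J :: "'j set" and K :: "'l set" and h :: "'l \<Rightarrow> 'j + 'a" and s
  assumes s: "invariant J s" and h: "\<And>k. k \<in> K \<Longrightarrow> h k \<in> Inl ` J \<union> Inr ` M"
begin

lemma pushforward_Fm:
  assumes "\<chi> \<in> Fm L (Inl ` K \<union> Inr ` A)"
  shows "ren (case_sum h Inr) \<chi> \<in> Fm L (Inl ` J \<union> Inr ` (M \<union> A))"
  using assms
proof (rule ren_in_Fm)
  fix v :: "'l + 'a" assume "v \<in> Inl ` K \<union> Inr ` A"
  then show "case_sum h Inr v \<in> Inl ` J \<union> Inr ` (M \<union> A)"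
    using h by (cases v) auto
qed

lemma pushforward_holds:
  "holds \<MM> (case_sum (\<lambda>k. case_sum c id (h k)) id) \<chi> \<longleftrightarrow> holds \<MM> (case_sum c id) (ren (case_sum h Inr) \<chi>)"
  unfolding holds_ren by (rule holds_cong) (simp split: sum.split)

lemma pushforward_image:
  "(\<lambda>k. case_sum c id (h k)) ` K \<subseteq> M \<union> c ` J"
proof
  fix y assume "y \<in> (\<lambda>k. case_sum c id (h k)) ` K"
  then obtain k where k: "k \<in> K" "y = case_sum c id (h k)" by blast
  show "y \<in> M \<union> c ` J" using h[OF k(1)] unfolding k(2) by auto
qed

lemma pushforward_invariant: "invariant K (pushforward K h s)"
  unfolding invariant_type_def complete_type_def
proof (intro conjI allI ballI impI)
  show "pushforward K h s \<subseteq> Fm L (Inl ` K \<union> Inr ` univ \<MM>)" unfolding pushforward_def by blast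
  show "consistent \<MM> K (pushforward K h s)"
    unfolding consistent_def
  proof (intro allI impI)
    fix F assume F: "finite F \<and> F \<subseteq> pushforward K h s"
    then have "finite (ren (case_sum h Inr) ` F)" "ren (case_sum h Inr) ` F \<subseteq> s"
      unfolding pushforward_def by blast+
    moreover have "consistent \<MM> J s" using s unfolding invariant_type_def complete_type_def by blast
    ultimately obtain c where c: "realizes \<MM> J c (ren (case_sum h Inr) ` F)"
      unfolding consistent_def by meson
    then have "c ` J \<subseteq> univ \<MM>" by (simp add: realizes_def)
    then have "M \<union> c ` J \<subseteq> univ \<MM>" using M_univ by (rule Un_least[rotated])
    from subset_trans[OF pushforward_image this]
    have "realizes \<MM> K (\<lambda>k. case_sum c id (h k)) F"
      using c by (simp add: realizes_def pushforward_holds)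
    then show "\<exists>c. realizes \<MM> K c F" by blast
  qed
  fix \<chi> :: "('f, 'r, 'l + 'a) fm" assume \<chi>: "\<chi> \<in> Fm L (Inl ` K \<union> Inr ` univ \<MM>)"
  have "M \<union> univ \<MM> = univ \<MM>" using M_univ by (rule Un_absorb1)
  then have "ren (case_sum h Inr) \<chi> \<in> Fm L (Inl ` J \<union> Inr ` univ \<MM>)" using pushforward_Fm[OF \<chi>] by simp
  from invariant_Neg[OF s this] show "\<chi> \<in> pushforward K h s \<or> Neg \<chi> \<in> pushforward K h s"
    using \<chi> by (auto simp: pushforward_def Neg_Fm)
next
  fix n and b b' :: "nat \<Rightarrow> 'a" and \<phi> :: "('f, 'r, 'l + nat) fm"
  assume \<phi>: "\<phi> \<in> Fm L (Inl ` K \<union> Inr ` {..<n})"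
    and bb': "b ` {..<n} \<subseteq> univ \<MM> \<and> b' ` {..<n} \<subseteq> univ \<MM> \<and>
      tp L \<MM> {..<n} b' M = tp L \<MM> {..<n} b M \<and> inst \<phi> b \<in> pushforward K h s"
  let ?V = "Inl ` {..<n} \<union> Inr ` M :: (nat + 'a) set"
  let ?g = "case_sum (\<lambda>k. map_sum id Inr (h k)) (\<lambda>l. Inr (Inl l)) :: 'l + nat \<Rightarrow> 'j + nat + 'a"
  have \<phi>': "ren ?g \<phi> \<in> Fm L (Inl ` J \<union> Inr ` ?V)"
    using \<phi>
  proof (rule ren_in_Fm)
    fix v :: "'l + nat" assume v: "v \<in> Inl ` K \<union> Inr ` {..<n}"
    show "?g v \<in> Inl ` J \<union> Inr ` ?V"
    proof (cases v)
      case (Inl k)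
      then have "h k \<in> Inl ` J \<union> Inr ` M" using v by (intro h) auto
      then show ?thesis using Inl by auto
    qed (use v in auto)
  qed
  have eq: "ren (case_sum h Inr) (inst \<phi> d) = ren (map_sum id (case_sum d id)) (ren ?g \<phi>)" for d
    unfolding inst_def ren_ren by (rule ren_cong) (auto simp: map_sum_def split: sum.split)
  have "ren (map_sum id (case_sum b id)) (ren ?g \<phi>) \<in> s \<longleftrightarrow> ren (map_sum id (case_sum b' id)) (ren ?g \<phi>) \<in> s"
  proof (rule invariant_eqv[OF s _ _ _ _ \<phi>'])
    show "eqv ?V (case_sum b id) (case_sum b' id)" using bb' by (intro tp_eqv) blast
    show "names_M ?V (case_sum b id) (case_sum b' id)" by (rule names_M_Inr[OF names_M_id]) simp
    show "case_sum b id ` ?V \<subseteq> univ \<MM>" "case_sum b' id ` ?V \<subseteq> univ \<MM>"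
      using bb' M_univ by (auto simp: image_Un image_image)
  qed
  moreover have "ren (case_sum h Inr) (inst \<phi> b) \<in> s" using bb' by (simp add: pushforward_def)
  moreover have "inst \<phi> b' \<in> Fm L (Inl ` K \<union> Inr ` univ \<MM>)"
    unfolding inst_def using \<phi> by (rule ren_in_Fm) (use bb' in auto)
  ultimately show "inst \<phi> b' \<in> pushforward K h s" by (simp add: pushforward_def eq)
qed

lemma pushforward_morley:
  assumes "morley J s M c"
  shows "morley K (pushforward K h s) M (\<lambda>i k. case_sum (c i) id (h k))"
proof (rule morleyI)
  fix i
  let ?c = "\<lambda>i k. case_sum (c i) id (h k)"
  have "?c j ` K \<subseteq> M \<union> (\<Union>j<i. c j ` J)" if "j \<in> {..<i}" for j
  proof -
    have "c j ` J \<subseteq> (\<Union>j<i. c j ` J)" using that by (rule UN_upper)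
    then show ?thesis by (rule subset_trans[OF pushforward_image Un_mono[OF order_refl]])
  qed
  then have sub: "M \<union> (M \<union> (\<Union>j<i. ?c j ` K)) \<subseteq> M \<union> (\<Union>j<i. c j ` J)"
    by (rule Un_least[OF Un_upper1 Un_least[OF Un_upper1 UN_least]])
  have "?c i ` K \<subseteq> univ \<MM>"
    by (rule subset_trans[OF pushforward_image Un_least[OF M_univ morley_univ[OF assms]]])
  moreover have "holds \<MM> (case_sum (?c i) id) \<chi>" if \<chi>: "\<chi> \<in> pushforward K h s \<restriction> (M \<union> (\<Union>j<i. ?c j ` K))" for \<chi>
  proof -
    have "\<chi> \<in> Fm L (Inl ` K \<union> Inr ` (M \<union> (\<Union>j<i. ?c j ` K)))"
      using restr_Fm[OF pushforward_invariant] \<chi> by blast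
    from pushforward_Fm[OF this] have "ren (case_sum h Inr) \<chi> \<in> Fm L (Inl ` J \<union> Inr ` (M \<union> (\<Union>j<i. c j ` J)))"
      by (rule Fm_mono[rotated]) (intro Un_mono image_mono sub order_refl)
    moreover have "ren (case_sum h Inr) \<chi> \<in> s" using \<chi> by (simp add: restr_def pushforward_def)
    ultimately have "ren (case_sum h Inr) \<chi> \<in> s \<restriction> (M \<union> (\<Union>j<i. c j ` J))" by (intro in_restr)
    then have "holds \<MM> (case_sum (c i) id) (ren (case_sum h Inr) \<chi>)"
      using morleyD[OF assms, of i] unfolding realizes_def by blast
    then show ?thesis unfolding pushforward_holds .
  qed
  ultimately show "realizes \<MM> K (?c i) (pushforward K h s \<restriction> (M \<union> (\<Union>j<i. ?c j ` K)))"
    unfolding realizes_def by blast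
qed

end

lemma elementary:
  fixes V :: "'v set"
  assumes \<phi>: "\<phi> \<in> Fm L V" and s: "s ` V \<subseteq> M"
  shows "holds (\<MM>\<lparr>univ := M\<rparr>) s \<phi> \<longleftrightarrow> holds \<MM> s \<phi>"
proof -
  have el: "elem_sub L M \<MM>" using small_model by (simp add: small_model_def)
  then obtain m where m: "m \<in> M" unfolding elem_sub_def is_struct_def by auto
  obtain k :: "'v \<Rightarrow> nat" where k: "inj_on k (fv \<phi>)"
    using finite_imp_inj_to_nat_seg[OF finite_fv[of \<phi>]] by blast
  define s' where "s' n = (if n \<in> k ` fv \<phi> then s (inv_into (fv \<phi>) k n) else m)" for n
  have s'l: "s' (k v) = s v" if v: "v \<in> fv \<phi>" for v
  proof -
    have "k v \<in> k ` fv \<phi>" using v by (rule imageI)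
    then have "s' (k v) = s (inv_into (fv \<phi>) k (k v))" unfolding s'_def by (rule if_P)
    also have "\<dots> = s v" using inv_into_f_f[OF k v] by (rule arg_cong)
    finally show ?thesis .
  qed
  have "s' n \<in> M" for n
  proof (cases "n \<in> k ` fv \<phi>")
    case True
    then obtain v where "v \<in> fv \<phi>" "n = k v" by blast
    have "v \<in> V" using FmD[OF \<phi>] \<open>v \<in> fv \<phi>\<close> by (rule subsetD)
    then show ?thesis unfolding \<open>n = k v\<close> s'l[OF \<open>v \<in> fv \<phi>\<close>] using s by blast
  qed (simp add: s'_def m)
  then have "range s' \<subseteq> M" by blast
  moreover have "ren k \<phi> \<in> Fm L UNIV" using \<phi> by (rule ren_in_Fm) simp
  ultimately have "holds (\<MM>\<lparr>univ := M\<rparr>) s' (ren k \<phi>) \<longleftrightarrow> holds \<MM> s' (ren k \<phi>)"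
    using el unfolding elem_sub_def by blast
  moreover have "holds \<AA> s' (ren k \<phi>) \<longleftrightarrow> holds \<AA> s \<phi>" for \<AA> :: "('f, 'r, 'a) struct"
    unfolding holds_ren by (rule holds_cong) (simp add: s'l)
  ultimately show ?thesis by simp
qed

text \<open>A maximal set of formulas that is finitely satisfiable in \<open>M\<close> is an invariant type: it cannot
  contain \<open>\<phi>(x, b)\<close> and the negation of \<open>\<phi>(x, b')\<close> when \<open>b\<close> and \<open>b'\<close> have the same type over \<open>M\<close>,
  as these have no common solution in \<open>M\<close>.\<close>

lemma coheir_exists:
  fixes J :: "'j set"
  assumes \<beta>: "\<beta> ` J \<subseteq> univ \<MM>"
  shows "\<exists>s. invariant J s \<and> realizes \<MM> J \<beta> (s \<restriction> M)"
proof -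
  let ?W = "Fm L (Inl ` J \<union> Inr ` univ \<MM>)"
  define \<Phi> where "\<Phi> = {\<phi> \<in> Fm L (Inl ` J \<union> Inr ` M). holds \<MM> (case_sum \<beta> id) \<phi>}"
  define G where "G F \<longleftrightarrow> (\<exists>w. w ` J \<subseteq> M \<and> (\<forall>\<phi>\<in>F. holds \<MM> (case_sum w id) \<phi>))"
    for F :: "('f, 'r, 'j + 'a) fm set"
  have M_ne: "univ (\<MM>\<lparr>univ := M\<rparr>) \<noteq> {}"
    using small_model unfolding small_model_def elem_sub_def is_struct_def by blast
  have mono: "\<forall>F F'. G F' \<and> F \<subseteq> F' \<longrightarrow> G F" unfolding G_def by (meson subsetD)
  have \<Phi>W: "\<Phi> \<subseteq> ?W"
  proof -
    have "Inl ` J \<union> Inr ` M \<subseteq> Inl ` J \<union> Inr ` univ \<MM>" using M_univ by auto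
    from Fm_mono[OF this] show ?thesis unfolding \<Phi>_def by blast
  qed
  have fin: "\<forall>F. finite F \<and> F \<subseteq> \<Phi> \<longrightarrow> G F"
  proof (intro allI impI)
    fix F assume F: "finite F \<and> F \<subseteq> \<Phi>"
    then have "finite F" "F \<subseteq> Fm L (Inl ` J \<union> Inr ` M)" unfolding \<Phi>_def by blast+
    from conj_fm[OF this] obtain \<phi> where \<phi>: "\<phi> \<in> Fm L (Inl ` J \<union> Inr ` M)"
      "\<forall>s. holds \<MM> s \<phi> \<longleftrightarrow> (\<forall>\<chi>\<in>F. holds \<MM> s \<chi>)" by (elim bexE, intro that)
    show "G F"
    proof (rule ex_formula[OF \<phi>(1), where 'a = 'a])
      fix \<phi>' assume \<phi>': "\<phi>' \<in> Fm L M" "\<And>(\<AA> :: ('f, 'r, 'a) struct) s. univ \<AA> \<noteq> {} \<Longrightarrow>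
        holds \<AA> s \<phi>' \<longleftrightarrow> (\<exists>w. w ` J \<subseteq> univ \<AA> \<and> holds \<AA> (case_sum w s) \<phi>)"
      have "\<forall>\<chi>\<in>F. holds \<MM> (case_sum \<beta> id) \<chi>" using F unfolding \<Phi>_def by blast
      then have "holds \<MM> (case_sum \<beta> id) \<phi>" using \<phi>(2) by blast
      then have "holds \<MM> id \<phi>'" using \<phi>'(2)[OF univ_nonempty] \<beta> by blast
      then have "holds (\<MM>\<lparr>univ := M\<rparr>) id \<phi>'" using elementary[OF \<phi>'(1), of id] by simp
      then obtain w where w: "w ` J \<subseteq> M" "holds (\<MM>\<lparr>univ := M\<rparr>) (case_sum w id) \<phi>"
        using \<phi>'(2)[OF M_ne] by auto
      have "case_sum w id ` (Inl ` J \<union> Inr ` M) \<subseteq> M" using w(1) by (auto simp: image_Un image_image)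
      then have "holds \<MM> (case_sum w id) \<phi>" using elementary[OF \<phi>(1)] w(2) by blast
      then show "G F" using w(1) \<phi>(2) unfolding G_def by blast
    qed
  qed
  obtain s where s: "\<Phi> \<subseteq> s" "s \<subseteq> ?W" "\<forall>F. finite F \<and> F \<subseteq> s \<longrightarrow> G F"
    "\<forall>\<phi>\<in>?W. \<phi> \<notin> s \<longrightarrow> (\<exists>F. finite F \<and> F \<subseteq> s \<and> \<not> G (insert \<phi> F))"
    using tukey[OF mono \<Phi>W fin] by (elim exE conjE, intro that)
  have complete: "\<phi> \<in> s \<or> Neg \<phi> \<in> s" if \<phi>: "\<phi> \<in> ?W" for \<phi>
  proof (rule ccontr)
    assume "\<not> ?thesis"
    then have n: "\<phi> \<notin> s" "Neg \<phi> \<notin> s" by auto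
    obtain F where F: "finite F" "F \<subseteq> s" "\<not> G (insert \<phi> F)" using s(4) \<phi> n(1) by meson
    have "Neg \<phi> \<in> ?W" using \<phi> by (simp add: Neg_Fm)
    then obtain F' where F': "finite F'" "F' \<subseteq> s" "\<not> G (insert (Neg \<phi>) F')" using s(4) n(2) by meson
    have "finite (F \<union> F')" "F \<union> F' \<subseteq> s" using F F' by auto
    then have "G (F \<union> F')" using s(3) by blast
    then obtain w where w: "w ` J \<subseteq> M" "\<forall>\<chi>\<in>F \<union> F'. holds \<MM> (case_sum w id) \<chi>" unfolding G_def by blast
    show False
    proof (cases "holds \<MM> (case_sum w id) \<phi>")
      case True
      then have "G (insert \<phi> F)" unfolding G_def using w by (intro exI[of _ w]) simp
      then show False using F(3) by blast
    next
      case False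
      then have "G (insert (Neg \<phi>) F')" unfolding G_def using w by (intro exI[of _ w]) (simp add: holds_Neg)
      then show False using F'(3) by blast
    qed
  qed
  have no_clash: False if "\<phi> \<in> s" "\<psi> \<in> s" "\<And>w. w ` J \<subseteq> M \<Longrightarrow> holds \<MM> (case_sum w id) \<phi> \<Longrightarrow>
      \<not> holds \<MM> (case_sum w id) \<psi>" for \<phi> \<psi>
  proof -
    have "finite {\<phi>, \<psi>}" "{\<phi>, \<psi>} \<subseteq> s" using that by auto
    then have "G {\<phi>, \<psi>}" using s(3) by blast
    then show False unfolding G_def using that(3) by blast
  qed
  have inv: "invariant J s"
    unfolding invariant_type_def complete_type_def
  proof (intro conjI allI ballI impI)
    show "s \<subseteq> ?W" by (rule s(2))
    show "consistent \<MM> J s"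
      unfolding consistent_def
    proof (intro allI impI)
      fix F assume "finite F \<and> F \<subseteq> s"
      then have "G F" using s(3) by blast
      then obtain w where "w ` J \<subseteq> M" "\<forall>\<chi>\<in>F. holds \<MM> (case_sum w id) \<chi>" unfolding G_def by blast
      then have "realizes \<MM> J w F" using M_univ unfolding realizes_def by blast
      then show "\<exists>c. realizes \<MM> J c F" by blast
    qed
    show "\<phi> \<in> s \<or> Neg \<phi> \<in> s" if "\<phi> \<in> ?W" for \<phi> by (rule complete[OF that])
    fix n b b' \<phi>
    assume \<phi>: "\<phi> \<in> Fm L (Inl ` J \<union> Inr ` {..<n :: nat})"
      and bb': "b ` {..<n} \<subseteq> univ \<MM> \<and> b' ` {..<n} \<subseteq> univ \<MM> \<and>
        tp L \<MM> {..<n} b' M = tp L \<MM> {..<n} b M \<and> inst \<phi> b \<in> s"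
    have "inst \<phi> b' \<in> ?W" unfolding inst_def using \<phi> by (rule ren_in_Fm) (use bb' in auto)
    show "inst \<phi> b' \<in> s"
    proof (rule ccontr)
      assume "inst \<phi> b' \<notin> s"
      then have "Neg (inst \<phi> b') \<in> s" using complete[OF \<open>inst \<phi> b' \<in> ?W\<close>] by blast
      moreover have "inst \<phi> b \<in> s" using bb' by blast
      moreover have "\<not> holds \<MM> (case_sum w id) (Neg (inst \<phi> b'))"
        if w: "w ` J \<subseteq> M" "holds \<MM> (case_sum w id) (inst \<phi> b)" for w
      proof -
        have "eqv (Inl ` {..<n} \<union> Inr ` M) (case_sum b id) (case_sum b' id)" using bb' by (intro tp_eqv) blast
        then have "eqv (Inl ` J \<union> Inr ` {..<n}) (case_sum w b) (case_sum w b')"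
          by (rule eqv_ren[where g = "case_sum (\<lambda>j. Inr (w j)) Inl"]) (use w in auto)
        from eqvD[OF this \<phi>] w(2) show ?thesis by (simp add: holds_inst holds_Neg)
      qed
      ultimately show False by (intro no_clash)
    qed
  qed
  moreover have "realizes \<MM> J \<beta> (s \<restriction> M)"
    unfolding realizes_def
  proof (intro conjI \<beta> ballI)
    fix \<phi> assume \<phi>: "\<phi> \<in> s \<restriction> M"
    then have \<phi>M: "\<phi> \<in> Fm L (Inl ` J \<union> Inr ` M)" using restr_Fm[OF inv] by blast
    show "holds \<MM> (case_sum \<beta> id) \<phi>"
    proof (rule ccontr)
      assume "\<not> holds \<MM> (case_sum \<beta> id) \<phi>"
      then have "Neg \<phi> \<in> \<Phi>" using \<phi>M by (simp add: \<Phi>_def Neg_Fm holds_Neg)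
      then have "Neg \<phi> \<in> s" "\<phi> \<in> s" using s(1) \<phi> by (auto simp: restr_def)
      then show False using no_clash[of \<phi> "Neg \<phi>"] by (auto simp: holds_Neg)
    qed
  qed
  ultimately show ?thesis by blast
qed

end

section \<open>Amalgamating two invariant types\<close>

context saturated_over_model
begin

text \<open>One new member is inserted after each block. It is chosen over everything that is present, and
  \<open>morley_absorb\<close> makes the rest of the sequence Morley over it again. The successive sequences
  agree on longer and longer beginnings.\<close>

lemma morley_insert:
  fixes I :: "'i set"
  assumes nsop: "\<not> SOP L \<MM> 3" and p: "invariant I p" and I: "small \<kappa> I"
    and Y: "Y \<subseteq> univ \<MM>" "small \<kappa> Y" and \<Sigma>: "\<Sigma> \<subseteq> Fm L (Inl ` ({..<n} \<times> I) \<union> Inr ` Y)"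
    and c: "morley I p M c"
    and blocks: "\<And>k \<phi>. \<phi> \<in> \<Sigma> \<Longrightarrow> holds \<MM> (case_sum (\<lambda>(i, x). c (k * n + i) x) id) \<phi>"
  shows "\<exists>c'. morley I p M c' \<and>
    (\<forall>k. \<forall>\<phi>\<in>\<Sigma>. holds \<MM> (case_sum (\<lambda>(i, x). c' (k * Suc n + i) x) id) \<phi>) \<and>
    (\<forall>k. realizes \<MM> I (c' (k * Suc n + n)) (p \<restriction> Y))"
proof -
  let ?H = "\<lambda>g a \<phi>. holds \<MM> (case_sum (\<lambda>(i, x). g (a + i) x) id) \<phi>"
  have H_cong: "?H g a \<phi> = ?H g' a' \<phi>" if "\<phi> \<in> \<Sigma>" "\<And>i. i < n \<Longrightarrow> g (a + i) = g' (a' + i)"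
    for g g' :: "nat \<Rightarrow> 'i \<Rightarrow> 'a" and a a' \<phi>
  proof (rule holds_cong_Fm)
    show "\<phi> \<in> Fm L (Inl ` ({..<n} \<times> I) \<union> Inr ` Y)" using that(1) \<Sigma> by blast
  qed (use that(2) in auto)
  \<comment> \<open>Stage \<open>k\<close> has \<open>k\<close> finished blocks of length \<open>Suc n\<close>, followed by blocks of length \<open>n\<close>.\<close>
  define Inv where "Inv k g \<longleftrightarrow> morley I p M g \<and>
      (\<forall>l<k. (\<forall>\<phi>\<in>\<Sigma>. ?H g (l * Suc n) \<phi>) \<and> realizes \<MM> I (g (l * Suc n + n)) (p \<restriction> Y)) \<and>
      (\<forall>t. \<forall>\<phi>\<in>\<Sigma>. ?H g (k * Suc n + t * n) \<phi>)" for k and g :: "nat \<Rightarrow> 'i \<Rightarrow> 'a"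
  define Q where "Q k g g' \<longleftrightarrow> (\<forall>j < k * Suc n + n. g' j = g j)" for k and g g' :: "nat \<Rightarrow> 'i \<Rightarrow> 'a"
  have "\<exists>G. \<forall>k. Inv k (G k) \<and> Q k (G k) (G (Suc k))"
  proof (rule dependent_nat_choice)
    show "\<exists>g. Inv 0 g" using c blocks by (intro exI[of _ c]) (simp add: Inv_def)
  next
    fix g k assume "Inv k g"
    then have g: "morley I p M g"
      and earlier: "\<And>l \<phi>. l < k \<Longrightarrow> \<phi> \<in> \<Sigma> \<Longrightarrow> ?H g (l * Suc n) \<phi>"
        "\<And>l. l < k \<Longrightarrow> realizes \<MM> I (g (l * Suc n + n)) (p \<restriction> Y)"
      and tail: "\<And>t \<phi>. \<phi> \<in> \<Sigma> \<Longrightarrow> ?H g (k * Suc n + t * n) \<phi>"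
      unfolding Inv_def by blast+
    define N where "N = k * Suc n + n"
    define C where "C = M \<union> (\<Union>j<N. g j ` I)"
    have C: "M \<subseteq> C" "C \<subseteq> univ \<MM>" "small \<kappa> C"
      unfolding C_def using prefix_univ[OF M_univ morley_univ[OF g]] small_Un[OF M_small small_prefix[OF I]]
      by auto
    have CY: "C \<union> Y \<subseteq> univ \<MM>" "small \<kappa> (C \<union> Y)"
      by (rule Un_least[OF C(2) Y(1)], rule small_Un[OF C(3) Y(2)])
    obtain u where u: "realizes \<MM> I u (p \<restriction> (C \<union> Y))" using realizes_exists[OF p I CY] by blast
    have shift: "morley I p C (\<lambda>i. g (N + i))" unfolding C_def by (rule morley_shift[OF g])
    have "?H (\<lambda>i. g (N + i)) (t * n) \<phi>" if "\<phi> \<in> \<Sigma>" for t \<phi>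
    proof -
      have "?H g (k * Suc n + Suc t * n) \<phi> = ?H (\<lambda>i. g (N + i)) (t * n) \<phi>"
        using that by (rule H_cong) (simp add: N_def algebra_simps)
      then show ?thesis using tail[OF that, of "Suc t"] by blast
    qed
    from morley_absorb[OF nsop p I p I C Y \<Sigma> shift this u]
    obtain e where e: "morley I p (C \<union> u ` I) e" "\<And>t \<phi>. \<phi> \<in> \<Sigma> \<Longrightarrow> ?H e (t * n) \<phi>" by blast
    define g1 where "g1 = g(N := u)"
    define g' where "g' i = (if i < Suc N then g1 i else e (i - Suc N))" for i
    have g'_less: "g' i = g i" if "i < N" for i using that by (simp add: g'_def g1_def)
    have g'_N: "g' N = u" by (simp add: g'_def g1_def)
    have g'_gt: "g' (Suc N + i) = e i" for i by (simp add: g'_def)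
    have prefix: "(\<Union>j<i. g1 j ` I) = (\<Union>j<i. g j ` I)" if "i \<le> N" for i
      using that by (intro SUP_cong) (auto simp: g1_def)
    have "morley I p M g'"
      unfolding g'_def
    proof (rule morley_append)
      fix i assume "i < Suc N"
      then consider "i < N" | "i = N" by linarith
      then show "realizes \<MM> I (g1 i) (p \<restriction> (M \<union> (\<Union>j<i. g1 j ` I)))"
      proof cases
        case 1
        then show ?thesis using morleyD[OF g, of i] prefix[of i] by (simp add: g1_def)
      next
        case 2
        have "realizes \<MM> I u (p \<restriction> C)" by (rule realizes_restr_mono[OF u]) simp
        then show ?thesis unfolding 2 prefix[OF order_refl] C_def by (simp add: g1_def)
      qed
    next
      have "(\<Union>j<Suc N. g1 j ` I) = (\<Union>j<N. g j ` I) \<union> u ` I"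
        unfolding lessThan_Suc UN_insert prefix[OF order_refl] by (simp add: g1_def Un_commute)
      then show "morley I p (M \<union> (\<Union>j<Suc N. g1 j ` I)) e" using e(1) by (simp add: C_def Un_assoc)
    qed
    moreover have "(\<forall>\<phi>\<in>\<Sigma>. ?H g' (l * Suc n) \<phi>) \<and> realizes \<MM> I (g' (l * Suc n + n)) (p \<restriction> Y)" if "l < Suc k" for l
    proof -
      have le: "l * Suc n + n \<le> N" unfolding N_def using that by (intro add_le_mono1 mult_le_mono1) simp
      then have "g' (l * Suc n + i) = g (l * Suc n + i)" if "i < n" for i using that by (intro g'_less) simp
      then have H_eq: "?H g' (l * Suc n) \<phi> = ?H g (l * Suc n) \<phi>" if "\<phi> \<in> \<Sigma>" for \<phi> using that by (intro H_cong)
      show ?thesis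
      proof (cases "l = k")
        case True
        have "?H g (k * Suc n) \<phi>" if "\<phi> \<in> \<Sigma>" for \<phi> using tail[OF that, of 0] by simp
        moreover have "realizes \<MM> I u (p \<restriction> Y)" by (rule realizes_restr_mono[OF u]) simp
        ultimately show ?thesis using H_eq g'_N True by (simp add: N_def)
      next
        case False
        then have lk: "l < k" using that by simp
        then have "Suc l * Suc n \<le> k * Suc n" by (intro mult_le_mono1) simp
        then have "l * Suc n + n < N" unfolding N_def by simp
        then show ?thesis using earlier[OF lk] H_eq g'_less by simp
      qed
    qed
    moreover have "?H g' (Suc k * Suc n + t * n) \<phi>" if "\<phi> \<in> \<Sigma>" for t \<phi>
    proof -
      have "g' (Suc k * Suc n + t * n + i) = e (t * n + i)" for i
        using g'_gt[of "t * n + i"] by (simp add: N_def algebra_simps)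
      then have "?H g' (Suc k * Suc n + t * n) \<phi> = ?H e (t * n) \<phi>" using that by (intro H_cong)
      then show ?thesis using e(2)[OF that] by blast
    qed
    ultimately have "Inv (Suc k) g'" unfolding Inv_def by blast
    moreover have "Q k g g'" unfolding Q_def using g'_less by (simp add: N_def)
    ultimately show "\<exists>g'. Inv (Suc k) g' \<and> Q k g g'" by blast
  qed
  then obtain G where G: "\<And>k. Inv k (G k)" "\<And>k. Q k (G k) (G (Suc k))" by blast
  have agree: "G k' j = G k j" if "k \<le> k'" "j < k * Suc n + n" for k k' j
    using that(1)
  proof (induction rule: dec_induct)
    case (step k')
    have "k * Suc n \<le> k' * Suc n" using step.hyps(1) by (intro mult_le_mono1)
    then have "j < k' * Suc n + n" using that(2) by linarith
    then show ?case using G(2)[of k'] step.IH by (simp add: Q_def)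
  qed simp
  define c' where "c' j = G (Suc j) j" for j
  have c'_G: "c' j = G k j" if "j < k" for j k
    unfolding c'_def using that by (intro agree[symmetric]) auto
  have "morley I p M c'"
  proof (rule morleyI)
    fix i
    have "morley I p M (G (Suc i))" using G(1)[of "Suc i"] by (simp add: Inv_def)
    from morleyD[OF this, of i] have "realizes \<MM> I (G (Suc i) i) (p \<restriction> (M \<union> (\<Union>j<i. G (Suc i) j ` I)))" .
    moreover have "(\<Union>j<i. c' j ` I) = (\<Union>j<i. G (Suc i) j ` I)" by (intro SUP_cong) (simp_all add: c'_G[of _ "Suc i"])
    ultimately show "realizes \<MM> I (c' i) (p \<restriction> (M \<union> (\<Union>j<i. c' j ` I)))" by (simp add: c'_G[of i "Suc i"])
  qed
  moreover have "(\<forall>\<phi>\<in>\<Sigma>. ?H c' (l * Suc n) \<phi>) \<and> realizes \<MM> I (c' (l * Suc n + n)) (p \<restriction> Y)" for l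
  proof -
    define k where "k = Suc (l * Suc n + n)"
    have "l \<le> l * Suc n" by simp
    then have lk: "l < k" unfolding k_def by linarith
    have eq: "c' (l * Suc n + i) = G k (l * Suc n + i)" if "i \<le> n" for i
      using that by (intro c'_G) (simp add: k_def)
    have H_eq: "?H c' (l * Suc n) \<phi> = ?H (G k) (l * Suc n) \<phi>" if "\<phi> \<in> \<Sigma>" for \<phi>
      using that by (rule H_cong) (rule eq[OF less_imp_le])
    have "(\<forall>\<phi>\<in>\<Sigma>. ?H (G k) (l * Suc n) \<phi>) \<and> realizes \<MM> I (G k (l * Suc n + n)) (p \<restriction> Y)"
      using G(1)[of k] lk unfolding Inv_def by blast
    then show ?thesis unfolding eq[OF order_refl] using H_eq by blast
  qed
  ultimately show ?thesis by blast
qed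

lemma morley_starting_at:
  assumes "invariant J s" "small \<kappa> J" "realizes \<MM> J \<beta> (s \<restriction> M)"
  shows "\<exists>c. morley J s M c \<and> c 0 = \<beta>"
proof -
  have \<beta>: "\<beta> ` J \<subseteq> univ \<MM>" using assms(3) by (simp add: realizes_def)
  have "M \<union> \<beta> ` J \<subseteq> univ \<MM>" "small \<kappa> (M \<union> \<beta> ` J)"
    by (rule Un_least[OF M_univ \<beta>], rule small_Un[OF M_small small_image[OF assms(2)]])
  from morley_exists[OF assms(1,2) this] obtain e where e: "morley J s (M \<union> \<beta> ` J) e" by blast
  have "morley J s M (\<lambda>i. if i < 1 then (\<lambda>_. \<beta>) i else e (i - 1))"
    by (rule morley_append) (use assms(3) e in \<open>simp_all add: lessThan_Suc\<close>)
  then show ?thesis by (intro exI[of _ "\<lambda>i. if i < 1 then (\<lambda>_. \<beta>) i else e (i - 1)"]) simp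
qed

text \<open>Kim-independence is used in this form only: a formula that \<open>A\<close> satisfies together with a
  tuple from \<open>B\<close> can be satisfied by one copy of \<open>A\<close> over \<open>M\<close> along a whole Morley sequence. The parameters
  from \<open>M\<close> in further formulas on the copy are appended to the tuples of the sequence.\<close>

lemma kim_indep_copy:
  fixes A B :: "'a set" and n :: nat
  assumes kim: "kim_indep L \<MM> M A id B" and A: "M \<subseteq> A" "A \<subseteq> univ \<MM>" "small \<kappa> A"
    and s: "invariant {..<n} s" and \<gamma>: "morley {..<n} s M \<gamma>" "\<gamma> 0 ` {..<n} \<subseteq> B" and B: "B \<subseteq> univ \<MM>"
    and \<chi>: "\<chi> \<in> Fm L (Inl ` A \<union> Inr ` {..<n})" "holds \<MM> (case_sum id (\<gamma> 0)) \<chi>"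
  shows "\<exists>f. f ` A \<subseteq> univ \<MM> \<and> eqv (Inl ` A \<union> Inr ` M) (case_sum id id) (case_sum f id) \<and>
    (\<forall>i. holds \<MM> (case_sum f (\<gamma> i)) \<chi>)"
proof -
  let ?V = "Inl ` (UNIV \<times> {..<n}) \<union> Inr ` M :: ((nat \<times> nat) + 'a) set"
  let ?t = "case_sum (case_prod \<gamma>) id"
  define T where "T = {\<sigma> \<in> Fm L (Inl ` A \<union> Inr ` M). holds \<MM> (case_sum id id) \<sigma>}"
  define gi :: "nat \<Rightarrow> 'a + nat \<Rightarrow> 'a + (nat \<times> nat) + 'a" where
    "gi i = map_sum id (\<lambda>l. Inl (i, l))" for i
  define \<Gamma> where "\<Gamma> = ren (map_sum id Inr) ` T \<union> range (\<lambda>i. ren (gi i) \<chi>)"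
  have T_iff: "holds \<MM> (case_sum w ?t) (ren (map_sum id Inr) \<sigma>) \<longleftrightarrow> holds \<MM> (case_sum w id) \<sigma>" for w \<sigma>
    unfolding holds_ren by (rule holds_cong) (simp add: map_sum_def split: sum.split)
  have \<chi>_iff: "holds \<MM> (case_sum w ?t) (ren (gi i) \<chi>) \<longleftrightarrow> holds \<MM> (case_sum w (\<gamma> i)) \<chi>" for w i
    unfolding holds_ren by (rule holds_cong) (simp add: gi_def map_sum_def split: sum.split)
  have \<Gamma>: "\<Gamma> \<subseteq> Fm L (Inl ` A \<union> Inr ` ?V)"
  proof -
    have "ren (map_sum id Inr) \<sigma> \<in> Fm L (Inl ` A \<union> Inr ` ?V)" if "\<sigma> \<in> T" for \<sigma>
    proof -
      have "\<sigma> \<in> Fm L (Inl ` A \<union> Inr ` M)" using that by (simp add: T_def)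
      then show ?thesis by (rule ren_in_Fm) auto
    qed
    moreover have "ren (gi i) \<chi> \<in> Fm L (Inl ` A \<union> Inr ` ?V)" for i
      using \<chi>(1) by (rule ren_in_Fm) (auto simp: gi_def)
    ultimately show ?thesis unfolding \<Gamma>_def by blast
  qed
  have t_eq: "?t ` ?V = case_prod \<gamma> ` (UNIV \<times> {..<n}) \<union> M" by (simp add: image_Un image_image)
  have t_univ: "?t ` ?V \<subseteq> univ \<MM>"
    unfolding t_eq using morley_univ[OF \<gamma>(1)] M_univ by auto
  have t_small: "small \<kappa> (?t ` ?V)"
    unfolding t_eq
    by (rule small_Un[OF small_image[OF small_Times_nat[OF small_finite[OF finite_lessThan]]] M_small])
  have fin: "\<exists>w. w ` A \<subseteq> univ \<MM> \<and> (\<forall>\<phi>\<in>F. holds \<MM> (case_sum w ?t) \<phi>)" if F: "finite F" "F \<subseteq> \<Gamma>" for F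
  proof -
    have "finite (F \<inter> ren (map_sum id Inr) ` T)" "F \<inter> ren (map_sum id Inr) ` T \<subseteq> ren (map_sum id Inr) ` T"
      using F(1) by auto
    then obtain F1 where F1: "F1 \<subseteq> T" "finite F1"
      "F \<inter> ren (map_sum id Inr) ` T = ren (map_sum id Inr) ` F1" by (meson finite_subset_image)
    have "finite (F \<inter> range (\<lambda>i. ren (gi i) \<chi>))" "F \<inter> range (\<lambda>i. ren (gi i) \<chi>) \<subseteq> (\<lambda>i. ren (gi i) \<chi>) ` UNIV"
      using F(1) by auto
    then obtain N where N: "finite N" "F \<inter> range (\<lambda>i. ren (gi i) \<chi>) = (\<lambda>i. ren (gi i) \<chi>) ` N"
      by (meson finite_subset_image)
    have F_eq: "F = ren (map_sum id Inr) ` F1 \<union> (\<lambda>i. ren (gi i) \<chi>) ` N"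
      unfolding F1(3)[symmetric] N(2)[symmetric] using F(2) unfolding \<Gamma>_def by blast
    have "F1 \<subseteq> Fm L (Inl ` A \<union> Inr ` M)" using F1(1) unfolding T_def by blast
    from conj_fm[OF F1(2) this] obtain \<sigma> where \<sigma>: "\<sigma> \<in> Fm L (Inl ` A \<union> Inr ` M)"
      "\<forall>s. holds \<MM> s \<sigma> \<longleftrightarrow> (\<forall>\<phi>\<in>F1. holds \<MM> s \<phi>)" by (elim bexE, intro that)
    have \<sigma>_id: "holds \<MM> (case_sum id id) \<sigma>" using F1(1) unfolding \<sigma>(2)[rule_format] T_def by blast
    define V0 where "V0 = {m. Inr m \<in> fv \<sigma>}"
    have "finite (Inr -` fv \<sigma>)" by (intro finite_vimageI finite_fv) auto
    then have "finite V0" by (simp add: vimage_def V0_def)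
    then obtain h r where h: "bij_betw h {..<r :: nat} V0"
      using ex_bij_betw_nat_finite[of V0] by (auto simp: atLeast0LessThan)
    define k where "k = the_inv_into {..<r} h"
    have k: "k v < r" "h (k v) = v" if "v \<in> V0" for v
      using that bij_betw_the_inv_into[OF h] f_the_inv_into_f_bij_betw[OF h] unfolding k_def
      by (auto simp: bij_betw_def)
    have hM: "h l \<in> M" if "l < r" for l
    proof -
      have "h l \<in> V0" using h that by (auto simp: bij_betw_def)
      then show ?thesis using FmD[OF \<sigma>(1)] by (auto simp: V0_def)
    qed
    define d where "d \<gamma>i l = (if l < n then \<gamma>i l else h (l - n))" for \<gamma>i :: "nat \<Rightarrow> 'a" and l
    define \<Theta> where "\<Theta> = And (ren (map_sum id (\<lambda>m. n + k m)) \<sigma>) \<chi>"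
    have "ren (map_sum id (\<lambda>m. n + k m)) \<sigma> \<in> Fm L (Inl ` A \<union> Inr ` {..<n + r})"
      using Fm_fv[OF \<sigma>(1)]
    proof (rule ren_in_Fm)
      fix v assume v: "v \<in> fv \<sigma>"
      then have "v \<in> Inl ` A \<union> Inr ` M" using FmD[OF \<sigma>(1)] by blast
      then show "map_sum id (\<lambda>m. n + k m) v \<in> Inl ` A \<union> Inr ` {..<n + r}"
        using v k(1) by (auto simp: V0_def)
    qed
    moreover have "\<chi> \<in> Fm L (Inl ` A \<union> Inr ` {..<n + r})" by (rule Fm_mono[OF _ \<chi>(1)]) auto
    ultimately have \<Theta>: "\<Theta> \<in> Fm L (Inl ` A \<union> Inr ` {..<n + r})" by (simp add: \<Theta>_def And_Fm)
    have \<Theta>_iff: "holds \<MM> (case_sum w (d \<gamma>i)) \<Theta> \<longleftrightarrow> holds \<MM> (case_sum w id) \<sigma> \<and> holds \<MM> (case_sum w \<gamma>i) \<chi>" for w \<gamma>i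
    proof -
      have "holds \<MM> (case_sum w (d \<gamma>i)) (ren (map_sum id (\<lambda>m. n + k m)) \<sigma>) = holds \<MM> (case_sum w id) \<sigma>"
        unfolding holds_ren
      proof (rule holds_cong)
        fix v assume "v \<in> fv \<sigma>"
        then show "(case_sum w (d \<gamma>i) \<circ> map_sum id (\<lambda>m. n + k m)) v = case_sum w id v"
          using k(2) by - (cases v, simp_all add: d_def V0_def)
      qed
      moreover have "holds \<MM> (case_sum w (d \<gamma>i)) \<chi> = holds \<MM> (case_sum w \<gamma>i) \<chi>"
        by (rule holds_cong_Fm[OF \<chi>(1)]) (auto simp: d_def)
      ultimately show ?thesis by (simp add: \<Theta>_def holds_And)
    qed
    have d_MB: "d (\<gamma> 0) ` {..<n + r} \<subseteq> M \<union> B"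
    proof
      fix y assume "y \<in> d (\<gamma> 0) ` {..<n + r}"
      then obtain l where l: "l < n + r" "y = d (\<gamma> 0) l" by blast
      show "y \<in> M \<union> B"
      proof (cases "l < n")
        case True
        then show ?thesis using \<gamma>(2) l(2) by (auto simp: d_def)
      next
        case False
        then have "l - n < r" using l(1) by linarith
        then show ?thesis using hM[of "l - n"] False l(2) by (simp add: d_def)
      qed
    qed
    have "inst \<Theta> (d (\<gamma> 0)) \<in> Fm L (Inl ` A \<union> Inr ` (M \<union> B))"
      unfolding inst_def using \<Theta>
    proof (rule ren_in_Fm)
      fix v :: "'a + nat" assume "v \<in> Inl ` A \<union> Inr ` {..<n + r}"
      then show "map_sum id (d (\<gamma> 0)) v \<in> Inl ` A \<union> Inr ` (M \<union> B)" using d_MB by (elim UnE imageE) auto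
    qed
    moreover have "holds \<MM> (case_sum id id) (inst \<Theta> (d (\<gamma> 0)))"
      unfolding holds_inst \<Theta>_iff using \<sigma>_id \<chi>(2) by blast
    ultimately have "inst \<Theta> (d (\<gamma> 0)) \<in> tp L \<MM> A id (M \<union> B)" by (simp add: tp_def)
    then have nf: "\<not> kim_forks L \<MM> M A \<Theta> (d (\<gamma> 0))"
      using kim \<Theta> d_MB unfolding kim_indep_def by blast
    have nd: "\<not> kim_divides L \<MM> M A (n + r) \<Theta> (d (\<gamma> 0))"
    proof
      assume div: "kim_divides L \<MM> M A (n + r) \<Theta> (d (\<gamma> 0))"
      have "d (\<gamma> 0) ` {..<n + r} \<subseteq> univ \<MM>" using d_MB M_univ B by blast
      then have "kim_forks L \<MM> M A \<Theta> (d (\<gamma> 0))"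
        unfolding kim_forks_def by (intro exI[of _ "{(n + r, \<Theta>, d (\<gamma> 0))}"]) (use \<Theta> div in simp)
      then show False using nf by blast
    qed
    define h' where "h' l = (if l < n then Inl l else Inr (h (l - n)))" for l
    have h': "h' l \<in> Inl ` {..<n} \<union> Inr ` M" if "l \<in> {..<n + r}" for l
    proof (cases "l < n")
      case False
      then have "h (l - n) \<in> M" using that by (intro hM) auto
      then show ?thesis using False by (simp add: h'_def)
    qed (simp add: h'_def)
    have d_h': "(\<lambda>i l. case_sum (\<gamma> i) id (h' l)) = (\<lambda>i. d (\<gamma> i))" by (auto simp: fun_eq_iff d_def h'_def)
    have "invariant_morley_seq L \<MM> M {..<n + r} (\<lambda>i. d (\<gamma> i))"
      unfolding invariant_morley_seq_def d_h'[symmetric]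
      by (intro exI[of _ "pushforward {..<n + r} h' s"] conjI pushforward_invariant[OF s h']
          pushforward_morley[OF s h' \<gamma>(1)])
    then have con: "consistent \<MM> A (range (\<lambda>i. inst \<Theta> (d (\<gamma> i))))"
      using nd unfolding kim_divides_def not_ex de_Morgan_conj by (metis (no_types))
    have "finite ((\<lambda>i. inst \<Theta> (d (\<gamma> i))) ` insert 0 N)" "(\<lambda>i. inst \<Theta> (d (\<gamma> i))) ` insert 0 N \<subseteq> range (\<lambda>i. inst \<Theta> (d (\<gamma> i)))"
      using N(1) by blast+
    then obtain w where w: "realizes \<MM> A w ((\<lambda>i. inst \<Theta> (d (\<gamma> i))) ` insert 0 N)"
      using con unfolding consistent_def by meson
    have wi: "holds \<MM> (case_sum w id) \<sigma> \<and> holds \<MM> (case_sum w (\<gamma> i)) \<chi>" if "i \<in> insert 0 N" for i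
    proof -
      have "holds \<MM> (case_sum w id) (inst \<Theta> (d (\<gamma> i)))" using w that unfolding realizes_def by blast
      then show ?thesis unfolding holds_inst \<Theta>_iff .
    qed
    have "holds \<MM> (case_sum w ?t) \<phi>" if "\<phi> \<in> F" for \<phi>
    proof -
      from that consider \<tau> where "\<tau> \<in> F1" "\<phi> = ren (map_sum id Inr) \<tau>" | i where "i \<in> N" "\<phi> = ren (gi i) \<chi>"
        unfolding F_eq by blast
      then show ?thesis
      proof cases
        case 1
        have "holds \<MM> (case_sum w id) \<sigma>" using wi[of 0] by blast
        then show ?thesis unfolding 1(2) T_iff using \<sigma>(2) 1(1) by blast
      next
        case 2
        then show ?thesis unfolding 2(2) \<chi>_iff using wi by blast
      qed
    qed
    then show ?thesis using w unfolding realizes_def by blast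
  qed
  obtain f where f: "f ` A \<subseteq> univ \<MM>" "\<And>\<phi>. \<phi> \<in> \<Gamma> \<Longrightarrow> holds \<MM> (case_sum f ?t) \<phi>"
    using saturation[OF \<Gamma> fin A(3) t_univ t_small] by blast
  have f_T: "holds \<MM> (case_sum f id) \<sigma>" if "\<sigma> \<in> T" for \<sigma>
  proof -
    have "ren (map_sum id Inr) \<sigma> \<in> \<Gamma>" using that unfolding \<Gamma>_def by blast
    from f(2)[OF this] show ?thesis unfolding T_iff .
  qed
  have "eqv (Inl ` A \<union> Inr ` M) (case_sum id id) (case_sum f id)"
    unfolding eqv_def
  proof
    fix \<sigma> assume "\<sigma> \<in> Fm L (Inl ` A \<union> Inr ` M)"
    then show "holds \<MM> (case_sum id id) \<sigma> = holds \<MM> (case_sum f id) \<sigma>"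
      using f_T[of \<sigma>] f_T[of "Neg \<sigma>"] by (auto simp: T_def Neg_Fm holds_Neg)
  qed
  moreover have "holds \<MM> (case_sum f (\<gamma> i)) \<chi>" for i
  proof -
    have "ren (gi i) \<chi> \<in> \<Gamma>" unfolding \<Gamma>_def by blast
    from f(2)[OF this] show ?thesis unfolding \<chi>_iff .
  qed
  ultimately show ?thesis using f(1) by blast
qed

end

lemma finite_subset_increasing_UN:
  fixes D :: "nat \<Rightarrow> 'x set"
  assumes "finite S" "S \<subseteq> (\<Union>N. D N)" "\<And>N N'. N \<le> N' \<Longrightarrow> D N \<subseteq> D N'"
  shows "\<exists>N. S \<subseteq> D N"
  using assms(1,2)
proof (induction rule: finite_induct)
  case (insert x S)
  then obtain N N' where "S \<subseteq> D N" "x \<in> D N'" by auto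
  then have "insert x S \<subseteq> D (max N N')"
    using assms(3)[of N "max N N'"] assms(3)[of N' "max N N'"] by auto
  then show ?case by blast
qed simp

context saturated_over_model
begin

text \<open>The tuples \<open>g\<^sub>0, g\<^sub>1, \<dots>\<close> form a Morley sequence over \<open>M\<close>, so a copy of \<open>A\<close> that works for one Morley
  sequence of \<open>s\<close> can be moved to one that works for all earlier \<open>g\<^sub>i\<close>.\<close>

lemma interleaved_copies:
  fixes A B :: "'a set" and n :: nat
  assumes kim: "kim_indep L \<MM> M A id B" and A: "M \<subseteq> A" "A \<subseteq> univ \<MM>" "small \<kappa> A"
    and s: "invariant {..<n} s" and \<beta>: "realizes \<MM> {..<n} \<beta> (s \<restriction> M)" "\<beta> ` {..<n} \<subseteq> B" and B: "B \<subseteq> univ \<MM>"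
    and \<chi>: "\<chi> \<in> Fm L (Inl ` A \<union> Inr ` {..<n})" "holds \<MM> (case_sum id \<beta>) \<chi>"
  shows "\<exists>f g. \<forall>j :: nat. f j ` A \<subseteq> univ \<MM> \<and> eqv (Inl ` A \<union> Inr ` M) (case_sum id id) (case_sum (f j) id) \<and>
    (\<forall>i<j. holds \<MM> (case_sum (f j) (g i)) \<chi>) \<and>
    realizes \<MM> {..<n} (g j) (s \<restriction> (M \<union> (\<Union>i<j. f i ` A \<union> g i ` {..<n}) \<union> f j ` A))"
proof -
  have sm: "small \<kappa> {..<n}" by (rule small_finite) simp
  obtain \<gamma> where \<gamma>: "morley {..<n} s M \<gamma>" "\<gamma> 0 = \<beta>"
    using morley_starting_at[OF s sm \<beta>(1)] by blast
  obtain f0 where f0: "f0 ` A \<subseteq> univ \<MM>" "eqv (Inl ` A \<union> Inr ` M) (case_sum id id) (case_sum f0 id)"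
    "\<And>i. holds \<MM> (case_sum f0 (\<gamma> i)) \<chi>"
    using kim_indep_copy[OF kim A s \<gamma>(1) _ B \<chi>(1)] \<beta>(2) \<chi>(2) unfolding \<gamma>(2) by blast
  define E where "E h j = M \<union> (\<Union>i<j. fst (h i) ` A \<union> snd (h i) ` {..<n})"
    for h :: "nat \<Rightarrow> ('a \<Rightarrow> 'a) \<times> (nat \<Rightarrow> 'a)" and j :: nat
  define P where "P h j y \<longleftrightarrow> fst y ` A \<subseteq> univ \<MM> \<and>
      eqv (Inl ` A \<union> Inr ` M) (case_sum id id) (case_sum (fst y) id) \<and>
      (\<forall>i<j. holds \<MM> (case_sum (fst y) (snd (h i))) \<chi>) \<and>
      realizes \<MM> {..<n} (snd y) (s \<restriction> (E h j \<union> fst y ` A))"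
    for h :: "nat \<Rightarrow> ('a \<Rightarrow> 'a) \<times> (nat \<Rightarrow> 'a)" and j y
  have "\<exists>h. \<forall>j. P h j (h j)"
  proof (rule dependent_wellorder_choice)
    fix y :: "('a \<Rightarrow> 'a) \<times> (nat \<Rightarrow> 'a)" and h h' :: "nat \<Rightarrow> ('a \<Rightarrow> 'a) \<times> (nat \<Rightarrow> 'a)" and j :: nat
    assume hh': "\<And>i. i < j \<Longrightarrow> h i = h' i"
    have "E h j = E h' j" unfolding E_def using hh' by simp
    moreover have "(\<forall>i<j. holds \<MM> (case_sum (fst y) (snd (h i))) \<chi>) = (\<forall>i<j. holds \<MM> (case_sum (fst y) (snd (h' i))) \<chi>)"
      using hh' by simp
    ultimately show "P h j y = P h' j y" by (simp only: P_def)
  next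
    fix j :: nat and h :: "nat \<Rightarrow> ('a \<Rightarrow> 'a) \<times> (nat \<Rightarrow> 'a)"
    assume h: "\<And>i. i < j \<Longrightarrow> P h i (h i)"
    have hi: "fst (h i) ` A \<subseteq> univ \<MM>" "snd (h i) ` {..<n} \<subseteq> univ \<MM>"
      "realizes \<MM> {..<n} (snd (h i)) (s \<restriction> (E h i \<union> fst (h i) ` A))" if "i < j" for i
      using h[OF that] by (simp_all add: P_def realizes_def)
    have E_univ: "E h j \<subseteq> univ \<MM>"
      unfolding E_def
    proof (rule Un_least[OF M_univ UN_least])
      fix i assume "i \<in> {..<j}"
      then have "i < j" by simp
      from hi(1,2)[OF this] show "fst (h i) ` A \<union> snd (h i) ` {..<n} \<subseteq> univ \<MM>" by (rule Un_least)
    qed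
    have "small \<kappa> (fst (h i) ` A \<union> snd (h i) ` {..<n})" for i
      by (rule small_Un[OF small_image[OF A(3)] small_image[OF sm]])
    then have E_small: "small \<kappa> (E h j)"
      unfolding E_def by (rule small_Un[OF M_small small_UN_finite[OF finite_lessThan]])
    obtain e0 where e0: "morley {..<n} s (E h j) e0" using morley_exists[OF s sm E_univ E_small] by blast
    define e where "e i = (if i < j then (\<lambda>i. snd (h i)) i else e0 (i - j))" for i
    have snd_E: "snd (h i) ` {..<n} \<subseteq> E h j'" if "i < j'" for i j' using that unfolding E_def by blast
    have ME: "M \<subseteq> E h j'" for j' unfolding E_def by (rule Un_upper1)
    have e: "morley {..<n} s M e"
      unfolding e_def
    proof (rule morley_append)
      fix i assume "i < j"
      have "M \<union> (\<Union>i'<i. snd (h i') ` {..<n}) \<subseteq> E h i" by (intro Un_least UN_least ME snd_E) simp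
      then show "realizes \<MM> {..<n} (snd (h i)) (s \<restriction> (M \<union> (\<Union>i'<i. snd (h i') ` {..<n})))"
        by (intro realizes_restr_mono[OF hi(3)[OF \<open>i < j\<close>]] le_supI1)
    next
      have "M \<union> (\<Union>i'<j. snd (h i') ` {..<n}) \<subseteq> E h j" by (intro Un_least UN_least ME snd_E) simp
      then show "morley {..<n} s (M \<union> (\<Union>i'<j. snd (h i') ` {..<n})) e0" by (rule morley_mono[OF e0])
    qed
    let ?V = "Inl ` seq_names {..<n} \<union> Inr ` M :: ((nat \<times> nat) + 'a) set"
    let ?g = "case_sum (case_prod \<gamma>) id" and ?e = "case_sum (case_prod e) id"
    have ge: "eqv ?V ?g ?e"
      using eqv_morley[OF s eqv_refl names_M_id[OF order_refl], of \<gamma> e] M_univ \<gamma>(1) e by simp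
    have e_eq: "?e ` ?V = case_prod e ` (UNIV \<times> {..<n}) \<union> M" by (simp add: image_Un image_image)
    have e_univ: "?e ` ?V \<subseteq> univ \<MM>" unfolding e_eq using morley_univ[OF e] M_univ by auto
    have e_small: "small \<kappa> (?e ` ?V)"
      unfolding e_eq by (rule small_Un[OF small_image[OF small_Times_nat[OF sm]] M_small])
    obtain f where f: "f ` A \<subseteq> univ \<MM>" "eqv (Inl ` A \<union> Inr ` ?V) (case_sum f0 ?g) (case_sum f ?e)"
      by (rule eqv_extend[OF ge f0(1) A(3) e_univ e_small])
    have "eqv (Inl ` A \<union> Inr ` M) (case_sum f0 id) (case_sum f id)"
      by (rule eqv_ren[OF f(2), where g = "map_sum id Inr"]) auto
    with f0(2) have fM: "eqv (Inl ` A \<union> Inr ` M) (case_sum id id) (case_sum f id)" by (rule eqv_trans)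
    have f\<chi>: "holds \<MM> (case_sum f (snd (h i))) \<chi>" if "i < j" for i
    proof -
      have "eqv (Inl ` A \<union> Inr ` {..<n}) (case_sum f0 (\<gamma> i)) (case_sum f (e i))"
        by (rule eqv_ren[OF f(2), where g = "map_sum id (\<lambda>l. Inl (i, l))"]) auto
      from eqvD[OF this \<chi>(1)] have "holds \<MM> (case_sum f (e i)) \<chi>" using f0(3) by blast
      then show ?thesis using that by (simp add: e_def)
    qed
    have Ef: "E h j \<union> f ` A \<subseteq> univ \<MM>" "small \<kappa> (E h j \<union> f ` A)"
      by (rule Un_least[OF E_univ f(1)], rule small_Un[OF E_small small_image[OF A(3)]])
    obtain g where "realizes \<MM> {..<n} g (s \<restriction> (E h j \<union> f ` A))" using realizes_exists[OF s sm Ef] by blast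
    then have "P h j (f, g)" unfolding P_def fst_conv snd_conv using f(1) fM f\<chi> by blast
    then show "\<exists>y. P h j y" by blast
  qed
  then obtain h where h: "\<forall>j. P h j (h j)" by blast
  define f where "f j = fst (h j)" for j
  define g where "g j = snd (h j)" for j
  have all: "f j ` A \<subseteq> univ \<MM> \<and> eqv (Inl ` A \<union> Inr ` M) (case_sum id id) (case_sum (f j) id) \<and>
    (\<forall>i<j. holds \<MM> (case_sum (f j) (g i)) \<chi>) \<and>
    realizes \<MM> {..<n} (g j) (s \<restriction> (M \<union> (\<Union>i<j. f i ` A \<union> g i ` {..<n}) \<union> f j ` A))" for j
    using spec[OF h, of j] unfolding P_def E_def f_def g_def .
  show ?thesis by (rule exI[of _ f], rule exI[of _ g], rule allI, rule all)
qed

text \<open>The length of the blocks grows by one in each step. First the sequence, read as a Morley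
  sequence of \<open>q\<close>, absorbs \<open>g\<^sub>N\<close>; thereafter all its members satisfy \<open>\<psi>(x, g\<^sub>N)\<close>. Then, read as a
  Morley sequence of \<open>p\<close>, it receives a new last member of each block, which satisfies \<open>\<phi>(x, f\<^sub>l)\<close>
  for all \<open>l \<le> N\<close>. The formulas obtained before are the conditions on blocks that both steps keep.\<close>

lemma chain_blocks:
  fixes I :: "'i set" and n :: nat
  assumes nsop: "\<not> SOP L \<MM> 3" and p: "invariant I p" and q: "invariant I q" and I: "small \<kappa> I"
    and pq: "\<And>c. morley I p M c \<longleftrightarrow> morley I q M c"
    and A: "A \<subseteq> univ \<MM>" "small \<kappa> A"
    and f: "\<And>j. f j ` A \<subseteq> univ \<MM>" "\<And>j. eqv (Inl ` A \<union> Inr ` M) (case_sum id id) (case_sum (f j) id)"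
    and s: "invariant {..<n} s"
    and g: "\<And>j. realizes \<MM> {..<n} (g j) (s \<restriction> (M \<union> (\<Union>i<j. f i ` A \<union> g i ` {..<n}) \<union> f j ` A))"
    and \<phi>: "\<phi> \<in> Fm L (Inl ` I \<union> Inr ` A)" "\<phi> \<in> p"
    and \<psi>: "\<psi> \<in> Fm L (Inl ` I \<union> Inr ` {..<n})" "\<And>j. ren (map_sum id (g j)) \<psi> \<in> q"
  shows "\<exists>c. morley I p M c \<and> (\<forall>k. \<forall>i<N. (\<forall>l\<le>i. holds \<MM> (case_sum (c (k * N + i)) (f l)) \<phi>) \<and>
    (\<forall>l. i < l \<and> l < N \<longrightarrow> holds \<MM> (case_sum (c (k * N + i)) (g l)) \<psi>))"
proof (induction N)
  case 0
  show ?case using morley_exists[OF p I M_univ M_small] by auto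
next
  case (Suc N)
  then obtain c where c1: "morley I p M c" and
    c23: "\<forall>k. \<forall>i<N. (\<forall>l\<le>i. holds \<MM> (case_sum (c (k * N + i)) (f l)) \<phi>) \<and>
      (\<forall>l. i < l \<and> l < N \<longrightarrow> holds \<MM> (case_sum (c (k * N + i)) (g l)) \<psi>)"
    by (elim exE conjE, intro that)
  have c2: "holds \<MM> (case_sum (c (k * N + i)) (f l)) \<phi>" if "i < N" "l \<le> i" for k i l
    using c23 that by blast
  have c3: "holds \<MM> (case_sum (c (k * N + i)) (g l)) \<psi>" if "i < l" "l < N" for k i l
    using c23 that less_trans[OF that] by blast
  note c = c1 c2 c3
  have sm: "small \<kappa> {..<n}" by (rule small_finite) simp
  have g_univ: "g j ` {..<n} \<subseteq> univ \<MM>" for j using g[of j] by (simp add: realizes_def)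
  define F1 where "F1 i l = ren (map_sum (Pair i) (f l)) \<phi>" for i l :: nat
  define F2 where "F2 i l = ren (map_sum (Pair i) (g l)) \<psi>" for i l :: nat
  have F1_iff: "holds \<MM> (case_sum (\<lambda>(i, x). d (a + i) x) id) (F1 i l) \<longleftrightarrow> holds \<MM> (case_sum (d (a + i)) (f l)) \<phi>"
    for d a i l unfolding F1_def holds_ren by (rule holds_cong) (simp add: map_sum_def split: sum.split)
  have F2_iff: "holds \<MM> (case_sum (\<lambda>(i, x). d (a + i) x) id) (F2 i l) \<longleftrightarrow> holds \<MM> (case_sum (d (a + i)) (g l)) \<psi>"
    for d a i l unfolding F2_def holds_ren by (rule holds_cong) (simp add: map_sum_def split: sum.split)
  have F1_Fm: "F1 i l \<in> Fm L (Inl ` ({..<N} \<times> I) \<union> Inr ` Z)" if "i < N" "f l ` A \<subseteq> Z" for i l Z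
    unfolding F1_def using \<phi>(1) by (rule ren_in_Fm) (use that in auto)
  have F2_Fm: "F2 i l \<in> Fm L (Inl ` ({..<N} \<times> I) \<union> Inr ` Z)" if "i < N" "g l ` {..<n} \<subseteq> Z" for i l Z
    unfolding F2_def using \<psi>(1) by (rule ren_in_Fm) (use that in auto)
  define Y where "Y = M \<union> (\<Union>l<N. f l ` A \<union> g l ` {..<n}) \<union> f N ` A"
  have Y: "Y \<subseteq> univ \<MM>" "small \<kappa> Y"
  proof -
    have "f l ` A \<union> g l ` {..<n} \<subseteq> univ \<MM>" for l by (rule Un_least[OF f(1) g_univ])
    then show "Y \<subseteq> univ \<MM>" unfolding Y_def by (rule Un_least[OF Un_least[OF M_univ UN_least] f(1)])
    have "small \<kappa> (f l ` A \<union> g l ` {..<n})" for l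
      by (rule small_Un[OF small_image[OF A(2)] small_image[OF sm]])
    then show "small \<kappa> Y"
      unfolding Y_def by (rule small_Un[OF small_Un[OF M_small small_UN_finite[OF finite_lessThan]] small_image[OF A(2)]])
  qed
  have fY: "f l ` A \<subseteq> Y" if "l \<le> N" for l
  proof (cases "l = N")
    case True
    then show ?thesis unfolding Y_def by simp
  next
    case False
    then have "l \<in> {..<N}" using that by simp
    then show ?thesis unfolding Y_def by blast
  qed
  have gY: "g l ` {..<n} \<subseteq> Y" if "l < N" for l using that unfolding Y_def by blast
  define \<Sigma> where "\<Sigma> = {F1 i l |i l. l \<le> i \<and> i < N} \<union> {F2 i l |i l. i < l \<and> l < N}"
  have \<Sigma>: "\<Sigma> \<subseteq> Fm L (Inl ` ({..<N} \<times> I) \<union> Inr ` Y)"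
  proof
    fix \<tau> assume "\<tau> \<in> \<Sigma>"
    then consider i l where "\<tau> = F1 i l" "l \<le> i" "i < N" | i l where "\<tau> = F2 i l" "i < l" "l < N"
      unfolding \<Sigma>_def by blast
    then show "\<tau> \<in> Fm L (Inl ` ({..<N} \<times> I) \<union> Inr ` Y)"
    proof cases
      case 1
      then have "l \<le> N" by simp
      then show ?thesis unfolding 1(1) by (rule F1_Fm[OF 1(3) fY])
    next
      case 2
      show ?thesis unfolding 2(1) by (rule F2_Fm[OF less_trans[OF 2(2,3)] gY[OF 2(3)]])
    qed
  qed
  have blocks: "holds \<MM> (case_sum (\<lambda>(i, x). c (k * N + i) x) id) \<tau>" if "\<tau> \<in> \<Sigma>" for k \<tau>
    using that c(2,3) unfolding \<Sigma>_def by (auto simp: F1_iff F2_iff)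
  have "M \<union> Y = Y" unfolding Y_def by blast
  then have gN: "realizes \<MM> {..<n} (g N) (s \<restriction> (M \<union> Y))" using g[of N] unfolding Y_def by simp
  have cq: "morley I q M c" using c(1) pq by blast
  from morley_absorb[OF nsop q I s sm order_refl M_univ M_small Y \<Sigma> cq blocks gN]
  obtain c1 where c1: "morley I q (M \<union> g N ` {..<n}) c1"
    "\<And>k \<tau>. \<tau> \<in> \<Sigma> \<Longrightarrow> holds \<MM> (case_sum (\<lambda>(i, x). c1 (k * N + i) x) id) \<tau>" by blast
  have c1p: "morley I p M c1" unfolding pq by (rule morley_mono[OF c1(1)]) simp
  have c1\<psi>: "holds \<MM> (case_sum (c1 t) (g N)) \<psi>" for t
  proof -
    have "M \<union> g N ` {..<n} \<subseteq> univ \<MM>" by (rule Un_least[OF M_univ g_univ])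
    moreover have "ren (map_sum id (g N)) \<psi> \<in> Fm L (Inl ` I \<union> Inr ` (M \<union> g N ` {..<n}))"
      by (rule Fm_mono[OF _ ren_map_sum_Fm[OF \<psi>(1)]]) auto
    ultimately have "holds \<MM> (case_sum (c1 t) id) (ren (map_sum id (g N)) \<psi>)"
      using realizes_iff[OF q morley_realizes[OF c1(1)]] \<psi>(2) by blast
    then show ?thesis unfolding holds_map_sum .
  qed
  define Y' where "Y' = Y \<union> g N ` {..<n}"
  have Y': "Y' \<subseteq> univ \<MM>" "small \<kappa> Y'"
    unfolding Y'_def by (rule Un_least[OF Y(1) g_univ], rule small_Un[OF Y(2) small_image[OF sm]])
  have YY': "Y \<subseteq> Y'" "g N ` {..<n} \<subseteq> Y'" unfolding Y'_def by auto
  define \<Sigma>' where "\<Sigma>' = \<Sigma> \<union> {F2 i N |i. i < N}"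
  have \<Sigma>': "\<Sigma>' \<subseteq> Fm L (Inl ` ({..<N} \<times> I) \<union> Inr ` Y')"
  proof -
    have "Inl ` ({..<N} \<times> I) \<union> Inr ` Y \<subseteq> Inl ` ({..<N} \<times> I) \<union> Inr ` Y'" using YY'(1) by blast
    from Fm_mono[OF this] have "\<Sigma> \<subseteq> Fm L (Inl ` ({..<N} \<times> I) \<union> Inr ` Y')" using \<Sigma> by blast
    then show ?thesis unfolding \<Sigma>'_def using F2_Fm[OF _ YY'(2)] by blast
  qed
  have blocks': "holds \<MM> (case_sum (\<lambda>(i, x). c1 (k * N + i) x) id) \<tau>" if "\<tau> \<in> \<Sigma>'" for k \<tau>
    using that c1(2) c1\<psi> unfolding \<Sigma>'_def by (auto simp: F2_iff)
  from morley_insert[OF nsop p I Y' \<Sigma>' c1p blocks']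
  obtain c2 where c2: "morley I p M c2"
    "\<And>k \<tau>. \<tau> \<in> \<Sigma>' \<Longrightarrow> holds \<MM> (case_sum (\<lambda>(i, x). c2 (k * Suc N + i) x) id) \<tau>"
    "\<And>k. realizes \<MM> I (c2 (k * Suc N + N)) (p \<restriction> Y')" by blast
  have last: "holds \<MM> (case_sum (c2 (k * Suc N + N)) (f l)) \<phi>" if "l \<le> N" for k l
  proof -
    have "ren (map_sum id (f l)) \<phi> \<in> p"
    proof (rule invariant_eqv_M[OF p \<phi>(1) _ f(1) f(2)])
      show "id ` A \<subseteq> univ \<MM>" using A(1) by simp
      show "ren (map_sum id id) \<phi> \<in> p" using \<phi>(2) by (simp add: map_sum.id ren_id)
    qed
    moreover have "ren (map_sum id (f l)) \<phi> \<in> Fm L (Inl ` I \<union> Inr ` Y')"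
      by (rule Fm_mono[OF _ ren_map_sum_Fm[OF \<phi>(1)]]) (use fY[OF that] YY'(1) in blast)
    ultimately have "holds \<MM> (case_sum (c2 (k * Suc N + N)) id) (ren (map_sum id (f l)) \<phi>)"
      using realizes_iff[OF p c2(3) Y'(1)] by blast
    then show ?thesis unfolding holds_map_sum .
  qed
  have earlier1: "holds \<MM> (case_sum (c2 (k * Suc N + i)) (f l)) \<phi>" if "i < N" "l \<le> i" for k i l
  proof -
    have "F1 i l \<in> \<Sigma>'" using that unfolding \<Sigma>'_def \<Sigma>_def by blast
    from c2(2)[OF this] show ?thesis unfolding F1_iff .
  qed
  have earlier2: "holds \<MM> (case_sum (c2 (k * Suc N + i)) (g l)) \<psi>" if "i < l" "l < Suc N" for k i l
  proof -
    have "F2 i l \<in> \<Sigma>'"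
    proof (cases "l = N")
      case True
      then show ?thesis using that unfolding \<Sigma>'_def by blast
    next
      case False
      then have "l < N" using that by simp
      then show ?thesis using that unfolding \<Sigma>'_def \<Sigma>_def by blast
    qed
    from c2(2)[OF this] show ?thesis unfolding F2_iff .
  qed
  have "holds \<MM> (case_sum (c2 (k * Suc N + i)) (f l)) \<phi>" if "i < Suc N" "l \<le> i" for k i l
    using that last[of l k] earlier1[of i l k] by (cases "i = N") auto
  then show ?case using c2(1) earlier2 by blast
qed

text \<open>For inconsistent \<open>\<phi>(x, A)\<close> and \<open>\<psi>(x, \<beta>)\<close>, the interleaved copies keep the inconsistency of \<open>f\<^sub>j\<close> with
  \<open>g\<^sub>i\<close> for \<open>i < j\<close>, while the blocks realize \<open>\<phi>(x, f\<^sub>l)\<close> and \<open>\<psi>(x, g\<^sub>m)\<close> together for \<open>l \<le> i < m\<close>.\<close>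

lemma amalgam_consistent:
  fixes I :: "'i set" and A B :: "'a set"
  assumes nsop: "\<not> SOP L \<MM> 3" and p: "invariant I p" and q: "invariant I q" and I: "small \<kappa> I"
    and pq: "\<And>c. morley I p M c \<longleftrightarrow> morley I q M c"
    and kim: "kim_indep L \<MM> M A id B" and A: "M \<subseteq> A" "A \<subseteq> univ \<MM>" "small \<kappa> A"
    and B: "B \<subseteq> univ \<MM>" "small \<kappa> B"
  shows "consistent \<MM> I (p \<restriction> A \<union> q \<restriction> B)"
proof (rule ccontr)
  assume "\<not> ?thesis"
  then obtain F where F: "finite F" "F \<subseteq> p \<restriction> A \<union> q \<restriction> B" "\<And>c. \<not> realizes \<MM> I c F"
    unfolding consistent_def by blast
  have "finite (F \<inter> p \<restriction> A)" "F \<inter> p \<restriction> A \<subseteq> Fm L (Inl ` I \<union> Inr ` A)" using F(1) restr_Fm[OF p] by blast+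
  from conj_fm[OF this] obtain \<phi> where \<phi>: "\<phi> \<in> Fm L (Inl ` I \<union> Inr ` A)"
    "\<forall>s. holds \<MM> s \<phi> \<longleftrightarrow> (\<forall>\<tau>\<in>F \<inter> p \<restriction> A. holds \<MM> s \<tau>)" by (elim bexE, intro that)
  have "finite (F \<inter> q \<restriction> B)" "F \<inter> q \<restriction> B \<subseteq> Fm L (Inl ` I \<union> Inr ` B)" using F(1) restr_Fm[OF q] by blast+
  from conj_fm[OF this] obtain \<psi>0 where \<psi>0: "\<psi>0 \<in> Fm L (Inl ` I \<union> Inr ` B)"
    "\<forall>s. holds \<MM> s \<psi>0 \<longleftrightarrow> (\<forall>\<tau>\<in>F \<inter> q \<restriction> B. holds \<MM> s \<tau>)" by (elim bexE, intro that)
  have incon: "\<not> (holds \<MM> (case_sum x id) \<phi> \<and> holds \<MM> (case_sum x id) \<psi>0)" if "x ` I \<subseteq> univ \<MM>" for x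
  proof
    assume "holds \<MM> (case_sum x id) \<phi> \<and> holds \<MM> (case_sum x id) \<psi>0"
    then have "\<forall>\<tau>\<in>F. holds \<MM> (case_sum x id) \<tau>" using F(2) \<phi>(2) \<psi>0(2) by blast
    then show False using F(3) that unfolding realizes_def by blast
  qed
  have \<phi>p: "\<phi> \<in> p"
  proof -
    obtain c where c: "realizes \<MM> I c (p \<restriction> A)" using realizes_exists[OF p I A(2,3)] by blast
    then have "holds \<MM> (case_sum c id) \<phi>" unfolding \<phi>(2)[rule_format] realizes_def by blast
    then show ?thesis using realizes_iff[OF p c A(2) \<phi>(1)] by blast
  qed
  have \<psi>q: "\<psi>0 \<in> q"
  proof -
    obtain c where c: "realizes \<MM> I c (q \<restriction> B)" using realizes_exists[OF q I B] by blast
    then have "holds \<MM> (case_sum c id) \<psi>0" unfolding \<psi>0(2)[rule_format] realizes_def by blast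
    then show ?thesis using realizes_iff[OF q c B(1) \<psi>0(1)] by blast
  qed
  define V0 where "V0 = {m. Inr m \<in> fv \<psi>0}"
  have "finite (Inr -` fv \<psi>0)" by (intro finite_vimageI finite_fv) auto
  then have "finite V0" by (simp add: vimage_def V0_def)
  then obtain \<beta> n where \<beta>: "bij_betw \<beta> {..<n :: nat} V0"
    using ex_bij_betw_nat_finite[of V0] by (auto simp: atLeast0LessThan)
  have "V0 \<subseteq> B" using FmD[OF \<psi>0(1)] by (auto simp: V0_def)
  then have \<beta>B: "\<beta> ` {..<n} \<subseteq> B" using \<beta> by (simp add: bij_betw_def)
  have "fv \<psi>0 \<subseteq> map_sum id \<beta> ` (Inl ` I \<union> Inr ` {..<n})"
  proof -
    have eq: "map_sum id \<beta> ` (Inl ` I \<union> Inr ` {..<n}) = Inl ` I \<union> Inr ` V0"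
      using \<beta> by (simp add: image_Un image_image bij_betw_def flip: image_image[of Inr \<beta>])
    have "v \<in> Inl ` I \<union> Inr ` V0" if "v \<in> fv \<psi>0" for v
      using that FmD[OF \<psi>0(1)] by (cases v) (auto simp: V0_def)
    then show ?thesis unfolding eq by (rule subsetI)
  qed
  then obtain \<psi> where \<psi>: "\<psi> \<in> Fm L (Inl ` I \<union> Inr ` {..<n})" "ren (map_sum id \<beta>) \<psi> = \<psi>0"
    by (rule ren_preimage[OF Fm_fv[OF \<psi>0(1)]])
  let ?l = "ren (map_sum id Inl) \<phi> :: ('f, 'r, 'i + 'a + nat) fm"
  let ?r = "ren (map_sum id Inr) \<psi> :: ('f, 'r, 'i + 'a + nat) fm"
  have "?l \<in> Fm L (Inl ` I \<union> Inr ` (Inl ` A \<union> Inr ` {..<n}))" using \<phi>(1) by (rule ren_in_Fm) auto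
  moreover have "?r \<in> Fm L (Inl ` I \<union> Inr ` (Inl ` A \<union> Inr ` {..<n}))" using \<psi>(1) by (rule ren_in_Fm) auto
  ultimately have "And ?l ?r \<in> Fm L (Inl ` I \<union> Inr ` (Inl ` A \<union> Inr ` {..<n}))" by (simp add: And_Fm)
  from ex_fm[OF this] obtain \<chi>0 where \<chi>0: "\<chi>0 \<in> Fm L (Inl ` A \<union> Inr ` {..<n})"
    "\<forall>s. holds \<MM> s \<chi>0 \<longleftrightarrow> (\<exists>x. x ` I \<subseteq> univ \<MM> \<and> holds \<MM> (case_sum x s) (And ?l ?r))"
    by (elim bexE, intro that)
  have l_iff: "holds \<MM> (case_sum x (case_sum y z)) ?l \<longleftrightarrow> holds \<MM> (case_sum x y) \<phi>" for x y z
    unfolding holds_ren by (rule holds_cong) (simp add: map_sum_def split: sum.split)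
  have r_iff: "holds \<MM> (case_sum x (case_sum y z)) ?r \<longleftrightarrow> holds \<MM> (case_sum x z) \<psi>" for x y z
    unfolding holds_ren by (rule holds_cong) (simp add: map_sum_def split: sum.split)
  define \<chi> where "\<chi> = Neg \<chi>0"
  have \<chi>: "\<chi> \<in> Fm L (Inl ` A \<union> Inr ` {..<n})" using \<chi>0(1) by (simp add: \<chi>_def Neg_Fm)
  have \<chi>_iff: "holds \<MM> (case_sum y z) \<chi> \<longleftrightarrow>
      (\<forall>x. x ` I \<subseteq> univ \<MM> \<longrightarrow> \<not> (holds \<MM> (case_sum x y) \<phi> \<and> holds \<MM> (case_sum x z) \<psi>))" for y z
    unfolding \<chi>_def holds_Neg \<chi>0(2)[rule_format] holds_And l_iff r_iff by blast
  have \<psi>\<beta>: "holds \<MM> (case_sum x \<beta>) \<psi> \<longleftrightarrow> holds \<MM> (case_sum x id) \<psi>0" for x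
    unfolding \<psi>(2)[symmetric] holds_map_sum ..
  have \<chi>\<beta>: "holds \<MM> (case_sum id \<beta>) \<chi>" unfolding \<chi>_iff \<psi>\<beta> using incon by blast
  have "\<beta> ` {..<n} \<subseteq> univ \<MM>" using \<beta>B B(1) by blast
  from coheir_exists[OF this] obtain s where s: "invariant {..<n} s" "realizes \<MM> {..<n} \<beta> (s \<restriction> M)" by blast
  from interleaved_copies[OF kim A s \<beta>B B(1) \<chi> \<chi>\<beta>] obtain f g where
    fg_all: "\<forall>j :: nat. f j ` A \<subseteq> univ \<MM> \<and> eqv (Inl ` A \<union> Inr ` M) (case_sum id id) (case_sum (f j) id) \<and>
      (\<forall>i<j. holds \<MM> (case_sum (f j) (g i)) \<chi>) \<and>
      realizes \<MM> {..<n} (g j) (s \<restriction> (M \<union> (\<Union>i<j. f i ` A \<union> g i ` {..<n}) \<union> f j ` A))"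
    by (elim exE, intro that)
  have f: "f j ` A \<subseteq> univ \<MM>" "eqv (Inl ` A \<union> Inr ` M) (case_sum id id) (case_sum (f j) id)"
    and g: "realizes \<MM> {..<n} (g j) (s \<restriction> (M \<union> (\<Union>i<j. f i ` A \<union> g i ` {..<n}) \<union> f j ` A))" for j
    using spec[OF fg_all, of j] by blast+
  have fg: "holds \<MM> (case_sum (f j) (g i)) \<chi>" if "i < j" for i j
    using spec[OF fg_all, of j] that by blast
  have g_univ: "g j ` {..<n} \<subseteq> univ \<MM>" for j using g[of j] by (simp add: realizes_def)
  have \<psi>g: "ren (map_sum id (g j)) \<psi> \<in> q" for j
  proof (rule invariant_eqv_M[OF q \<psi>(1)])
    show "\<beta> ` {..<n} \<subseteq> univ \<MM>" using \<beta>B B(1) by blast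
    show "g j ` {..<n} \<subseteq> univ \<MM>" by (rule g_univ)
    have "realizes \<MM> {..<n} (g j) (s \<restriction> M)"
      by (rule realizes_restr_mono[OF g subset_trans[OF Un_upper1 Un_upper1]])
    then show "eqv (Inl ` {..<n} \<union> Inr ` M) (case_sum \<beta> id) (case_sum (g j) id)"
      using eqv_realizes[OF s(1) eqv_refl names_M_id[OF order_refl], of \<beta> "g j"] M_univ s(2) by simp
    show "ren (map_sum id \<beta>) \<psi> \<in> q" using \<psi>q \<psi>(2) by simp
  qed
  note chain = chain_blocks[OF nsop p q I pq A(2,3) f s(1) g \<phi>(1) \<phi>p \<psi>(1) \<psi>g]
  let ?Y = "Inl ` (UNIV \<times> A) \<union> Inr ` (UNIV \<times> {..<n}) :: ((nat \<times> 'a) + (nat \<times> nat)) set"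
  let ?t = "case_sum (case_prod f) (case_prod g)"
  define F1 :: "nat \<Rightarrow> nat \<Rightarrow> ('f, 'r, (nat \<times> 'i) + (nat \<times> 'a) + (nat \<times> nat)) fm" where
    "F1 i l = ren (map_sum (Pair i) (\<lambda>y. Inl (l, y))) \<phi>" for i l
  define F2 :: "nat \<Rightarrow> nat \<Rightarrow> ('f, 'r, (nat \<times> 'i) + (nat \<times> 'a) + (nat \<times> nat)) fm" where
    "F2 i l = ren (map_sum (Pair i) (\<lambda>y. Inr (l, y))) \<psi>" for i l
  have F1_iff: "holds \<MM> (case_sum w ?t) (F1 i l) \<longleftrightarrow> holds \<MM> (case_sum (\<lambda>x. w (i, x)) (f l)) \<phi>" for w i l
    unfolding F1_def holds_ren by (rule holds_cong) (simp add: map_sum_def split: sum.split)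
  have F2_iff: "holds \<MM> (case_sum w ?t) (F2 i l) \<longleftrightarrow> holds \<MM> (case_sum (\<lambda>x. w (i, x)) (g l)) \<psi>" for w i l
    unfolding F2_def holds_ren by (rule holds_cong) (simp add: map_sum_def split: sum.split)
  define \<Gamma> where "\<Gamma> N = {F1 i l |i l. l \<le> i \<and> i < N} \<union> {F2 i l |i l. i < l \<and> l < N}" for N
  have "F1 i l \<in> Fm L (Inl ` seq_names I \<union> Inr ` ?Y)" for i l
    unfolding F1_def using \<phi>(1) by (rule ren_in_Fm) auto
  moreover have "F2 i l \<in> Fm L (Inl ` seq_names I \<union> Inr ` ?Y)" for i l
    unfolding F2_def using \<psi>(1) by (rule ren_in_Fm) auto
  ultimately have \<Gamma>_Fm: "(\<Union>N. \<Gamma> N) \<subseteq> Fm L (Inl ` seq_names I \<union> Inr ` ?Y)" unfolding \<Gamma>_def by blast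
  have \<Gamma>_mono: "\<Gamma> N \<subseteq> \<Gamma> N'" if "N \<le> N'" for N N'
    unfolding \<Gamma>_def using less_le_trans[OF _ that] by blast
  have t_eq: "?t ` ?Y = case_prod f ` (UNIV \<times> A) \<union> case_prod g ` (UNIV \<times> {..<n})"
    by (simp add: image_Un image_image)
  have t_univ: "?t ` ?Y \<subseteq> univ \<MM>" unfolding t_eq using f(1) g_univ by (auto simp: image_subset_iff)
  have t_small: "small \<kappa> (?t ` ?Y)"
    unfolding t_eq
    by (rule small_Un[OF small_image[OF small_Times_nat[OF A(3)]]
          small_image[OF small_Times_nat[OF small_finite[OF finite_lessThan]]]])
  have fin: "\<exists>w. w ` seq_names I \<subseteq> univ \<MM> \<and> (\<forall>\<tau>\<in>S. holds \<MM> (case_sum w ?t) \<tau>)"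
    if S: "finite S" "S \<subseteq> (\<Union>N. \<Gamma> N)" for S
  proof -
    obtain N where N: "S \<subseteq> \<Gamma> N" using finite_subset_increasing_UN[OF S \<Gamma>_mono] by blast
    obtain c where c: "morley I p M c"
      "\<And>i l. i < N \<Longrightarrow> l \<le> i \<Longrightarrow> holds \<MM> (case_sum (c i) (f l)) \<phi>"
      "\<And>i l. i < l \<Longrightarrow> l < N \<Longrightarrow> holds \<MM> (case_sum (c i) (g l)) \<psi>"
    proof -
      obtain c where c: "morley I p M c" "\<forall>k. \<forall>i<N. (\<forall>l\<le>i. holds \<MM> (case_sum (c (k * N + i)) (f l)) \<phi>) \<and>
          (\<forall>l. i < l \<and> l < N \<longrightarrow> holds \<MM> (case_sum (c (k * N + i)) (g l)) \<psi>)" using chain[of N] by blast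
      show thesis
      proof (rule that[OF c(1)])
        show "holds \<MM> (case_sum (c i) (f l)) \<phi>" if "i < N" "l \<le> i" for i l
          using c(2)[rule_format, of i 0] that by simp
        show "holds \<MM> (case_sum (c i) (g l)) \<psi>" if "i < l" "l < N" for i l
          using c(2)[rule_format, of i 0] that by simp
      qed
    qed
    have "holds \<MM> (case_sum (case_prod c) ?t) \<tau>" if "\<tau> \<in> \<Gamma> N" for \<tau>
      using that c(2,3) unfolding \<Gamma>_def by (auto simp: F1_iff F2_iff)
    moreover have "case_prod c ` seq_names I \<subseteq> univ \<MM>" using morley_univ[OF c(1)] by auto
    ultimately show ?thesis using N by blast
  qed
  obtain w where w: "w ` seq_names I \<subseteq> univ \<MM>" "\<And>\<tau>. \<tau> \<in> (\<Union>N. \<Gamma> N) \<Longrightarrow> holds \<MM> (case_sum w ?t) \<tau>"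
    using saturation[OF \<Gamma>_Fm fin small_Times_nat[OF I] t_univ t_small] by blast
  have w\<phi>: "holds \<MM> (case_sum (\<lambda>x. w (i, x)) (f l)) \<phi>" if "l \<le> i" for i l
  proof -
    have "F1 i l \<in> \<Gamma> (Suc i)" using that unfolding \<Gamma>_def by blast
    then have "F1 i l \<in> (\<Union>N. \<Gamma> N)" by (rule UN_I[OF UNIV_I])
    from w(2)[OF this] show ?thesis unfolding F1_iff .
  qed
  have w\<psi>: "holds \<MM> (case_sum (\<lambda>x. w (i, x)) (g l)) \<psi>" if "i < l" for i l
  proof -
    have "F2 i l \<in> \<Gamma> (Suc l)" using that unfolding \<Gamma>_def by blast
    then have "F2 i l \<in> (\<Union>N. \<Gamma> N)" by (rule UN_I[OF UNIV_I])
    from w(2)[OF this] show ?thesis unfolding F2_iff .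
  qed
  have "SOP L \<MM> 3"
  proof (rule SOP3_criterion[OF \<psi>(1) \<phi>(1), where u = "\<lambda>i x. w (i, x)" and v = g and w = f])
    show "(\<lambda>x. w (i, x)) ` I \<subseteq> univ \<MM>" for i using w(1) by auto
    fix i j :: nat assume ij: "i < j"
    show "holds \<MM> (case_sum (\<lambda>x. w (i, x)) (g j)) \<psi>" using w\<psi>[OF ij] .
    show "holds \<MM> (case_sum (\<lambda>x. w (j, x)) (f i)) \<phi>" using w\<phi>[of i j] ij by simp
    fix x assume "x ` I \<subseteq> univ \<MM>" "holds \<MM> (case_sum x (g i)) \<psi>"
    then show "\<not> holds \<MM> (case_sum x (f j)) \<phi>" using fg[OF ij] unfolding \<chi>_iff by blast
  qed (use g_univ f(1) in blast)+
  then show False using nsop by blast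
qed

end

section \<open>Passing to the whole Morley sequence\<close>

context saturated_over_model
begin

lemma omega_power_iff:
  assumes "is_omega_power L \<kappa> \<MM> M I p p\<omega>" "M \<subseteq> A" "A \<subseteq> univ \<MM>" "small \<kappa> A"
  shows "realizes \<MM> (seq_names I) (case_prod c) (p\<omega> \<restriction> A) \<longleftrightarrow> morley I p A c"
  using assms unfolding is_omega_power_def by blast

text \<open>A Morley sequence of \<open>p\<^sup>\<omega>\<close> is a Morley sequence of \<open>p\<close> of order type \<open>\<omega> \<cdot> \<omega>\<close>. Each formula
  sees finitely many of its members, and these form a beginning of a Morley sequence of order
  type \<open>\<omega>\<close>, for which \<open>p\<close> and \<open>q\<close> cannot be distinguished over \<open>M\<close>.\<close>

lemma omega_power_morley:
  fixes I :: "'i set"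
  assumes I: "small \<kappa> I" and q: "invariant I q"
    and p\<omega>: "is_omega_power L \<kappa> \<MM> M I p p\<omega>" and q\<omega>: "is_omega_power L \<kappa> \<MM> M I q q\<omega>"
    and pq: "\<And>c. morley I p M c \<Longrightarrow> morley I q M c"
    and e: "morley (seq_names I) p\<omega> M e"
  shows "morley (seq_names I) q\<omega> M e"
proof -
  define A where "A k = M \<union> (\<Union>j<k. e j ` seq_names I)" for k
  have A: "M \<subseteq> A k" "A k \<subseteq> univ \<MM>" "small \<kappa> (A k)" for k
    unfolding A_def by (rule Un_upper1, rule prefix_univ[OF M_univ morley_univ[OF e]],
      rule small_Un[OF M_small small_prefix[OF small_Times_nat[OF I]]])
  define d where "d k i x = e k (i, x)" for k i x
  have d_e: "case_prod (d k) = e k" for k by (auto simp: d_def)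
  have dA: "d j t ` I \<subseteq> A k" if "j < k" for j t k
  proof -
    have "d j t ` I \<subseteq> e j ` seq_names I" unfolding d_def by auto
    moreover have "e j ` seq_names I \<subseteq> (\<Union>j<k. e j ` seq_names I)" using that by (intro UN_upper) simp
    ultimately show ?thesis unfolding A_def by (meson le_supI2 order_trans)
  qed
  have dp: "morley I p (A k) (d k)" for k
    using morleyD[OF e, of k] omega_power_iff[OF p\<omega> A[of k], of "d k"] unfolding d_e A_def by blast
  have "morley I q (A k) (d k)" for k
  proof (rule morleyI)
    fix i
    have "holds \<MM> (case_sum (d k i) id) \<phi>" if \<phi>: "\<phi> \<in> q \<restriction> (A k \<union> (\<Union>r<i. d k r ` I))" for \<phi>
    proof -
      have \<phi>Fm: "\<phi> \<in> Fm L (Inl ` I \<union> Inr ` (A k \<union> (\<Union>r<i. d k r ` I)))" using restr_Fm[OF q] \<phi> by blast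
      define S where "S = {m. Inr m \<in> fv \<phi>}"
      have "finite (Inr -` fv \<phi>)" by (intro finite_vimageI finite_fv) auto
      then have S: "finite S" by (simp add: vimage_def S_def)
      define D where "D N = M \<union> (\<Union>j<k. \<Union>t<Suc N. d j t ` I) \<union> (\<Union>r<i. d k r ` I)" for N
      have "S \<subseteq> (\<Union>N. D N)"
      proof
        fix m assume "m \<in> S"
        then have "m \<in> A k \<union> (\<Union>r<i. d k r ` I)" using FmD[OF \<phi>Fm] by (auto simp: S_def)
        then consider "m \<in> M \<union> (\<Union>r<i. d k r ` I)" | j t x where "j < k" "x \<in> I" "m = d j t x"
          unfolding A_def d_def by auto
        then show "m \<in> (\<Union>N. D N)"
        proof cases
          case 1
          then show ?thesis unfolding D_def by blast
        next
          case 2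
          have "m \<in> (\<Union>t'<Suc t. d j t' ` I)" using 2 by (intro UN_I[of t]) auto
          then have "m \<in> D t" unfolding D_def using 2(1) by blast
          then show ?thesis by (rule UN_I[OF UNIV_I])
        qed
      qed
      moreover have "D N \<subseteq> D N'" if "N \<le> N'" for N N'
      proof -
        have "{..<Suc N} \<subseteq> {..<Suc N'}" using that by simp
        then show ?thesis unfolding D_def by (intro Un_mono order_refl UN_mono)
      qed
      ultimately obtain N where N: "S \<subseteq> D N" using finite_subset_increasing_UN[OF S] by blast
      define n where "n = Suc N"
      have n: "0 < n" by (simp add: n_def)
      define c where "c t = (if t < k * n then d (t div n) (t mod n) else d k (t - k * n))" for t
      have div_less: "t div n < k" if "t < k * n" for t using that by (rule less_mult_imp_div_less)
      have "morley I p M c"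
        unfolding c_def
      proof (rule morley_append)
        fix t assume t: "t < k * n"
        have "d (t' div n) (t' mod n) ` I \<subseteq> A (t div n) \<union> (\<Union>r<t mod n. d (t div n) r ` I)" if "t' \<in> {..<t}" for t'
        proof -
          have t': "t' < t" using that by simp
          then have "t' div n \<le> t div n" by (simp add: div_le_mono)
          then consider "t' div n < t div n" | "t' div n = t div n" by linarith
          then show ?thesis
          proof cases
            case 1
            then show ?thesis by (intro le_supI1 dA)
          next
            case 2
            have "n * (t' div n) + t' mod n = t'" "n * (t div n) + t mod n = t" by simp_all
            then have "t' mod n < t mod n" using 2 t' by (metis add_less_cancel_left)
            then show ?thesis unfolding 2 by (intro le_supI2 UN_upper) simp
          qed
        qed
        then have "M \<union> (\<Union>t'<t. d (t' div n) (t' mod n) ` I) \<subseteq> A (t div n) \<union> (\<Union>r<t mod n. d (t div n) r ` I)"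
          by (rule Un_least[OF le_supI1[OF A(1)] UN_least])
        then show "realizes \<MM> I (d (t div n) (t mod n)) (p \<restriction> (M \<union> (\<Union>t'<t. d (t' div n) (t' mod n) ` I)))"
          by (rule realizes_restr_mono[OF morleyD[OF dp]])
      next
        have "d (t div n) (t mod n) ` I \<subseteq> A k" if "t \<in> {..<k * n}" for t
          using that by (intro dA div_less) simp
        then have "M \<union> (\<Union>t<k * n. d (t div n) (t mod n) ` I) \<subseteq> A k" by (rule Un_least[OF A(1) UN_least])
        then show "morley I p (M \<union> (\<Union>t<k * n. d (t div n) (t mod n) ` I)) (d k)" by (rule morley_mono[OF dp])
      qed
      then have cq: "morley I q M c" by (rule pq)
      have ck: "c (k * n + r) = d k r" for r by (simp add: c_def)
      have D_sub: "D N \<subseteq> M \<union> (\<Union>t<k * n + i. c t ` I)"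
      proof -
        have sub1: "d j t ` I \<subseteq> (\<Union>t<k * n + i. c t ` I)" if "j \<in> {..<k}" "t \<in> {..<Suc N}" for j t
        proof -
          have t: "t < n" using that(2) by (simp add: n_def)
          have "j * n + t < Suc j * n" using t by simp
          also have "\<dots> \<le> k * n" using that(1) by (intro mult_le_mono1) simp
          finally have less: "j * n + t < k * n" .
          then have "c (j * n + t) = d j t" using t by (simp add: c_def)
          moreover have "j * n + t \<in> {..<k * n + i}" using less by simp
          ultimately show ?thesis by (metis UN_upper)
        qed
        have sub2: "d k r ` I \<subseteq> (\<Union>t<k * n + i. c t ` I)" if "r \<in> {..<i}" for r
        proof -
          have "k * n + r \<in> {..<k * n + i}" using that by simp
          from UN_upper[OF this, of "\<lambda>t. c t ` I"] show ?thesis unfolding ck .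
        qed
        show ?thesis
          unfolding D_def
          by (rule Un_least[OF Un_least[OF Un_upper1 le_supI2] le_supI2]) (intro UN_least sub1 sub2, assumption+)+
      qed
      have "\<phi> \<in> Fm L (Inl ` I \<union> Inr ` (M \<union> (\<Union>t<k * n + i. c t ` I)))"
      proof (rule Fm_mono[OF _ Fm_fv[OF \<phi>Fm]], rule subsetI)
        fix v assume v: "v \<in> fv \<phi>"
        show "v \<in> Inl ` I \<union> Inr ` (M \<union> (\<Union>t<k * n + i. c t ` I))"
        proof (cases v)
          case (Inl x)
          then show ?thesis using FmD[OF \<phi>Fm] v by auto
        next
          case (Inr m)
          then have "m \<in> S" using v by (simp add: S_def)
          then have "m \<in> M \<union> (\<Union>t<k * n + i. c t ` I)" using N D_sub by blast
          then show ?thesis unfolding Inr by (rule UnI2[OF imageI])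
        qed
      qed
      then have "\<phi> \<in> q \<restriction> (M \<union> (\<Union>t<k * n + i. c t ` I))" using \<phi> by (intro in_restr) (simp_all add: restr_def)
      then have "holds \<MM> (case_sum (c (k * n + i)) id) \<phi>"
        using morleyD[OF cq, of "k * n + i"] unfolding realizes_def by blast
      then show ?thesis unfolding ck .
    qed
    then show "realizes \<MM> I (d k i) (q \<restriction> (A k \<union> (\<Union>r<i. d k r ` I)))"
      using morley_univ[OF dp, of k i] unfolding realizes_def by blast
  qed
  then have "realizes \<MM> (seq_names I) (e k) (q\<omega> \<restriction> A k)" for k
    using omega_power_iff[OF q\<omega> A[of k], of "d k"] unfolding d_e by blast
  then show ?thesis unfolding A_def by (rule morleyI)
qed

text \<open>Among infinitely many realizations of a partial type, infinitely many agree on any finite set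
  of formulas; a type that is maximal with this property is complete.\<close>

lemma morley_thin:
  fixes I :: "'i set"
  assumes p: "invariant I p" and I: "small \<kappa> I" and D: "M \<subseteq> D" "D \<subseteq> univ \<MM>" "small \<kappa> D"
    and c: "morley I p M c" and \<Phi>: "\<Phi> \<subseteq> Fm L (Inl ` I \<union> Inr ` D)"
    and c\<Phi>: "\<And>k \<phi>. \<phi> \<in> \<Phi> \<Longrightarrow> holds \<MM> (case_sum (c k) id) \<phi>"
  shows "\<exists>c'. morley I p M c' \<and> (\<forall>k. \<forall>\<phi>\<in>\<Phi>. holds \<MM> (case_sum (c' k) id) \<phi>) \<and>
    (\<forall>k. eqv (Inl ` I \<union> Inr ` D) (case_sum (c' 0) id) (case_sum (c' k) id))"
proof -
  let ?W = "Fm L (Inl ` I \<union> Inr ` D)"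
  define K where "K F = {k. \<forall>\<phi>\<in>F. holds \<MM> (case_sum (c k) id) \<phi>}" for F
  have K_mono: "K F' \<subseteq> K F" if "F \<subseteq> F'" for F F' using that unfolding K_def by blast
  have mono: "\<forall>F F'. infinite (K F') \<and> F \<subseteq> F' \<longrightarrow> infinite (K F)" using K_mono finite_subset by metis
  have fin: "\<forall>F. finite F \<and> F \<subseteq> \<Phi> \<longrightarrow> infinite (K F)"
  proof (intro allI impI)
    fix F assume "finite F \<and> F \<subseteq> \<Phi>"
    then have "K F = UNIV" unfolding K_def using c\<Phi> by blast
    then show "infinite (K F)" by simp
  qed
  obtain t where t: "\<Phi> \<subseteq> t" "t \<subseteq> ?W" "\<forall>F. finite F \<and> F \<subseteq> t \<longrightarrow> infinite (K F)"
    "\<forall>\<phi>\<in>?W. \<phi> \<notin> t \<longrightarrow> (\<exists>F. finite F \<and> F \<subseteq> t \<and> \<not> infinite (K (insert \<phi> F)))"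
    using tukey[OF mono \<Phi> fin] by (elim exE conjE, intro that)
  have complete: "\<phi> \<in> t \<or> Neg \<phi> \<in> t" if \<phi>: "\<phi> \<in> ?W" for \<phi>
  proof (rule ccontr)
    assume "\<not> ?thesis"
    then have n: "\<phi> \<notin> t" "Neg \<phi> \<notin> t" by auto
    obtain F where F: "finite F" "F \<subseteq> t" "finite (K (insert \<phi> F))" using t(4) \<phi> n(1) by meson
    have "Neg \<phi> \<in> ?W" using \<phi> by (simp add: Neg_Fm)
    then obtain F' where F': "finite F'" "F' \<subseteq> t" "finite (K (insert (Neg \<phi>) F'))" using t(4) n(2) by meson
    have "K (F \<union> F') \<subseteq> K (insert \<phi> F) \<union> K (insert (Neg \<phi>) F')"
      unfolding K_def by (auto simp: holds_Neg)
    then have "finite (K (F \<union> F'))" using F(3) F'(3) by (meson finite_UnI finite_subset)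
    moreover have "finite (F \<union> F')" "F \<union> F' \<subseteq> t" using F F' by auto
    ultimately show False using t(3) by blast
  qed
  define T where "T = {\<theta> \<in> Fm L (Inl ` seq_names I \<union> Inr ` M). holds \<MM> (case_sum (case_prod c) id) \<theta>}"
  define at where "at k \<phi> = ren (map_sum (Pair k) id) \<phi>" for k :: nat and \<phi> :: "('f, 'r, 'i + 'a) fm"
  have at_iff: "holds \<MM> (case_sum w id) (at k \<phi>) \<longleftrightarrow> holds \<MM> (case_sum (\<lambda>x. w (k, x)) id) \<phi>" for w k \<phi>
    unfolding at_def holds_ren by (rule holds_cong) (simp add: map_sum_def split: sum.split)
  define \<Gamma> where "\<Gamma> = T \<union> (\<lambda>(k, \<phi>). at k \<phi>) ` (UNIV \<times> t)"
  have \<Gamma>: "\<Gamma> \<subseteq> Fm L (Inl ` seq_names I \<union> Inr ` D)"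
  proof -
    have "Inl ` seq_names I \<union> Inr ` M \<subseteq> Inl ` seq_names I \<union> Inr ` D"
      by (rule Un_mono[OF order_refl image_mono[OF D(1)]])
    from Fm_mono[OF this] have "T \<subseteq> Fm L (Inl ` seq_names I \<union> Inr ` D)" unfolding T_def by blast
    moreover have "at k \<phi> \<in> Fm L (Inl ` seq_names I \<union> Inr ` D)" if "\<phi> \<in> t" for k \<phi>
      unfolding at_def using subsetD[OF t(2) that] by (rule ren_in_Fm) auto
    ultimately show ?thesis unfolding \<Gamma>_def by auto
  qed
  have fin\<Gamma>: "\<exists>w. w ` seq_names I \<subseteq> univ \<MM> \<and> (\<forall>\<phi>\<in>F. holds \<MM> (case_sum w id) \<phi>)"
    if F: "finite F" "F \<subseteq> \<Gamma>" for F
  proof -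
    let ?at = "(\<lambda>(k, \<phi>). at k \<phi>) ` (UNIV \<times> t)"
    have "finite (F \<inter> ?at)" "F \<inter> ?at \<subseteq> ?at" using F(1) by auto
    then obtain X where X: "X \<subseteq> UNIV \<times> t" "finite X" "F \<inter> ?at = (\<lambda>(k, \<phi>). at k \<phi>) ` X"
      by (meson finite_subset_image)
    have "finite (snd ` X)" "snd ` X \<subseteq> t" using X by auto
    then have "infinite (K (snd ` X))" using t(3) by blast
    then obtain r :: "nat \<Rightarrow> nat" where r: "strict_mono r" "\<forall>k. r k \<in> K (snd ` X)"
      using infinite_enumerate by blast
    have cr: "morley I p M (c \<circ> r)" by (rule morley_subseq[OF c r(1)])
    have eq: "eqv (Inl ` seq_names I \<union> Inr ` M) (case_sum (case_prod c) id) (case_sum (case_prod (c \<circ> r)) id)"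
      using eqv_morley[OF p eqv_refl names_M_id[OF order_refl], of c "c \<circ> r"] M_univ c cr by simp
    have "holds \<MM> (case_sum (case_prod (c \<circ> r)) id) \<phi>" if "\<phi> \<in> F" for \<phi>
    proof -
      have "\<phi> \<in> T \<or> \<phi> \<in> F \<inter> ?at" using that F(2) unfolding \<Gamma>_def by blast
      then show ?thesis
      proof
        assume "\<phi> \<in> T"
        then show ?thesis using eqvD[OF eq] unfolding T_def by blast
      next
        assume "\<phi> \<in> F \<inter> ?at"
        then obtain k \<tau> where k: "(k, \<tau>) \<in> X" "\<phi> = at k \<tau>" unfolding X(3) by auto
        have "\<tau> \<in> snd ` X" using imageI[OF k(1), of snd] by simp
        then have "holds \<MM> (case_sum (c (r k)) id) \<tau>" using r(2) unfolding K_def by blast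
        then show ?thesis unfolding k(2) at_iff by simp
      qed
    qed
    moreover have "case_prod (c \<circ> r) ` seq_names I \<subseteq> univ \<MM>"
      using morley_univ[OF cr] by (auto simp: image_subset_iff)
    ultimately show ?thesis by blast
  qed
  have D': "id ` D \<subseteq> univ \<MM>" "small \<kappa> (id ` D)" using D by simp_all
  obtain w where w: "w ` seq_names I \<subseteq> univ \<MM>" "\<And>\<phi>. \<phi> \<in> \<Gamma> \<Longrightarrow> holds \<MM> (case_sum w id) \<phi>"
    using saturation[OF \<Gamma> fin\<Gamma> small_Times_nat[OF I] D'] by blast
  define c' where "c' k x = w (k, x)" for k x
  have w_c': "w = case_prod c'" by (auto simp: c'_def)
  have c'_univ: "c' k ` I \<subseteq> univ \<MM>" for k using w(1) by (auto simp: c'_def)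
  have wT: "holds \<MM> (case_sum w id) \<theta>" if "\<theta> \<in> T" for \<theta>
    using that unfolding \<Gamma>_def by (intro w(2)) (simp add: \<Gamma>_def)
  have wt: "holds \<MM> (case_sum (c' k) id) \<phi>" if "\<phi> \<in> t" for k \<phi>
  proof -
    have "(k, \<phi>) \<in> UNIV \<times> t" using that by simp
    from imageI[OF this, of "\<lambda>(k, \<phi>). at k \<phi>"] have "at k \<phi> \<in> \<Gamma>" unfolding \<Gamma>_def by simp
    from w(2)[OF this] show ?thesis unfolding at_iff by (simp add: w_c')
  qed
  have "eqv (Inl ` seq_names I \<union> Inr ` M) (case_sum (case_prod c) id) (case_sum (case_prod c') id)"
    unfolding eqv_def
  proof
    fix \<theta> assume "\<theta> \<in> Fm L (Inl ` seq_names I \<union> Inr ` M)"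
    then show "holds \<MM> (case_sum (case_prod c) id) \<theta> = holds \<MM> (case_sum (case_prod c') id) \<theta>"
      using wT[of \<theta>] wT[of "Neg \<theta>"] by (auto simp: T_def Neg_Fm holds_Neg w_c')
  qed
  then have "morley I p M c'"
    using morley_eqv[OF p names_M_id[OF order_refl], of c c'] M_univ c c'_univ by simp
  moreover have "eqv (Inl ` I \<union> Inr ` D) (case_sum (c' 0) id) (case_sum (c' k) id)" for k
    unfolding eqv_def
  proof
    fix \<phi> assume "\<phi> \<in> ?W"
    from complete[OF this] show "holds \<MM> (case_sum (c' 0) id) \<phi> = holds \<MM> (case_sum (c' k) id) \<phi>"
      using wt[of \<phi>] wt[of "Neg \<phi>"] unfolding holds_Neg by blast
  qed
  ultimately show ?thesis using wt t(1) by blast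
qed

section \<open>Conant-independence from a Morley sequence\<close>

text \<open>All members of the sequence have the same type over \<open>D\<close>, so \<open>D\<close> itself is a solution along the
  sequence of every formula that it satisfies with the first member.\<close>

lemma conant_indep_morley:
  fixes I :: "'i set" and D :: "'a set"
  assumes p: "invariant I p" and c: "morley I p M c" and D: "M \<subseteq> D" "D \<subseteq> univ \<MM>"
    and same: "\<And>k. eqv (Inl ` I \<union> Inr ` D) (case_sum (c 0) id) (case_sum (c k) id)"
  shows "conant_indep L \<MM> M D id (c 0 ` I)"
  unfolding conant_indep_def
proof (intro allI ballI impI)
  fix n d and \<phi> :: "('f, 'r, 'a + nat) fm"
  assume \<phi>: "\<phi> \<in> Fm L (Inl ` D \<union> Inr ` {..<n})"
    and d: "d ` {..<n} \<subseteq> M \<union> c 0 ` I \<and> inst \<phi> d \<in> tp L \<MM> D id (M \<union> c 0 ` I)"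
  define h where "h l = (if d l \<in> M then Inr (d l) else Inl (SOME x. x \<in> I \<and> c 0 x = d l))" for l
  have coord: "(SOME x. x \<in> I \<and> c 0 x = d l) \<in> I \<and> c 0 (SOME x. x \<in> I \<and> c 0 x = d l) = d l"
    if "l < n" "d l \<notin> M" for l
  proof (rule someI_ex)
    have "d l \<in> M \<union> c 0 ` I" using d that(1) by auto
    then show "\<exists>x. x \<in> I \<and> c 0 x = d l" using that(2) by auto
  qed
  have h: "h l \<in> Inl ` I \<union> Inr ` M" if "l \<in> {..<n}" for l
    using coord[of l] that by (cases "d l \<in> M") (simp_all add: h_def)
  define bs where "bs i l = case_sum (c i) id (h l)" for i l
  have bs0: "bs 0 l = d l" if "l < n" for l
    using coord[OF that] by (cases "d l \<in> M") (simp_all add: bs_def h_def)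
  have "invariant_morley_seq L \<MM> M {..<n} bs"
    unfolding invariant_morley_seq_def bs_def[abs_def]
    by (intro exI[of _ "pushforward {..<n} h p"] conjI pushforward_invariant[OF p h]
        pushforward_morley[OF p h c])
  moreover have "consistent \<MM> D (range (\<lambda>i. inst \<phi> (bs i)))"
  proof -
    have "holds \<MM> (case_sum id d) \<phi>" using d by (simp add: tp_def holds_inst)
    moreover have "holds \<MM> (case_sum id d) \<phi> = holds \<MM> (case_sum id (bs 0)) \<phi>"
      by (rule holds_cong_Fm[OF \<phi>]) (auto simp: bs0)
    moreover have "eqv (Inl ` D \<union> Inr ` {..<n}) (case_sum id (bs 0)) (case_sum id (bs i))" for i
    proof (rule eqv_ren[OF same, where g = "case_sum Inr h"])
      fix v :: "'a + nat" assume v: "v \<in> Inl ` D \<union> Inr ` {..<n}"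
      show "case_sum Inr h v \<in> Inl ` I \<union> Inr ` D"
      proof (cases v)
        case (Inr l)
        then have "h l \<in> Inl ` I \<union> Inr ` M" using v by (intro h) auto
        then show ?thesis using D(1) Inr by auto
      qed (use v in auto)
      show "case_sum id (bs 0) v = case_sum (c 0) id (case_sum Inr h v)"
        "case_sum id (bs i) v = case_sum (c i) id (case_sum Inr h v)"
        by (simp_all add: bs_def split: sum.split)
    qed
    ultimately have "holds \<MM> (case_sum id (bs i)) \<phi>" for i using eqvD[OF _ \<phi>] by blast
    then have "realizes \<MM> D id (range (\<lambda>i. inst \<phi> (bs i)))"
      using D(2) by (auto simp: realizes_def holds_inst)
    then show ?thesis unfolding consistent_def using realizes_mono by metis
  qed
  ultimately show "\<not> conant_divides L \<MM> M D n \<phi> d"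
    unfolding conant_divides_def using bs0 by blast
qed

text \<open>Symmetry is about sets, which are tuples indexed by themselves; repeated entries of \<open>c\<close> are
  identified.\<close>

lemma conant_indep_reindex:
  fixes I :: "'i set" and c :: "'i \<Rightarrow> 'a"
  assumes "conant_indep L \<MM> M (c ` I) id B" and c: "c ` I \<subseteq> univ \<MM>"
  shows "conant_indep L \<MM> M I c B"
  unfolding conant_indep_def
proof (intro allI ballI impI notI)
  fix n d and \<phi> :: "('f, 'r, 'i + nat) fm"
  assume \<phi>: "\<phi> \<in> Fm L (Inl ` I \<union> Inr ` {..<n})"
    and d: "d ` {..<n} \<subseteq> M \<union> B \<and> inst \<phi> d \<in> tp L \<MM> I c (M \<union> B)"
    and div: "conant_divides L \<MM> M I n \<phi> d"
  define \<phi>' where "\<phi>' = ren (map_sum c id) \<phi>"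
  have \<phi>': "\<phi>' \<in> Fm L (Inl ` c ` I \<union> Inr ` {..<n})" unfolding \<phi>'_def using \<phi> by (rule ren_in_Fm) auto
  have inst': "inst \<phi>' b = ren (map_sum c id) (inst \<phi> b)" for b :: "nat \<Rightarrow> 'a"
    unfolding \<phi>'_def inst_def ren_ren by (rule ren_cong) (simp add: map_sum_def split: sum.split)
  have holds': "holds \<MM> (case_sum w id) (ren (map_sum c id) \<chi>) \<longleftrightarrow> holds \<MM> (case_sum (w \<circ> c) id) \<chi>"
    for w and \<chi> :: "('f, 'r, 'i + 'a) fm"
    unfolding holds_ren by (rule holds_cong) (simp add: map_sum_def split: sum.split)
  have "inst \<phi>' d \<in> tp L \<MM> (c ` I) id (M \<union> B)"
  proof -
    have "inst \<phi> d \<in> Fm L (Inl ` I \<union> Inr ` (M \<union> B))" "holds \<MM> (case_sum c id) (inst \<phi> d)"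
      using d by (simp_all add: tp_def)
    moreover from this(1) have "inst \<phi>' d \<in> Fm L (Inl ` c ` I \<union> Inr ` (M \<union> B))"
      unfolding inst' by (rule ren_in_Fm) auto
    ultimately show ?thesis unfolding tp_def inst' by (simp add: holds')
  qed
  then have "\<not> conant_divides L \<MM> M (c ` I) n \<phi>' d"
    using assms(1) \<phi>' d unfolding conant_indep_def by blast
  then obtain bs where bs: "invariant_morley_seq L \<MM> M {..<n} bs" "\<forall>j<n. bs 0 j = d j"
    "consistent \<MM> (c ` I) (range (\<lambda>i. inst \<phi>' (bs i)))" unfolding conant_divides_def by blast
  have "consistent \<MM> I (range (\<lambda>i. inst \<phi> (bs i)))"
    unfolding consistent_def
  proof (intro allI impI)
    fix F assume F: "finite F \<and> F \<subseteq> range (\<lambda>i. inst \<phi> (bs i))"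
    then have "finite (ren (map_sum c id) ` F)" "ren (map_sum c id) ` F \<subseteq> range (\<lambda>i. inst \<phi>' (bs i))"
      unfolding inst' by auto
    then obtain w where w: "realizes \<MM> (c ` I) w (ren (map_sum c id) ` F)"
      using bs(3) unfolding consistent_def by meson
    then have "realizes \<MM> I (w \<circ> c) F" by (simp add: realizes_def holds' image_comp)
    then show "\<exists>w. realizes \<MM> I w F" by blast
  qed
  then show False using div bs(1,2) unfolding conant_divides_def by blast
qed

end

section \<open>The amalgamation theorem\<close>

theorem mainTheorem4:
  fixes L :: "('f, 'r) lang" and T :: "('f, 'r, nat) fm set" and \<kappa> :: "'k rel"
    and \<MM> :: "('f, 'r, 'a) struct" and M :: "'a set" and I :: "'i set"
    and p q :: "('f, 'r, 'i + 'a) fm set"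
    and p\<omega> q\<omega> :: "('f, 'r, (nat \<times> 'i) + 'a) fm set"
    and a b :: "'a set"
  assumes "complete_theory L T" and "monster L T \<kappa> \<MM>"
    and "\<not> SOP L \<MM> 3"
    and "conant_indep_symmetric L \<kappa> \<MM>"
    and "small_model L \<kappa> \<MM> M"
    and "small \<kappa> I"
    and "invariant_type L \<MM> M I p" and "invariant_type L \<MM> M I q"
    and "is_omega_power L \<kappa> \<MM> M I p p\<omega>" and "is_omega_power L \<kappa> \<MM> M I q q\<omega>"
    and "p\<omega> \<restriction> M = q\<omega> \<restriction> M"
    and "M \<subseteq> a" and "a \<subseteq> univ \<MM>" and "small \<kappa> a"
    and "M \<subseteq> b" and "b \<subseteq> univ \<MM>" and "small \<kappa> b"
    and "kim_indep L \<MM> M a id b"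
  shows "\<exists>c. realizes \<MM> I c (p \<restriction> a \<union> q \<restriction> b) \<and> conant_indep L \<MM> M I c (a \<union> b)"
proof -
  interpret saturated_over_model L \<kappa> \<MM> M
    using assms(2,5) by unfold_locales (auto simp: monster_def is_model_def is_struct_def)
  note I = assms(6) and p = assms(7) and q = assms(8) and p\<omega> = assms(9) and q\<omega> = assms(10)
  have inv: "invariant (seq_names I) p\<omega>" "invariant (seq_names I) q\<omega>"
    using p\<omega> q\<omega> unfolding is_omega_power_def by blast+
  note p_iff = omega_power_iff[OF p\<omega>] and q_iff = omega_power_iff[OF q\<omega>]
  have pq: "morley I p M c \<longleftrightarrow> morley I q M c" for c
    using p_iff[OF order_refl M_univ M_small] q_iff[OF order_refl M_univ M_small] assms(11) by simp
  have pq\<omega>: "morley (seq_names I) p\<omega> M e \<longleftrightarrow> morley (seq_names I) q\<omega> M e" for e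
    using omega_power_morley[OF I q p\<omega> q\<omega>] omega_power_morley[OF I p q\<omega> p\<omega>] pq by blast
  have "consistent \<MM> (seq_names I) (p\<omega> \<restriction> a \<union> q\<omega> \<restriction> b)"
    by (rule amalgam_consistent[OF assms(3) inv small_Times_nat[OF I] pq\<omega> assms(18,12,13,14,16,17)])
  define D where "D = a \<union> b"
  have D: "M \<subseteq> D" "D \<subseteq> univ \<MM>" "small \<kappa> D" "a \<subseteq> D" "b \<subseteq> D"
    using assms(12,13,14,16,17) unfolding D_def by (auto intro: small_Un)
  have sub: "Inl ` X \<union> Inr ` a \<subseteq> Inl ` X \<union> Inr ` D" "Inl ` X \<union> Inr ` b \<subseteq> Inl ` X \<union> Inr ` D"
    for X :: "'x set" using D(4,5) by auto
  have "p\<omega> \<restriction> a \<union> q\<omega> \<restriction> b \<subseteq> Fm L (Inl ` seq_names I \<union> Inr ` D)"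
    using restr_Fm[OF inv(1), of a] restr_Fm[OF inv(2), of b] Fm_mono[OF sub(1)] Fm_mono[OF sub(2)] by blast
  from realize_small[OF this \<open>consistent \<MM> (seq_names I) (p\<omega> \<restriction> a \<union> q\<omega> \<restriction> b)\<close> D(2,3) small_Times_nat[OF I]]
  obtain e where e: "realizes \<MM> (seq_names I) e (p\<omega> \<restriction> a \<union> q\<omega> \<restriction> b)" .
  define c where "c k x = e (k, x)" for k x
  have e_c: "e = case_prod c" by (auto simp: c_def)
  have "realizes \<MM> (seq_names I) (case_prod c) (p\<omega> \<restriction> a)" "realizes \<MM> (seq_names I) (case_prod c) (q\<omega> \<restriction> b)"
    using e unfolding e_c by (auto intro: realizes_mono)
  then have c: "morley I p a c" "morley I q b c"
    using p_iff[OF assms(12,13,14)] q_iff[OF assms(15,16,17)] by blast+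
  have cM: "morley I p M c" by (rule morley_mono[OF c(1) assms(12)])
  have \<Phi>: "p \<restriction> a \<union> q \<restriction> b \<subseteq> Fm L (Inl ` I \<union> Inr ` D)"
    using restr_Fm[OF p, of a] restr_Fm[OF q, of b] Fm_mono[OF sub(1)] Fm_mono[OF sub(2)] by blast
  have "holds \<MM> (case_sum (c k) id) \<phi>" if "\<phi> \<in> p \<restriction> a \<union> q \<restriction> b" for k \<phi>
    using that morley_realizes[OF c(1), of k] morley_realizes[OF c(2), of k] unfolding realizes_def by blast
  from morley_thin[OF p I D(1-3) cM \<Phi> this] obtain c' where c': "morley I p M c'"
    "\<And>k \<phi>. \<phi> \<in> p \<restriction> a \<union> q \<restriction> b \<Longrightarrow> holds \<MM> (case_sum (c' k) id) \<phi>"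
    "\<And>k. eqv (Inl ` I \<union> Inr ` D) (case_sum (c' 0) id) (case_sum (c' k) id)" by blast
  have "conant_indep L \<MM> M D id (c' 0 ` I)" by (rule conant_indep_morley[OF p c'(1) D(1,2) c'(3)])
  moreover have "c' 0 ` I \<subseteq> univ \<MM>" by (rule morley_univ[OF c'(1)])
  ultimately have "conant_indep L \<MM> M (c' 0 ` I) id D"
    using assms(4,5) D(2,3) small_image[OF I] unfolding conant_indep_symmetric_def by blast
  then have "conant_indep L \<MM> M I (c' 0) D" by (rule conant_indep_reindex[OF _ morley_univ[OF c'(1)]])
  moreover have "realizes \<MM> I (c' 0) (p \<restriction> a \<union> q \<restriction> b)"
    using c'(2) morley_univ[OF c'(1), of 0] unfolding realizes_def by blast
  ultimately show ?thesis unfolding D_def by blast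
qed

end
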